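(* For every $\lambda>0$, the multiplication operator $M_z$ on $(\mathcal H,K_{(-1)}K^{(\lambda)})$ is a Möbius bounded weakly homogeneous operator which is not similar to any homogeneous operator.
   Context: $\mathbb D$ is the open unit disc in $\mathbb C$. Möb is the group of all biholomorphic automorphisms of $\mathbb D$. For a bounded operator $T$ on a complex separable Hilbert space with $\sigma(T)\subseteq\overline{\mathbb D}$, $\varphi(T)$ is defined by the holomorphic functional calculus. Such a $T$ is homogeneous if $\varphi(T)$ is unitarily equivalent to $T$ for all $\varphi\in$ Möb; weakly homogeneous if $\varphi(T)$ is similar to $T$ (i.e. $\varphi(T)=LTL^{-1}$ for some bounded invertible $L$, depending on $\varphi$) for all $\varphi\in$ Möb; Möbius bounded if $\sup_{\varphi\in \text{Möb}}\|\varphi(T)\|<\infty$ (all three notions include the requirement $\sigma(T)\subseteq\overline{\mathbb D}$). $K_{(-1)}(z,w)=\sum_{n=0}^\infty\frac{1}{n+1}(z\bar w)^n$ is the Dirichlet kernel and $K^{(\lambda)}(z,w)=(1-z\bar w)^{-\lambda}$ on $\mathbb D\times\mathbb D$; $K_{(-1)}K^{(\lambda)}$ is their pointwise product. $(\mathcal H,K)$ denotes the reproducing kernel Hilbert space of holomorphic functions on $\mathbb D$ with kernel $K$, and $M_z$ is multiplication by the coordinate function $z$. *)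

theory Defs
  imports "HOL-Complex_Analysis.Complex_Analysis" "HOL-Library.Function_Algebras"
begin

section \<open>Complex Hilbert spaces and their bounded operators\<close>

text \<open>
  A Hilbert space is given by a carrier inside an ambient additive group, so that function spaces
  depending on a real parameter are covered.  The inner product is linear in its first argument;
  its values off the carrier are irrelevant.
\<close>

record 'a hilbert =
  hcarrier :: "'a set"
  hscale :: "complex \<Rightarrow> 'a \<Rightarrow> 'a"
  hinner :: "'a \<Rightarrow> 'a \<Rightarrow> complex"

definition hnorm :: "'a hilbert \<Rightarrow> 'a \<Rightarrow> real" where
  "hnorm H x = sqrt (Re (hinner H x x))"

locale hilbert_space = vector_space "hscale H"
  for H :: "'a::ab_group_add hilbert" +
  assumes subspace_carrier: "subspace (hcarrier H)"
    and inner_commute: "\<lbrakk>x \<in> hcarrier H; y \<in> hcarrier H\<rbrakk> \<Longrightarrow> hinner H x y = cnj (hinner H y x)"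
    and inner_add_left: "\<lbrakk>x \<in> hcarrier H; y \<in> hcarrier H; z \<in> hcarrier H\<rbrakk>
          \<Longrightarrow> hinner H (x + y) z = hinner H x z + hinner H y z"
    and inner_scale_left: "\<lbrakk>x \<in> hcarrier H; y \<in> hcarrier H\<rbrakk>
          \<Longrightarrow> hinner H (hscale H c x) y = c * hinner H x y"
    and inner_pos: "\<lbrakk>x \<in> hcarrier H; x \<noteq> 0\<rbrakk> \<Longrightarrow> Re (hinner H x x) > 0"
    and complete: "\<lbrakk>\<And>n. X n \<in> hcarrier H;
            \<And>e. e > 0 \<Longrightarrow> \<exists>N. \<forall>m\<ge>N. \<forall>n\<ge>N. hnorm H (X m - X n) < e\<rbrakk>
          \<Longrightarrow> \<exists>x\<in>hcarrier H. (\<lambda>n::nat. hnorm H (X n - x)) \<longlonglongrightarrow> 0"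

definition separable_hilbert_space :: "'a::ab_group_add hilbert \<Rightarrow> bool" where
  "separable_hilbert_space H \<longleftrightarrow> hilbert_space H \<and>
     (\<exists>S\<subseteq>hcarrier H. countable S \<and> (\<forall>x\<in>hcarrier H. \<forall>e>0. \<exists>s\<in>S. hnorm H (x - s) < e))"

definition bounded_op ::
    "'a::ab_group_add hilbert \<Rightarrow> 'b::ab_group_add hilbert \<Rightarrow> ('a \<Rightarrow> 'b) \<Rightarrow> bool" where
  "bounded_op H G A \<longleftrightarrow>
     (\<forall>x\<in>hcarrier H. A x \<in> hcarrier G) \<and>
     (\<forall>x\<in>hcarrier H. \<forall>y\<in>hcarrier H. A (x + y) = A x + A y) \<and>
     (\<forall>c. \<forall>x\<in>hcarrier H. A (hscale H c x) = hscale G c (A x)) \<and>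
     (\<exists>C. \<forall>x\<in>hcarrier H. hnorm G (A x) \<le> C * hnorm H x)"

definition op_norm :: "'a hilbert \<Rightarrow> ('a \<Rightarrow> 'a) \<Rightarrow> real" where
  "op_norm H A = Sup {hnorm H (A x) |x. x \<in> hcarrier H \<and> hnorm H x \<le> 1}"

definition spectrum :: "'a::ab_group_add hilbert \<Rightarrow> ('a \<Rightarrow> 'a) \<Rightarrow> complex set" where
  "spectrum H T = {\<mu>. \<not> (\<exists>R. bounded_op H H R \<and>
     (\<forall>x\<in>hcarrier H. R (hscale H \<mu> x - T x) = x \<and> hscale H \<mu> (R x) - T (R x) = x))}"

definition resolvent :: "'a::ab_group_add hilbert \<Rightarrow> ('a \<Rightarrow> 'a) \<Rightarrow> complex \<Rightarrow> 'a \<Rightarrow> 'a" where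
  "resolvent H T \<mu> = inv_into (hcarrier H) (\<lambda>x. hscale H \<mu> x - T x)"

text \<open>\<open>similar_op H T G S\<close> says \<open>S = L T L\<inverse>\<close> on \<open>G\<close>, with \<open>M\<close> as \<open>L\<inverse>\<close>.\<close>

definition similar_op ::
    "'a::ab_group_add hilbert \<Rightarrow> ('a \<Rightarrow> 'a) \<Rightarrow> 'b::ab_group_add hilbert \<Rightarrow> ('b \<Rightarrow> 'b) \<Rightarrow> bool" where
  "similar_op H T G S \<longleftrightarrow> (\<exists>L M. bounded_op H G L \<and> bounded_op G H M \<and>
     (\<forall>x\<in>hcarrier H. M (L x) = x) \<and> (\<forall>y\<in>hcarrier G. L (M y) = y) \<and>
     (\<forall>y\<in>hcarrier G. S y = L (T (M y))))"

definition unitarily_equivalent ::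
    "'a::ab_group_add hilbert \<Rightarrow> ('a \<Rightarrow> 'a) \<Rightarrow> 'b::ab_group_add hilbert \<Rightarrow> ('b \<Rightarrow> 'b) \<Rightarrow> bool" where
  "unitarily_equivalent H T G S \<longleftrightarrow> (\<exists>U. bounded_op H G U \<and>
     bij_betw U (hcarrier H) (hcarrier G) \<and>
     (\<forall>x\<in>hcarrier H. \<forall>y\<in>hcarrier H. hinner G (U x) (U y) = hinner H x y) \<and>
     (\<forall>x\<in>hcarrier H. S (U x) = U (T x)))"


section \<open>Holomorphic functional calculus and homogeneity\<close>

text \<open>Only the values on the open unit disc matter for membership.\<close>

definition moeb :: "(complex \<Rightarrow> complex) set" where
  "moeb = {\<phi>. \<phi> holomorphic_on ball 0 1 \<and> \<phi> ` ball 0 1 \<subseteq> ball 0 1 \<and>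
     (\<exists>\<psi>. \<psi> holomorphic_on ball 0 1 \<and> \<psi> ` ball 0 1 \<subseteq> ball 0 1 \<and>
        (\<forall>z\<in>ball 0 1. \<psi> (\<phi> z) = z \<and> \<phi> (\<psi> z) = z))}"

text \<open>
  \<open>hol_calculus H T f A\<close> says that \<open>A = f(T)\<close> in the Riesz-Dunford calculus, for an operator \<open>T\<close>
  whose spectrum lies in the closed unit disc and a function \<open>f\<close> on the open disc that extends
  holomorphically (as \<open>F\<close>) to a neighbourhood of the closed disc:
  \<open>f(T) = 1/(2 \<pi> i) \<integral> F(\<zeta>) (\<zeta> - T)\<inverse> d\<zeta>\<close> over a circle of radius \<open>r > 1\<close>.  The
  operator-valued integral is taken weakly.  Neither \<open>F\<close> on the closed disc nor the value of the
  integral depends on the choices of \<open>\<rho>\<close> and \<open>r\<close>.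
\<close>

definition hol_calculus ::
    "'a::ab_group_add hilbert \<Rightarrow> ('a \<Rightarrow> 'a) \<Rightarrow> (complex \<Rightarrow> complex) \<Rightarrow> ('a \<Rightarrow> 'a) \<Rightarrow> bool" where
  "hol_calculus H T f A \<longleftrightarrow> bounded_op H H A \<and>
     (\<exists>\<rho> F r. 1 < r \<and> r < \<rho> \<and> F holomorphic_on ball 0 \<rho> \<and> (\<forall>z\<in>ball 0 1. F z = f z) \<and>
        (\<forall>x\<in>hcarrier H. \<forall>y\<in>hcarrier H.
           ((\<lambda>\<zeta>. F \<zeta> * hinner H (resolvent H T \<zeta> x) y) has_contour_integral
             2 * of_real pi * \<i> * hinner H (A x) y) (circlepath 0 r)))"

definition disc_operator :: "'a::ab_group_add hilbert \<Rightarrow> ('a \<Rightarrow> 'a) \<Rightarrow> bool" where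
  "disc_operator H T \<longleftrightarrow>
     separable_hilbert_space H \<and> bounded_op H H T \<and> spectrum H T \<subseteq> cball 0 1"

definition homogeneous :: "'a::ab_group_add hilbert \<Rightarrow> ('a \<Rightarrow> 'a) \<Rightarrow> bool" where
  "homogeneous H T \<longleftrightarrow> disc_operator H T \<and>
     (\<forall>\<phi>\<in>moeb. \<exists>A. hol_calculus H T \<phi> A \<and> unitarily_equivalent H T H A)"

definition weakly_homogeneous :: "'a::ab_group_add hilbert \<Rightarrow> ('a \<Rightarrow> 'a) \<Rightarrow> bool" where
  "weakly_homogeneous H T \<longleftrightarrow> disc_operator H T \<and>
     (\<forall>\<phi>\<in>moeb. \<exists>A. hol_calculus H T \<phi> A \<and> similar_op H T H A)"

definition moebius_bounded :: "'a::ab_group_add hilbert \<Rightarrow> ('a \<Rightarrow> 'a) \<Rightarrow> bool" where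
  "moebius_bounded H T \<longleftrightarrow> disc_operator H T \<and>
     (\<exists>C. \<forall>\<phi>\<in>moeb. \<exists>A. hol_calculus H T \<phi> A \<and> op_norm H A \<le> C)"


section \<open>Reproducing kernel Hilbert spaces on the disc\<close>

text \<open>
  Functions on the disc are represented by functions on \<open>\<complex>\<close> vanishing off the disc.  With this
  convention the carrier, and the inner product on it, are determined by \<open>K\<close>.
\<close>

definition is_rkhs ::
    "(complex \<Rightarrow> complex) hilbert \<Rightarrow> (complex \<Rightarrow> complex \<Rightarrow> complex) \<Rightarrow> bool" where
  "is_rkhs H K \<longleftrightarrow> hilbert_space H \<and>
     hscale H = (\<lambda>c f z. c * f z) \<and>
     (\<forall>f\<in>hcarrier H. f holomorphic_on ball 0 1 \<and> (\<forall>z. z \<notin> ball 0 1 \<longrightarrow> f z = 0)) \<and>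
     (\<forall>w\<in>ball 0 1. (\<lambda>z. if z \<in> ball 0 1 then K z w else 0) \<in> hcarrier H \<and>
        (\<forall>f\<in>hcarrier H. hinner H f (\<lambda>z. if z \<in> ball 0 1 then K z w else 0) = f w))"

definition mult_z :: "(complex \<Rightarrow> complex) \<Rightarrow> complex \<Rightarrow> complex" where
  "mult_z f = (\<lambda>z. z * f z)"

definition dirichlet_kernel :: "complex \<Rightarrow> complex \<Rightarrow> complex" where
  "dirichlet_kernel z w = (\<Sum>n. 1 / of_nat (n + 1) * (z * cnj w) ^ n)"

text \<open>Since \<open>Re (1 - z * cnj w) > 0\<close> on the disc, the principal branch of the power is meant.\<close>

definition power_kernel :: "real \<Rightarrow> complex \<Rightarrow> complex \<Rightarrow> complex" where
  "power_kernel l z w = (1 - z * cnj w) powr (- of_real l)"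

end

theory Submission
  imports Defs
begin

text \<open>
  Write \<open>D\<close> for the Dirichlet kernel, \<open>P\<close> for the power kernel \<open>(1 - z * cnj w)\<^sup>-\<^sup>l\<close>, \<open>K = D P\<close>, and
  order kernels by positive semidefiniteness of the difference.

  A weighted composition operator \<open>f \<mapsto> \<psi> (f \<circ> \<phi>)\<close> has norm at most \<open>C\<close> on the space with kernel
  \<open>K\<close> as soon as \<open>\<psi> z * K (\<phi> z) (\<phi> w) * cnj (\<psi> w) \<le> C\<^sup>2 K z w\<close> (\<open>weighted_composition\<close>).  Both factors
  of \<open>K\<close> are power series in \<open>z * cnj w\<close> with nonnegative coefficients, so an inequality involving one
  factor may be multiplied by the other (\<open>psd_power_series_mult\<close>).

  For Moebius boundedness, \<open>P\<close> is invariant under every automorphism \<open>\<phi>\<close>, up to a weight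
  (\<open>power_kernel_invariant\<close>).  Hence multiplication by \<open>\<phi>\<close> on the space of \<open>P\<close> is bounded by the same
  constant as multiplication by \<open>z\<close>, and multiplying by \<open>D\<close> preserves this (\<open>psd_multiplier\<close>).

  For weak homogeneity, \<open>D\<close> composed with \<open>\<phi>\<close> is dominated by a multiple of \<open>D\<close>
  (\<open>psd_dirichlet_moebius\<close>).  With the weight \<open>\<psi>\<close> that makes \<open>P\<close> invariant, \<open>f \<mapsto> \<psi> (f \<circ> \<phi>)\<close> is
  therefore bounded, and so is its inverse, which is of the same kind; it carries \<open>M\<^sub>z\<close> to
  \<open>M\<^sub>\<phi>\<close>, which is \<open>\<phi>(M\<^sub>z)\<close> by Cauchy's formula tested on kernel functions (\<open>cauchy_integral\<close>).

  Suppose finally that \<open>M\<^sub>z\<close> were similar to a homogeneous \<open>S\<close> on \<open>G\<close>.  The eigenvectors \<open>k w\<close> of the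
  adjoint of \<open>S\<close> give a kernel \<open>\<langle>k w, k z\<rangle>\<close> comparable with \<open>K\<close> on the diagonal, where \<open>K\<close> grows like
  \<open>(1 - ln x) x\<^sup>-\<^sup>l\<close> with \<open>x = 1 - \<bar>w\<bar>\<^sup>2\<close>.  Eigenspaces being one dimensional
  (\<open>adjoint_eigenvector\<close>), homogeneity makes this kernel invariant under every automorphism up to a
  factor \<open>g z * cnj (g w)\<close>.  If the growth of such a kernel is radial up to constants then it is that
  of a power of \<open>x\<close>, and the logarithm contradicts this (\<open>no_quasi_invariant_kernel\<close>).
\<close>

section \<open>Geometry of Hilbert spaces\<close>

context hilbert_space
begin

lemma carrier_zero: "0 \<in> hcarrier H"
  using subspace_carrier by (rule subspace_0)

lemma carrier_add: "x \<in> hcarrier H \<Longrightarrow> y \<in> hcarrier H \<Longrightarrow> x + y \<in> hcarrier H"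
  using subspace_carrier by (rule subspace_add)

lemma carrier_scale: "x \<in> hcarrier H \<Longrightarrow> hscale H c x \<in> hcarrier H"
  using subspace_carrier by (rule subspace_scale)

lemma carrier_diff: "x \<in> hcarrier H \<Longrightarrow> y \<in> hcarrier H \<Longrightarrow> x - y \<in> hcarrier H"
  using subspace_carrier by (rule subspace_diff)

lemma inner_diff_left:
  assumes "x \<in> hcarrier H" "y \<in> hcarrier H" "z \<in> hcarrier H"
  shows "hinner H (x - y) z = hinner H x z - hinner H y z"
  using inner_add_left[of "x - y" y z] assms carrier_diff by simp

lemma inner_add_right:
  assumes "x \<in> hcarrier H" "y \<in> hcarrier H" "z \<in> hcarrier H"
  shows "hinner H x (y + z) = hinner H x y + hinner H x z"
  using assms
  by (metis carrier_add complex_cnj_add inner_add_left inner_commute)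

lemma inner_diff_right:
  assumes "x \<in> hcarrier H" "y \<in> hcarrier H" "z \<in> hcarrier H"
  shows "hinner H x (y - z) = hinner H x y - hinner H x z"
  using inner_add_right[of x "y - z" z] assms carrier_diff by simp

lemma inner_scale_right:
  assumes "x \<in> hcarrier H" "y \<in> hcarrier H"
  shows "hinner H x (hscale H c y) = cnj c * hinner H x y"
  using assms by (metis carrier_scale complex_cnj_mult inner_commute inner_scale_left)

lemma inner_zero_left: "x \<in> hcarrier H \<Longrightarrow> hinner H 0 x = 0"
  using inner_add_left[of 0 0 x] carrier_zero by simp

lemma inner_zero_right: "x \<in> hcarrier H \<Longrightarrow> hinner H x 0 = 0"
  using inner_add_right[of x 0 0] carrier_zero by simp

lemma inner_self_ge_0: "x \<in> hcarrier H \<Longrightarrow> 0 \<le> Re (hinner H x x)"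
  using inner_pos[of x] inner_zero_left[OF carrier_zero] by (cases "x = 0") (auto simp: less_imp_le)

lemma hnorm_power2: "x \<in> hcarrier H \<Longrightarrow> (hnorm H x)\<^sup>2 = Re (hinner H x x)"
  unfolding hnorm_def by (simp add: inner_self_ge_0)

lemma inner_self: 
  assumes "x \<in> hcarrier H"
  shows "hinner H x x = of_real ((hnorm H x)\<^sup>2)"
proof -
  have "hinner H x x = cnj (hinner H x x)"
    using inner_commute assms by blast
  then show ?thesis
    unfolding hnorm_power2[OF assms] by (auto simp: complex_eq_iff)
qed

lemma hnorm_ge_0: "x \<in> hcarrier H \<Longrightarrow> 0 \<le> hnorm H x"
  unfolding hnorm_def by (simp add: inner_self_ge_0)

lemma hnorm_zero: "hnorm H 0 = 0"
  unfolding hnorm_def by (simp add: inner_zero_left[OF carrier_zero])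

lemma hnorm_eq_0: "x \<in> hcarrier H \<Longrightarrow> hnorm H x = 0 \<Longrightarrow> x = 0"
  using inner_pos[of x] hnorm_power2[of x] by fastforce

lemma hnorm_scale:
  assumes "x \<in> hcarrier H" shows "hnorm H (hscale H c x) = cmod c * hnorm H x"
proof -
  have "hinner H (hscale H c x) (hscale H c x) = of_real ((cmod c)\<^sup>2) * hinner H x x"
    using assms by (simp add: inner_scale_left inner_scale_right carrier_scale
        complex_norm_square mult.assoc del: of_real_power)
  then show ?thesis
    unfolding hnorm_def by (simp add: real_sqrt_mult)
qed

lemma hnorm_add_power2:
  assumes "x \<in> hcarrier H" "y \<in> hcarrier H"
  shows "(hnorm H (x + y))\<^sup>2 = (hnorm H x)\<^sup>2 + 2 * Re (hinner H x y) + (hnorm H y)\<^sup>2"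
proof -
  have "Re (hinner H y x) = Re (hinner H x y)"
    using inner_commute[of y x] assms by simp
  then show ?thesis
    using assms by (simp add: hnorm_power2 carrier_add inner_add_left inner_add_right)
qed

lemma hnorm_diff_power2:
  assumes "x \<in> hcarrier H" "y \<in> hcarrier H"
  shows "(hnorm H (x - y))\<^sup>2 = (hnorm H x)\<^sup>2 - 2 * Re (hinner H x y) + (hnorm H y)\<^sup>2"
proof -
  have "Re (hinner H y x) = Re (hinner H x y)"
    using inner_commute[of y x] assms by simp
  then show ?thesis
    using assms by (simp add: hnorm_power2 carrier_diff inner_diff_left inner_diff_right)
qed

lemma hnorm_minus_commute:
  assumes "x \<in> hcarrier H" "y \<in> hcarrier H"
  shows "hnorm H (x - y) = hnorm H (y - x)"
proof -
  have "(hnorm H (x - y))\<^sup>2 = (hnorm H (y - x))\<^sup>2"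
    using assms inner_commute[of x y] by (simp add: hnorm_diff_power2)
  then show ?thesis
    using assms by (simp add: hnorm_ge_0 carrier_diff)
qed

lemma cauchy_schwarz:
  assumes "x \<in> hcarrier H" "y \<in> hcarrier H"
  shows "cmod (hinner H x y) \<le> hnorm H x * hnorm H y"
proof (cases "y = 0")
  case True
  then show ?thesis using assms by (simp add: inner_zero_right hnorm_zero)
next
  case False
  then have pos: "hnorm H y > 0"
    using assms hnorm_eq_0[of y] hnorm_ge_0[of y] by fastforce
  define t where "t = hinner H x y / of_real ((hnorm H y)\<^sup>2)"
  have "0 \<le> (hnorm H (x - hscale H t y))\<^sup>2" by simp
  also have "\<dots> = (hnorm H x)\<^sup>2 - 2 * Re (cnj t * hinner H x y) + (cmod t * hnorm H y)\<^sup>2"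
    using assms by (simp add: hnorm_diff_power2 carrier_scale inner_scale_right hnorm_scale)
  also have "cnj t * hinner H x y = of_real ((cmod (hinner H x y))\<^sup>2 / (hnorm H y)\<^sup>2)"
    unfolding t_def by (simp add: complex_norm_square mult.commute del: of_real_power)
  also have "cmod t * hnorm H y = cmod (hinner H x y) / hnorm H y"
    unfolding t_def using pos by (simp add: norm_divide norm_mult power2_eq_square)
  finally have "0 \<le> (hnorm H x)\<^sup>2 - (cmod (hinner H x y))\<^sup>2 / (hnorm H y)\<^sup>2"
    by (simp add: power_divide)
  then have "(cmod (hinner H x y))\<^sup>2 \<le> (hnorm H x * hnorm H y)\<^sup>2"
    using pos by (simp add: field_simps power_mult_distrib)
  then show ?thesis
    using assms hnorm_ge_0 by (meson mult_nonneg_nonneg power2_le_imp_le)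
qed

lemma hnorm_triangle:
  assumes "x \<in> hcarrier H" "y \<in> hcarrier H"
  shows "hnorm H (x + y) \<le> hnorm H x + hnorm H y"
proof -
  have "(hnorm H (x + y))\<^sup>2 \<le> (hnorm H x + hnorm H y)\<^sup>2"
    using cauchy_schwarz[OF assms] complex_Re_le_cmod[of "hinner H x y"] assms
    by (simp add: hnorm_add_power2 power2_sum)
  then show ?thesis
    using assms hnorm_ge_0 by (meson add_nonneg_nonneg power2_le_imp_le)
qed

lemma inner_tendsto_left:
  assumes X: "\<And>n. X n \<in> hcarrier H" and g: "g \<in> hcarrier H" and y: "y \<in> hcarrier H"
    and lim: "(\<lambda>n. hnorm H (X n - g)) \<longlonglongrightarrow> 0"
  shows "(\<lambda>n. hinner H (X n) y) \<longlonglongrightarrow> hinner H g y"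
proof (rule LIM_zero_cancel, rule Lim_null_comparison)
  show "\<forall>\<^sub>F n in sequentially. norm (hinner H (X n) y - hinner H g y) \<le> hnorm H (X n - g) * hnorm H y"
    using cauchy_schwarz[OF carrier_diff[OF X g] y] X g y
    by (simp add: inner_diff_left)
  show "(\<lambda>n. hnorm H (X n - g) * hnorm H y) \<longlonglongrightarrow> 0"
    using tendsto_mult_left_zero[OF lim] .
qed

lemma inner_tendsto_right:
  assumes X: "\<And>n. X n \<in> hcarrier H" and g: "g \<in> hcarrier H" and y: "y \<in> hcarrier H"
    and lim: "(\<lambda>n. hnorm H (X n - g)) \<longlonglongrightarrow> 0"
  shows "(\<lambda>n. hinner H y (X n)) \<longlonglongrightarrow> hinner H y g"
proof -
  have "(\<lambda>n. cnj (hinner H (X n) y)) \<longlonglongrightarrow> cnj (hinner H g y)"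
    by (intro tendsto_cnj inner_tendsto_left assms)
  moreover have "cnj (hinner H (X n) y) = hinner H y (X n)" for n
    using inner_commute X y by metis
  moreover have "cnj (hinner H g y) = hinner H y g"
    using inner_commute g y by metis
  ultimately show ?thesis by simp
qed

text \<open>
  The Riesz representation theorem, for a bounded functional given by its graph \<open>P\<close> on a subspace
  that need be neither closed nor dense.  Minimising \<open>\<parallel>x\<parallel>\<^sup>2 - 2 Re l\<close> over the graph produces the
  representing vector as a limit of points of the subspace; the parallelogram law makes the
  minimising sequence Cauchy.  One statement thus serves both to produce elements of the space and
  to approximate them.
\<close>

lemma riesz_graph:
  assumes B: "0 \<le> B" and zero: "(0, 0) \<in> P"
    and add: "\<And>x l y m. (x, l) \<in> P \<Longrightarrow> (y, m) \<in> P \<Longrightarrow> (x + y, l + m) \<in> P"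
    and scale: "\<And>c x l. (x, l) \<in> P \<Longrightarrow> (hscale H c x, c * l) \<in> P"
    and carr: "\<And>x l. (x, l) \<in> P \<Longrightarrow> x \<in> hcarrier H"
    and bound: "\<And>x l. (x, l) \<in> P \<Longrightarrow> cmod l \<le> B * hnorm H x"
  obtains g where "g \<in> hcarrier H" "\<And>x l. (x, l) \<in> P \<Longrightarrow> hinner H x g = l"
    "hnorm H g \<le> B" "\<And>e. e > 0 \<Longrightarrow> \<exists>(x, l)\<in>P. hnorm H (x - g) < e"
proof -
  define J where "J p = (hnorm H (fst p))\<^sup>2 - 2 * Re (snd p)" for p :: "'a \<times> complex"
  have lower: "- B\<^sup>2 \<le> J p" if "p \<in> P" for p
  proof -
    obtain x l where p: "p = (x, l)" by force
    have "Re l \<le> B * hnorm H x"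
      using bound[of x l] that p complex_Re_le_cmod[of l] by simp
    moreover have "0 \<le> (hnorm H x - B)\<^sup>2" by simp
    ultimately show ?thesis
      unfolding J_def p by (simp add: power2_diff mult.commute)
  qed
  define d where "d = Inf (J ` P)"
  have bdd: "bdd_below (J ` P)"
    using lower by (auto intro!: bdd_belowI2)
  have dle: "d \<le> J p" if "p \<in> P" for p
    unfolding d_def using bdd that by (simp add: cInf_lower)
  have "\<exists>p\<in>P. J p < d + 1 / of_nat (Suc n)" for n
    using cInf_lessD[of "J ` P" "d + 1 / of_nat (Suc n)"] zero unfolding d_def by force
  then obtain p where p: "\<And>n. p n \<in> P" and pJ: "\<And>n. J (p n) < d + 1 / of_nat (Suc n)"
    by metis
  define X where "X n = fst (p n)" for n
  define l where "l n = snd (p n)" for n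
  have XP: "(X n, l n) \<in> P" for n
    unfolding X_def l_def using p by simp
  have XH: "X n \<in> hcarrier H" for n
    using carr XP by blast
  have JX: "(hnorm H (X n))\<^sup>2 - 2 * Re (l n) < d + 1 / of_nat (Suc n)" for n
    using pJ[of n] unfolding J_def X_def l_def .
  have close: "(hnorm H (X m - X n))\<^sup>2 \<le> 2 * (1 / of_nat (Suc m)) + 2 * (1 / of_nat (Suc n))" for m n
  proof -
    have "(hscale H (1/2) (X m + X n), (1/2) * (l m + l n)) \<in> P"
      by (intro scale add XP)
    from dle[OF this] have "d \<le> (cmod (1/2) * hnorm H (X m + X n))\<^sup>2 - (Re (l m) + Re (l n))"
      unfolding J_def by (simp add: hnorm_scale carrier_add XH add_divide_distrib)
    also have "\<dots> = (hnorm H (X m + X n))\<^sup>2 / 4 - (Re (l m) + Re (l n))"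
      by (simp add: power_mult_distrib power2_eq_square)
    finally show ?thesis
      using JX[of m] JX[of n] hnorm_diff_power2[OF XH XH, of m n] hnorm_add_power2[OF XH XH, of m n]
      by linarith
  qed
  have "\<exists>g\<in>hcarrier H. (\<lambda>n. hnorm H (X n - g)) \<longlonglongrightarrow> 0"
  proof (rule complete[OF XH])
    fix e :: real assume e: "e > 0"
    obtain N where N: "4 / e\<^sup>2 < of_nat N" using reals_Archimedean2 by blast
    show "\<exists>N. \<forall>m\<ge>N. \<forall>n\<ge>N. hnorm H (X m - X n) < e"
    proof (intro exI allI impI)
      fix m n assume "N \<le> m" "N \<le> n"
      have *: "2 * (1 / of_nat (Suc k)) < e\<^sup>2 / 2" if "N \<le> k" for k
      proof -
        have "4 / e\<^sup>2 < of_nat (Suc k)" using N that by simp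
        then show ?thesis using e by (simp add: field_simps)
      qed
      have "(hnorm H (X m - X n))\<^sup>2 < e\<^sup>2"
        using close[of m n] *[OF \<open>N \<le> m\<close>] *[OF \<open>N \<le> n\<close>] by simp
      then show "hnorm H (X m - X n) < e"
        using e power2_less_imp_less less_imp_le by metis
    qed
  qed
  then obtain g where g: "g \<in> hcarrier H" and lim: "(\<lambda>n. hnorm H (X n - g)) \<longlonglongrightarrow> 0"
    by blast
  have rep: "hinner H x g = m" if xm: "(x, m) \<in> P" for x m
  proof -
    have x: "x \<in> hcarrier H" using carr xm .
    \<comment> \<open>Moving from \<open>X n\<close> to \<open>X n + t x\<close> can lower the minimised quantity by at most \<open>1 / Suc n\<close>.\<close>
    have step: "2 * Re (t * (m - hinner H x g)) \<le> (cmod t)\<^sup>2 * (hnorm H x)\<^sup>2" for t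
    proof -
      have arith: "2 * (b - a) \<le> e + T"
        if "d \<le> T + 2 * a + X - 2 * (b + l)" "X - 2 * l < d + e" for T a X b l e :: real
        using that by argo
      have ineq: "2 * Re (t * (m - hinner H x (X n))) \<le> 1 / of_nat (Suc n) + (cmod t)\<^sup>2 * (hnorm H x)\<^sup>2" for n
      proof -
        have "(hscale H t x + X n, t * m + l n) \<in> P"
          by (intro scale add XP xm)
        from dle[OF this] have "d \<le> (hnorm H (hscale H t x + X n))\<^sup>2 - 2 * Re (t * m + l n)"
          unfolding J_def by simp
        moreover have "(hnorm H (hscale H t x + X n))\<^sup>2
            = (cmod t)\<^sup>2 * (hnorm H x)\<^sup>2 + 2 * Re (t * hinner H x (X n)) + (hnorm H (X n))\<^sup>2"
          unfolding hnorm_add_power2[OF carrier_scale[OF x] XH]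
          by (simp add: x XH inner_scale_left hnorm_scale power_mult_distrib)
        moreover have "Re (t * (m - hinner H x (X n))) = Re (t * m) - Re (t * hinner H x (X n))"
          by (simp only: right_diff_distrib minus_complex.sel)
        ultimately show ?thesis
          using JX[of n] arith by (simp only: plus_complex.sel)
      qed
      have "(\<lambda>n. 2 * Re (t * (m - hinner H x (X n)))) \<longlonglongrightarrow> 2 * Re (t * (m - hinner H x g))"
        by (intro tendsto_intros inner_tendsto_right XH g x lim)
      moreover have "(\<lambda>n. 1 / of_nat (Suc n) + (cmod t)\<^sup>2 * (hnorm H x)\<^sup>2) \<longlonglongrightarrow> 0 + (cmod t)\<^sup>2 * (hnorm H x)\<^sup>2"
        by (intro tendsto_intros) (rule LIMSEQ_Suc[OF lim_1_over_n])
      ultimately show ?thesis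
        using ineq by (intro LIMSEQ_le[where X = "\<lambda>n. 2 * Re (t * (m - hinner H x (X n)))"
              and Y = "\<lambda>n. 1 / of_nat (Suc n) + (cmod t)\<^sup>2 * (hnorm H x)\<^sup>2"]) auto
    qed
    define \<delta> where "\<delta> = m - hinner H x g"
    \<comment> \<open>With \<open>t\<close> a small multiple of \<open>cnj \<delta>\<close> the linear term dominates the quadratic one.\<close>
    define e where "e = 1 / (1 + (hnorm H x)\<^sup>2)"
    have pos: "1 + (hnorm H x)\<^sup>2 > 0" by (simp add: add_pos_nonneg)
    have e: "e > 0" "e * (hnorm H x)\<^sup>2 \<le> 1"
      unfolding e_def using pos by (auto simp: field_simps)
    have "Re (cnj \<delta> * \<delta>) = (cmod \<delta>)\<^sup>2"
      by (metis Re_complex_of_real complex_norm_square mult.commute)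
    then have "Re ((of_real e * cnj \<delta>) * \<delta>) = e * (cmod \<delta>)\<^sup>2"
      by (metis Re_complex_of_real complex_norm_square mult.assoc mult.commute of_real_mult)
    then have "2 * (e * (cmod \<delta>)\<^sup>2) \<le> (cmod (of_real e * cnj \<delta>))\<^sup>2 * (hnorm H x)\<^sup>2"
      using step[of "of_real e * cnj \<delta>"] unfolding \<delta>_def by simp
    also have "\<dots> = e * (cmod \<delta>)\<^sup>2 * (e * (hnorm H x)\<^sup>2)"
      by (simp add: norm_mult power_mult_distrib power2_eq_square)
    also have "\<dots> \<le> e * (cmod \<delta>)\<^sup>2 * 1"
      using e by (intro mult_left_mono) auto
    finally have "\<delta> = 0" using e by simp
    then show ?thesis unfolding \<delta>_def by simp
  qed
  have bnd: "hnorm H g \<le> B"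
  proof -
    have "(\<lambda>n. cmod (l n)) \<longlonglongrightarrow> cmod (hinner H g g)"
      using tendsto_norm[OF inner_tendsto_left[OF XH g g lim]] rep[OF XP] by simp
    moreover have "(\<lambda>n. B * hnorm H (X n)) \<longlonglongrightarrow> B * hnorm H g"
    proof -
      have "(\<lambda>n. hnorm H (X n)) \<longlonglongrightarrow> hnorm H g"
      proof (rule LIM_zero_cancel, rule Lim_null_comparison[OF _ lim])
        have "\<bar>hnorm H (X n) - hnorm H g\<bar> \<le> hnorm H (X n - g)" for n
          using hnorm_triangle[of "X n - g" g] hnorm_triangle[of "g - X n" "X n"]
            hnorm_minus_commute[of "X n" g] XH[of n] g carrier_diff by simp
        then show "\<forall>\<^sub>F n in sequentially. norm (hnorm H (X n) - hnorm H g) \<le> hnorm H (X n - g)"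
          by simp
      qed
      then show ?thesis by (rule tendsto_mult_left)
    qed
    ultimately have "cmod (hinner H g g) \<le> B * hnorm H g"
      using bound[OF XP] by (intro LIMSEQ_le[where X = "\<lambda>n. cmod (l n)"]) auto
    then have "hnorm H g * hnorm H g \<le> B * hnorm H g"
      unfolding inner_self[OF g] by (simp add: power2_eq_square norm_mult)
    then show ?thesis
      using hnorm_ge_0[OF g] B by (auto simp: mult_le_cancel_right)
  qed
  have appr: "\<exists>(x, l)\<in>P. hnorm H (x - g) < e" if "e > 0" for e
  proof -
    have "\<forall>\<^sub>F n in sequentially. hnorm H (X n - g) < e"
      using order_tendstoD(2)[OF lim that] .
    then obtain n where "hnorm H (X n - g) < e"
      using eventually_happens'[OF sequentially_bot] by blast
    then show ?thesis using XP by blast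
  qed
  from that[OF g rep bnd appr] show thesis .
qed

lemma riesz_functional:
  assumes add: "\<And>x y. x \<in> hcarrier H \<Longrightarrow> y \<in> hcarrier H \<Longrightarrow> ell (x + y) = ell x + ell y"
    and scale: "\<And>c x. x \<in> hcarrier H \<Longrightarrow> ell (hscale H c x) = c * ell x"
    and bound: "\<And>x. x \<in> hcarrier H \<Longrightarrow> cmod (ell x) \<le> B * hnorm H x" and B: "0 \<le> B"
  obtains g where "g \<in> hcarrier H" "\<And>x. x \<in> hcarrier H \<Longrightarrow> hinner H x g = ell x"
proof -
  define P where "P = (\<lambda>x. (x, ell x)) ` hcarrier H"
  have P: "(x, l) \<in> P \<longleftrightarrow> x \<in> hcarrier H \<and> l = ell x" for x l
    unfolding P_def by auto
  have "ell 0 = 0" using add[OF carrier_zero carrier_zero] by simp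
  then have zero: "(0, 0) \<in> P"
    using carrier_zero P by simp
  obtain g where "g \<in> hcarrier H" "\<And>x l. (x, l) \<in> P \<Longrightarrow> hinner H x g = l"
    using riesz_graph[of B P] B zero P add scale bound carrier_add carrier_scale by (smt (verit))
  then show thesis using that P by blast
qed

end

lemma bounded_op_diff:
  assumes "hilbert_space H" "hilbert_space G" "bounded_op H G A" "x \<in> hcarrier H" "y \<in> hcarrier H"
  shows "A (x - y) = A x - A y"
proof -
  interpret hilbert_space H by fact
  have "A ((x - y) + y) = A (x - y) + A y"
    using assms carrier_diff unfolding bounded_op_def by blast
  then show ?thesis by simp
qed

lemma bounded_op_bound:
  assumes "hilbert_space H" "bounded_op H G A"
  obtains C where "C > 0" "\<And>x. x \<in> hcarrier H \<Longrightarrow> hnorm G (A x) \<le> C * hnorm H x"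
proof -
  interpret hilbert_space H by fact
  obtain C where C: "\<And>x. x \<in> hcarrier H \<Longrightarrow> hnorm G (A x) \<le> C * hnorm H x"
    using assms unfolding bounded_op_def by blast
  have "hnorm G (A x) \<le> max C 1 * hnorm H x" if "x \<in> hcarrier H" for x
    using C[OF that] mult_right_mono[OF max.cobounded1 hnorm_ge_0[OF that], of C 1] by linarith
  then show thesis using that[of "max C 1"] by simp
qed

section \<open>Positive semidefinite kernels\<close>

definition kernel_form :: "(complex \<Rightarrow> complex \<Rightarrow> complex) \<Rightarrow> (complex \<times> complex) list \<Rightarrow> complex" where
  "kernel_form K xs = (\<Sum>(c, z)\<leftarrow>xs. \<Sum>(d, w)\<leftarrow>xs. cnj c * d * K z w)"

text \<open>
  Lists rather than finite sets of points, because a point may then occur repeatedly: the form is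
  closed under substitution of an arbitrary self-map of the disc.  The real part of the form is the
  squared norm of a combination of kernel functions.
\<close>

definition psd :: "(complex \<Rightarrow> complex \<Rightarrow> complex) \<Rightarrow> bool" where
  "psd K \<longleftrightarrow> (\<forall>xs. snd ` set xs \<subseteq> ball 0 1 \<longrightarrow> 0 \<le> Re (kernel_form K xs))"

lemma kernel_form_cong:
  assumes "\<And>z w. z \<in> ball 0 1 \<Longrightarrow> w \<in> ball 0 1 \<Longrightarrow> K z w = K' z w" "snd ` set xs \<subseteq> ball 0 1"
  shows "kernel_form K xs = kernel_form K' xs"
proof -
  have "K (snd p) (snd q) = K' (snd p) (snd q)" if "p \<in> set xs" "q \<in> set xs" for p q
    using that assms by blast
  then show ?thesis
    unfolding kernel_form_def case_prod_unfold
    by (intro arg_cong[where f = sum_list] map_cong refl) simp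
qed

lemma psd_cong:
  assumes "psd K" "\<And>z w. z \<in> ball 0 1 \<Longrightarrow> w \<in> ball 0 1 \<Longrightarrow> K z w = K' z w"
  shows "psd K'"
  using assms(1) kernel_form_cong[OF assms(2)] unfolding psd_def by simp

lemma kernel_form_add: "kernel_form (\<lambda>z w. K z w + K' z w) xs = kernel_form K xs + kernel_form K' xs"
  unfolding kernel_form_def by (simp add: case_prod_unfold distrib_left sum_list_addf)

lemma kernel_form_scale: "kernel_form (\<lambda>z w. a * K z w) xs = a * kernel_form K xs"
  unfolding kernel_form_def
  by (simp add: case_prod_unfold sum_list_const_mult[symmetric] mult_ac)

lemma kernel_form_diff: "kernel_form (\<lambda>z w. K z w - K' z w) xs = kernel_form K xs - kernel_form K' xs"
  using kernel_form_add[of "\<lambda>z w. K z w - K' z w" K' xs] by simp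

lemma kernel_form_transform:
  "kernel_form (\<lambda>z w. f z * K (\<phi> z) (\<phi> w) * cnj (f w)) xs
     = kernel_form K (map (\<lambda>(c, z). (c * cnj (f z), \<phi> z)) xs)"
  unfolding kernel_form_def by (simp add: case_prod_unfold comp_def mult_ac)

lemma kernel_form_rank_one: "kernel_form (\<lambda>z w. f z * cnj (f w)) xs = of_real ((cmod (\<Sum>(c, z)\<leftarrow>xs. cnj c * f z))\<^sup>2)"
proof -
  have "cnj (\<Sum>(c, z)\<leftarrow>xs. cnj c * f z) = (\<Sum>(c, z)\<leftarrow>xs. c * cnj (f z))"
    by (induction xs) auto
  moreover have "kernel_form (\<lambda>z w. f z * cnj (f w)) xs =
      (\<Sum>(c, z)\<leftarrow>xs. cnj c * f z) * (\<Sum>(c, z)\<leftarrow>xs. c * cnj (f z))"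
    unfolding kernel_form_def
    by (simp add: case_prod_unfold sum_list_const_mult[symmetric] sum_list_mult_const[symmetric] mult_ac)
  ultimately show ?thesis
    by (simp add: complex_norm_square del: of_real_power)
qed

lemma psd_add: "psd K \<Longrightarrow> psd K' \<Longrightarrow> psd (\<lambda>z w. K z w + K' z w)"
  unfolding psd_def kernel_form_add by simp

lemma psd_scale: "psd K \<Longrightarrow> a \<ge> 0 \<Longrightarrow> psd (\<lambda>z w. complex_of_real a * K z w)"
  unfolding psd_def kernel_form_scale by simp

lemma psd_rank_one: "psd (\<lambda>z w. f z * cnj (f w))"
  unfolding psd_def kernel_form_rank_one by simp

lemma psd_one: "psd (\<lambda>z w. 1)"
  using psd_rank_one[of "\<lambda>_. 1"] by simp

lemma psd_transform:
  assumes "psd K" "\<And>z. z \<in> ball 0 1 \<Longrightarrow> \<phi> z \<in> ball 0 1"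
  shows "psd (\<lambda>z w. f z * K (\<phi> z) (\<phi> w) * cnj (f w))"
  unfolding psd_def kernel_form_transform
proof (intro allI impI)
  fix xs :: "(complex \<times> complex) list" assume "snd ` set xs \<subseteq> ball 0 1"
  then have "snd ` set (map (\<lambda>(c, z). (c * cnj (f z), \<phi> z)) xs) \<subseteq> ball 0 1"
    using assms(2) by force
  then show "0 \<le> Re (kernel_form K (map (\<lambda>(c, z). (c * cnj (f z), \<phi> z)) xs))"
    using assms(1) unfolding psd_def by blast
qed

lemma sums_sum_list:
  fixes f :: "nat \<Rightarrow> 'b \<Rightarrow> 'c::real_normed_vector"
  assumes "\<And>x. x \<in> set xs \<Longrightarrow> (\<lambda>n. f n x) sums g x"
  shows "(\<lambda>n. \<Sum>x\<leftarrow>xs. f n x) sums (\<Sum>x\<leftarrow>xs. g x)"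
  using assms by (induction xs) (auto intro!: sums_add)

lemma psd_sums:
  assumes "\<And>n. psd (K n)"
    and "\<And>z w. z \<in> ball 0 1 \<Longrightarrow> w \<in> ball 0 1 \<Longrightarrow> (\<lambda>n. K n z w) sums L z w"
  shows "psd L"
  unfolding psd_def
proof (intro allI impI)
  fix xs :: "(complex \<times> complex) list" assume xs: "snd ` set xs \<subseteq> ball 0 1"
  have "(\<lambda>n. kernel_form (K n) xs) sums kernel_form L xs"
    unfolding kernel_form_def using xs
    by (auto simp: case_prod_unfold intro!: sums_sum_list sums_mult assms(2))
  then have lim: "(\<lambda>n. Re (kernel_form (K n) xs)) sums Re (kernel_form L xs)"
    by (rule sums_Re)
  have pos: "0 \<le> Re (kernel_form (K n) xs)" for n
    using assms(1) xs unfolding psd_def by blast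
  show "0 \<le> Re (kernel_form L xs)"
    by (rule sums_le[OF pos sums_zero lim])
qed

text \<open>
  The only case of the Schur product theorem that is used: the factor \<open>q(z * cnj w)\<close> is a sum of
  rank one kernels \<open>c n * z ^ n * cnj w ^ n\<close>, and multiplication by a rank one kernel is a rescaling
  of the coefficients in the quadratic form.
\<close>

lemma psd_power_series_mult:
  assumes K: "psd K" and c: "\<And>n. c n \<ge> 0"
    and q: "\<And>x. cmod x < 1 \<Longrightarrow> (\<lambda>n. complex_of_real (c n) * x ^ n) sums q x"
  shows "psd (\<lambda>z w. q (z * cnj w) * K z w)"
proof (rule psd_sums)
  show "psd (\<lambda>z w. (of_real (sqrt (c n)) * z ^ n) * K z w * cnj (of_real (sqrt (c n)) * w ^ n))" for n
    using psd_transform[OF K, of "\<lambda>z. z" "\<lambda>z. of_real (sqrt (c n)) * z ^ n"] by simp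
  fix z w :: complex assume "z \<in> ball 0 1" "w \<in> ball 0 1"
  then have "cmod (z * cnj w) < 1"
    using mult_strict_mono'[of "cmod z" 1 "cmod w" 1] by (simp add: norm_mult)
  from sums_mult2[OF q[OF this], of "K z w"]
  show "(\<lambda>n. (of_real (sqrt (c n)) * z ^ n) * K z w * cnj (of_real (sqrt (c n)) * w ^ n))
      sums (q (z * cnj w) * K z w)"
  proof (rule back_subst[where P = "\<lambda>f. f sums _"], intro ext)
    fix n
    have "complex_of_real (c n) = of_real (sqrt (c n)) * of_real (sqrt (c n))"
      using c[of n] by (simp flip: of_real_mult)
    then show "complex_of_real (c n) * (z * cnj w) ^ n * K z w =
        (of_real (sqrt (c n)) * z ^ n) * K z w * cnj (of_real (sqrt (c n)) * w ^ n)"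
      by (simp add: power_mult_distrib mult_ac)
  qed
qed

lemmas psd_power_series = psd_power_series_mult[OF psd_one, simplified]


section \<open>Reproducing kernel Hilbert spaces\<close>

locale rkhs =
  fixes H :: "(complex \<Rightarrow> complex) hilbert" and K :: "complex \<Rightarrow> complex \<Rightarrow> complex"
  assumes is_rkhs: "is_rkhs H K"

sublocale rkhs \<subseteq> hilbert_space H
  using is_rkhs unfolding is_rkhs_def by blast

context rkhs
begin

definition kfun :: "complex \<Rightarrow> complex \<Rightarrow> complex" where
  "kfun w = (\<lambda>z. if z \<in> ball 0 1 then K z w else 0)"

definition kcomb :: "(complex \<times> complex) list \<Rightarrow> complex \<Rightarrow> complex" where
  "kcomb xs = (\<lambda>z. \<Sum>(c, w)\<leftarrow>xs. c * kfun w z)"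

lemma hscale: "hscale H c f = (\<lambda>z. c * f z)"
  using is_rkhs unfolding is_rkhs_def by simp

lemma carrier_holomorphic: "f \<in> hcarrier H \<Longrightarrow> f holomorphic_on ball 0 1"
  using is_rkhs unfolding is_rkhs_def by blast

lemma carrier_outside: "f \<in> hcarrier H \<Longrightarrow> z \<notin> ball 0 1 \<Longrightarrow> f z = 0"
  using is_rkhs unfolding is_rkhs_def by blast

lemma carrier_eqI:
  assumes "f \<in> hcarrier H" "\<And>z. z \<in> ball 0 1 \<Longrightarrow> f z = g z" "\<And>z. z \<notin> ball 0 1 \<Longrightarrow> g z = 0"
  shows "f = g"
  using assms carrier_outside by (intro ext) metis

lemma kfun_carrier: "w \<in> ball 0 1 \<Longrightarrow> kfun w \<in> hcarrier H"
  using is_rkhs unfolding is_rkhs_def kfun_def by blast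

lemma reproducing: "w \<in> ball 0 1 \<Longrightarrow> f \<in> hcarrier H \<Longrightarrow> hinner H f (kfun w) = f w"
  using is_rkhs unfolding is_rkhs_def kfun_def by blast

lemma hnorm_kfun: "w \<in> ball 0 1 \<Longrightarrow> (hnorm H (kfun w))\<^sup>2 = Re (K w w)"
  using reproducing[of w "kfun w"] by (simp add: hnorm_power2 kfun_carrier) (simp add: kfun_def)

lemma kcomb_Nil: "kcomb [] = 0"
  by (simp add: kcomb_def zero_fun_def)

lemma kcomb_Cons: "kcomb ((c, w) # xs) = hscale H c (kfun w) + kcomb xs"
  by (simp add: kcomb_def hscale plus_fun_def)

lemma kcomb_append: "kcomb (xs @ ys) = kcomb xs + kcomb ys"
  by (simp add: kcomb_def plus_fun_def)

lemma kcomb_scale: "kcomb (map (\<lambda>p. (c * fst p, snd p)) xs) = hscale H c (kcomb xs)"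
  by (simp add: kcomb_def hscale case_prod_unfold comp_def sum_list_const_mult[symmetric] mult_ac)

lemma kcomb_carrier: "snd ` set xs \<subseteq> ball 0 1 \<Longrightarrow> kcomb xs \<in> hcarrier H"
proof (induction xs)
  case (Cons x xs)
  obtain c w where x: "x = (c, w)" by force
  show ?case
    unfolding x kcomb_Cons using Cons x
    by (intro carrier_add carrier_scale kfun_carrier) auto
qed (simp add: kcomb_Nil carrier_zero)

lemma inner_kcomb:
  assumes "snd ` set xs \<subseteq> ball 0 1" "f \<in> hcarrier H"
  shows "hinner H f (kcomb xs) = (\<Sum>(c, w)\<leftarrow>xs. cnj c * f w)"
  using assms
proof (induction xs)
  case (Cons x xs)
  obtain c w where x: "x = (c, w)" by force
  have w: "w \<in> ball 0 1" and xs: "snd ` set xs \<subseteq> ball 0 1"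
    using Cons.prems x by auto
  have "hinner H f (kcomb (x # xs)) = cnj c * f w + hinner H f (kcomb xs)"
    unfolding x kcomb_Cons inner_add_right[OF Cons.prems(2) carrier_scale[OF kfun_carrier[OF w]] kcomb_carrier[OF xs]]
      inner_scale_right[OF Cons.prems(2) kfun_carrier[OF w]] reproducing[OF w Cons.prems(2)] ..
  then show ?case
    using Cons.IH[OF xs Cons.prems(2)] x by simp
qed (simp add: kcomb_Nil inner_zero_right)

lemma hnorm_kcomb:
  assumes "snd ` set xs \<subseteq> ball 0 1"
  shows "(hnorm H (kcomb xs))\<^sup>2 = Re (kernel_form K xs)"
proof -
  have "(\<Sum>(c, w)\<leftarrow>xs. cnj c * kcomb xs w) = kernel_form K xs"
    unfolding kernel_form_def using assms
    by (intro arg_cong[where f = sum_list] map_cong refl)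
      (auto simp: kcomb_def kfun_def case_prod_unfold sum_list_const_mult[symmetric] mult_ac)
  then show ?thesis
    using assms by (simp add: hnorm_power2 kcomb_carrier inner_kcomb)
qed

text \<open>
  Membership is decided by testing against kernel functions: the functional
  \<open>K\<^sub>w \<mapsto> cnj (g w)\<close> on their span is represented by an element of the space, whose values
  are those of \<open>g\<close> by the reproducing property.
\<close>

lemma membership:
  assumes g: "\<And>z. z \<notin> ball 0 1 \<Longrightarrow> g z = 0" and B: "0 \<le> B"
    and bound: "\<And>xs. snd ` set xs \<subseteq> ball 0 1 \<Longrightarrow>
      cmod (\<Sum>(c, w)\<leftarrow>xs. cnj c * g w) \<le> B * hnorm H (kcomb xs)"
  shows "g \<in> hcarrier H" "hnorm H g \<le> B"
proof -
  define P where "P = {(kcomb xs, \<Sum>(c, w)\<leftarrow>xs. c * cnj (g w)) |xs. snd ` set xs \<subseteq> ball 0 1}"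
  have cnj_sum: "(\<Sum>(c, w)\<leftarrow>xs. c * cnj (g w)) = cnj (\<Sum>(c, w)\<leftarrow>xs. cnj c * g w)" for xs
    by (induction xs) auto
  obtain h where h: "h \<in> hcarrier H" "\<And>x l. (x, l) \<in> P \<Longrightarrow> hinner H x h = l" "hnorm H h \<le> B"
  proof (rule riesz_graph[OF B, of P])
    show "(0, 0) \<in> P"
      unfolding P_def using kcomb_Nil by (auto intro!: exI[of _ "[]"])
    show "(x + y, l + m) \<in> P" if "(x, l) \<in> P" "(y, m) \<in> P" for x l y m
      using that unfolding P_def
    proof clarify
      fix xs ys :: "(complex \<times> complex) list" assume "snd ` set xs \<subseteq> ball 0 1" "snd ` set ys \<subseteq> ball 0 1"
      then show "\<exists>zs. (kcomb xs + kcomb ys, (\<Sum>(c, w)\<leftarrow>xs. c * cnj (g w)) + (\<Sum>(c, w)\<leftarrow>ys. c * cnj (g w))) =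
          (kcomb zs, \<Sum>(c, w)\<leftarrow>zs. c * cnj (g w)) \<and> snd ` set zs \<subseteq> ball 0 1"
        by (intro exI[of _ "xs @ ys"]) (auto simp: kcomb_append)
    qed
    show "(hscale H c x, c * l) \<in> P" if "(x, l) \<in> P" for c x l
      using that unfolding P_def
    proof clarify
      fix xs :: "(complex \<times> complex) list" assume "snd ` set xs \<subseteq> ball 0 1"
      then show "\<exists>zs. (hscale H c (kcomb xs), c * (\<Sum>(c, w)\<leftarrow>xs. c * cnj (g w))) =
          (kcomb zs, \<Sum>(c, w)\<leftarrow>zs. c * cnj (g w)) \<and> snd ` set zs \<subseteq> ball 0 1"
        unfolding kcomb_scale[symmetric]
        by (intro exI[of _ "map (\<lambda>p. (c * fst p, snd p)) xs"])
          (auto simp: case_prod_unfold comp_def sum_list_const_mult[symmetric] mult_ac)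
    qed
    show "x \<in> hcarrier H" if "(x, l) \<in> P" for x l
      using that kcomb_carrier unfolding P_def by blast
    show "cmod l \<le> B * hnorm H x" if "(x, l) \<in> P" for x l
      using that bound unfolding P_def cnj_sum by auto
  qed blast
  have "h w = g w" if w: "w \<in> ball 0 1" for w
  proof -
    have "(kcomb [(1, w)], cnj (g w)) \<in> P"
      unfolding P_def using w by (auto intro!: exI[of _ "[(1, w)]"])
    then have "hinner H (kfun w) h = cnj (g w)"
      using h(2) by (simp add: kcomb_def)
    then show ?thesis
      using inner_commute[OF h(1) kfun_carrier[OF w]] reproducing[OF w h(1)] by simp
  qed
  then have "h = g"
    using carrier_eqI[OF h(1)] g by blast
  then show "g \<in> hcarrier H" "hnorm H g \<le> B"
    using h by auto
qed

lemma membership_psd: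
  assumes "\<And>z. z \<notin> ball 0 1 \<Longrightarrow> g z = 0" "psd (\<lambda>z w. K z w - g z * cnj (g w))"
  shows "g \<in> hcarrier H"
proof (rule membership(1)[where B = 1])
  fix xs :: "(complex \<times> complex) list" assume xs: "snd ` set xs \<subseteq> ball 0 1"
  then have "(cmod (\<Sum>(c, w)\<leftarrow>xs. cnj c * g w))\<^sup>2 \<le> (hnorm H (kcomb xs))\<^sup>2"
    using assms(2) unfolding psd_def kernel_form_diff kernel_form_rank_one hnorm_kcomb[OF xs] by auto
  then show "cmod (\<Sum>(c, w)\<leftarrow>xs. cnj c * g w) \<le> 1 * hnorm H (kcomb xs)"
    using hnorm_ge_0[OF kcomb_carrier[OF xs]] power2_le_imp_le by fastforce
qed (use assms in auto)

definition wcomp :: "(complex \<Rightarrow> complex) \<Rightarrow> (complex \<Rightarrow> complex) \<Rightarrow> (complex \<Rightarrow> complex) \<Rightarrow> complex \<Rightarrow> complex" where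
  "wcomp \<psi> \<phi> f = (\<lambda>z. if z \<in> ball 0 1 then \<psi> z * f (\<phi> z) else 0)"

text \<open>
  The formal adjoint of a weighted composition operator maps the kernel function at \<open>w\<close> to a
  multiple of the one at \<open>\<phi> w\<close>; the kernel inequality says that this adjoint is bounded by \<open>C\<close> on the
  span of the kernel functions.
\<close>

lemma weighted_composition:
  assumes \<phi>: "\<And>z. z \<in> ball 0 1 \<Longrightarrow> \<phi> z \<in> ball 0 1" and C: "0 \<le> C"
    and pos: "psd (\<lambda>z w. complex_of_real (C\<^sup>2) * K z w - \<psi> z * K (\<phi> z) (\<phi> w) * cnj (\<psi> w))"
    and f: "f \<in> hcarrier H"
  shows "wcomp \<psi> \<phi> f \<in> hcarrier H" "hnorm H (wcomp \<psi> \<phi> f) \<le> C * hnorm H f"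
proof -
  have bound: "cmod (\<Sum>(c, w)\<leftarrow>xs. cnj c * wcomp \<psi> \<phi> f w) \<le> C * hnorm H f * hnorm H (kcomb xs)"
    if xs: "snd ` set xs \<subseteq> ball 0 1" for xs
  proof -
    define ys where "ys = map (\<lambda>(c, z). (c * cnj (\<psi> z), \<phi> z)) xs"
    have ys: "snd ` set ys \<subseteq> ball 0 1"
      unfolding ys_def using xs \<phi> by force
    have "(\<Sum>(c, w)\<leftarrow>xs. cnj c * wcomp \<psi> \<phi> f w) = (\<Sum>(c, w)\<leftarrow>ys. cnj c * f w)"
      unfolding ys_def map_map
      by (intro arg_cong[where f = sum_list] map_cong refl) (use xs in \<open>auto simp: wcomp_def\<close>)
    also have "\<dots> = hinner H f (kcomb ys)"
      using inner_kcomb[OF ys f] by simp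
    finally have 1: "cmod (\<Sum>(c, w)\<leftarrow>xs. cnj c * wcomp \<psi> \<phi> f w) \<le> hnorm H f * hnorm H (kcomb ys)"
      using cauchy_schwarz[OF f kcomb_carrier[OF ys]] by simp
    have "(hnorm H (kcomb ys))\<^sup>2 = Re (kernel_form (\<lambda>z w. \<psi> z * K (\<phi> z) (\<phi> w) * cnj (\<psi> w)) xs)"
      using hnorm_kcomb[OF ys] unfolding kernel_form_transform ys_def .
    also have "\<dots> \<le> C\<^sup>2 * (hnorm H (kcomb xs))\<^sup>2"
      using pos xs unfolding psd_def kernel_form_diff kernel_form_scale hnorm_kcomb[OF xs] by simp
    finally have "(hnorm H (kcomb ys))\<^sup>2 \<le> (C * hnorm H (kcomb xs))\<^sup>2"
      by (simp add: power_mult_distrib)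
    then have "hnorm H (kcomb ys) \<le> C * hnorm H (kcomb xs)"
      using C hnorm_ge_0[OF kcomb_carrier[OF xs]] by (meson mult_nonneg_nonneg power2_le_imp_le)
    then have "hnorm H f * hnorm H (kcomb ys) \<le> hnorm H f * (C * hnorm H (kcomb xs))"
      using hnorm_ge_0[OF f] by (rule mult_left_mono)
    with 1 show ?thesis by (simp add: mult_ac)
  qed
  have out: "\<And>z. z \<notin> ball 0 1 \<Longrightarrow> wcomp \<psi> \<phi> f z = 0"
    by (simp add: wcomp_def)
  show "wcomp \<psi> \<phi> f \<in> hcarrier H" "hnorm H (wcomp \<psi> \<phi> f) \<le> C * hnorm H f"
    using membership[OF out _ bound] C hnorm_ge_0[OF f] by auto
qed

lemma bounded_op_wcomp:
  assumes \<phi>: "\<And>z. z \<in> ball 0 1 \<Longrightarrow> \<phi> z \<in> ball 0 1" and C: "0 \<le> C"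
    and pos: "psd (\<lambda>z w. complex_of_real (C\<^sup>2) * K z w - \<psi> z * K (\<phi> z) (\<phi> w) * cnj (\<psi> w))"
  shows "bounded_op H H (wcomp \<psi> \<phi>)"
  unfolding bounded_op_def
proof (intro conjI ballI allI)
  show "\<exists>C. \<forall>x\<in>hcarrier H. hnorm H (wcomp \<psi> \<phi> x) \<le> C * hnorm H x"
    using weighted_composition[OF \<phi> C pos] by blast
qed (use weighted_composition[OF \<phi> C pos] in
    \<open>auto simp: wcomp_def hscale plus_fun_def fun_eq_iff distrib_left\<close>)

text \<open>
  Functions vanishing on a determining set \<open>Q\<close> vanish, so kernel functions at points of \<open>Q\<close> span a
  dense subspace.
\<close>

lemma kcomb_dense:
  assumes f: "f \<in> hcarrier H" and Q: "Q \<subseteq> ball 0 1"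
    and det: "\<And>h. h \<in> hcarrier H \<Longrightarrow> (\<And>w. w \<in> Q \<Longrightarrow> h w = 0) \<Longrightarrow> h = 0" and e: "e > 0"
  obtains xs where "snd ` set xs \<subseteq> Q" "hnorm H (f - kcomb xs) < e"
proof -
  define P where "P = {(kcomb xs, hinner H (kcomb xs) f) |xs. snd ` set xs \<subseteq> Q}"
  have PD: "\<exists>xs. x = kcomb xs \<and> l = hinner H x f \<and> snd ` set xs \<subseteq> Q \<and> kcomb xs \<in> hcarrier H"
    if "(x, l) \<in> P" for x l
    using that kcomb_carrier Q unfolding P_def by blast
  have PI: "(kcomb xs, hinner H (kcomb xs) f) \<in> P" if "snd ` set xs \<subseteq> Q" for xs
    using that unfolding P_def by blast
  obtain g where g: "g \<in> hcarrier H" "\<And>x l. (x, l) \<in> P \<Longrightarrow> hinner H x g = l"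
    and appr: "\<And>e. e > 0 \<Longrightarrow> \<exists>(x, l)\<in>P. hnorm H (x - g) < e"
  proof (rule riesz_graph[OF hnorm_ge_0[OF f], of P])
    show "(0, 0) \<in> P"
      unfolding P_def using kcomb_Nil inner_zero_left[OF f] by (auto intro!: exI[of _ "[]"])
    show "(x + y, l + m) \<in> P" if xl: "(x, l) \<in> P" and ym: "(y, m) \<in> P" for x l y m
    proof -
      obtain xs where "x = kcomb xs" "l = hinner H x f" "snd ` set xs \<subseteq> Q" "kcomb xs \<in> hcarrier H"
        using PD[OF xl] by metis
      moreover obtain ys where "y = kcomb ys" "m = hinner H y f" "snd ` set ys \<subseteq> Q" "kcomb ys \<in> hcarrier H"
        using PD[OF ym] by metis
      ultimately show ?thesis
        using PI[of "xs @ ys"] f by (simp add: kcomb_append inner_add_left image_Un)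
    qed
    show "(hscale H c x, c * l) \<in> P" if xl: "(x, l) \<in> P" for c x l
    proof -
      obtain xs where "x = kcomb xs" "l = hinner H x f" "snd ` set xs \<subseteq> Q" "kcomb xs \<in> hcarrier H"
        using PD[OF xl] by metis
      then show ?thesis
        using PI[of "map (\<lambda>p. (c * fst p, snd p)) xs"] f
        by (simp add: kcomb_scale inner_scale_left image_comp case_prod_unfold comp_def)
    qed
    show "x \<in> hcarrier H" if "(x, l) \<in> P" for x l
      using PD that by blast
    show "cmod l \<le> hnorm H f * hnorm H x" if "(x, l) \<in> P" for x l
      using PD[OF that] cauchy_schwarz[OF _ f] by (metis mult.commute)
  qed blast
  have "f - g = 0"
  proof (rule det)
    fix w assume w: "w \<in> Q"
    then have wb: "w \<in> ball 0 1" using Q by blast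
    have "(kcomb [(1, w)], hinner H (kcomb [(1, w)]) f) \<in> P"
      using PI[of "[(1, w)]"] w by simp
    then have "hinner H (kfun w) g = hinner H (kfun w) f"
      using g(2) by (simp add: kcomb_def)
    then have "hinner H g (kfun w) = hinner H f (kfun w)"
      using inner_commute[OF g(1) kfun_carrier[OF wb]] inner_commute[OF f kfun_carrier[OF wb]] by simp
    then show "(f - g) w = 0"
      using reproducing[OF wb] f g(1) by (simp add: fun_diff_def)
  qed (use f g carrier_diff in auto)
  then have "f = g" by simp
  with appr[OF e] obtain xs where xs: "snd ` set xs \<subseteq> Q" "hnorm H (kcomb xs - f) < e"
    unfolding P_def by auto
  then show thesis
    using that hnorm_minus_commute[OF f kcomb_carrier, of xs] Q by fastforce
qed

text \<open>
  The dense set consists of the combinations with rational coefficients of kernel functions at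
  rational points, the latter being a determining set by continuity.
\<close>

lemma separable: "separable_hilbert_space H"
  unfolding separable_hilbert_space_def
proof (intro conjI)
  show "hilbert_space H" by (rule hilbert_space_axioms)
  define D where "D = {z. Re z \<in> \<rat> \<and> Im z \<in> \<rat>}"
  have "D \<subseteq> (\<lambda>(a, b). Complex a b) ` (\<rat> \<times> \<rat>)"
    unfolding D_def by (auto simp: image_iff) (metis complex_surj)
  then have cD: "countable D"
    using countable_rat by (meson countable_SIGMA countable_image countable_subset)
  have Dd: "\<exists>d\<in>D. cmod (z - d) < e" if "e > 0" for z e
  proof -
    obtain a where a: "a \<in> \<rat>" "Re z < a" "a < Re z + e / 2"
      using Rats_dense_in_real[of "Re z" "Re z + e / 2"] \<open>e > 0\<close> by auto
    obtain b where b: "b \<in> \<rat>" "Im z < b" "b < Im z + e / 2"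
      using Rats_dense_in_real[of "Im z" "Im z + e / 2"] \<open>e > 0\<close> by auto
    have "cmod (z - Complex a b) \<le> \<bar>Re z - a\<bar> + \<bar>Im z - b\<bar>"
      using cmod_le[of "z - Complex a b"] by simp
    then show ?thesis
      using a b by (intro bexI[of _ "Complex a b"]) (auto simp: D_def)
  qed
  define Q where "Q = D \<inter> ball 0 1"
  have det: "h = 0" if h: "h \<in> hcarrier H" and z: "\<And>w. w \<in> Q \<Longrightarrow> h w = 0" for h
  proof -
    have "h w = 0" if w: "w \<in> ball 0 1" for w
    proof (rule ccontr)
      assume "h w \<noteq> 0"
      have "open (ball 0 1 \<inter> h -` (- {0}))"
        by (intro continuous_open_preimage holomorphic_on_imp_continuous_on carrier_holomorphic h) auto
      then obtain e where "e > 0" and e: "ball w e \<subseteq> ball 0 1 \<inter> h -` (- {0})"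
        using w \<open>h w \<noteq> 0\<close> by (metis IntI open_contains_ball vimageI ComplI singletonD)
      obtain d where "d \<in> D" "cmod (w - d) < e"
        using Dd \<open>e > 0\<close> by blast
      then have "d \<in> ball w e" by (simp add: dist_norm)
      then have "h d \<noteq> 0" "d \<in> Q"
        using e \<open>d \<in> D\<close> unfolding Q_def by auto
      then show False using z by blast
    qed
    then show "h = 0"
      using carrier_eqI[OF h, of 0] by simp
  qed
  define S where "S = kcomb ` {xs. set xs \<subseteq> D \<times> Q}"
  have "countable {xs. set xs \<subseteq> D \<times> Q}"
    using countable_lists[of "D \<times> Q"] cD unfolding Q_def lists_eq_set
    by (meson countable_Int1 countable_SIGMA)
  then have "countable S" unfolding S_def by (rule countable_image)
  moreover have "S \<subseteq> hcarrier H"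
    unfolding S_def Q_def using kcomb_carrier by force
  moreover have "\<exists>s\<in>S. hnorm H (f - s) < e" if f: "f \<in> hcarrier H" and e: "e > 0" for f e
  proof -
    have QB: "Q \<subseteq> ball 0 1" and e2: "e / 2 > 0"
      using e unfolding Q_def by auto
    obtain xs where xs: "snd ` set xs \<subseteq> Q" "hnorm H (f - kcomb xs) < e / 2"
      by (rule kcomb_dense[OF f QB det e2])
    have "\<exists>ys. set ys \<subseteq> D \<times> Q \<and> hnorm H (kcomb xs - kcomb ys) < d" if "d > 0" for d
      using xs(1) \<open>d > 0\<close>
    proof (induction xs arbitrary: d)
      case Nil
      have "hnorm H (kcomb [] - kcomb []) < d"
        unfolding diff_self hnorm_zero by (rule Nil.prems)
      then show ?case by (metis empty_set empty_subsetI)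
    next
      case (Cons x xs)
      obtain c w where x: "x = (c, w)" by force
      have w: "w \<in> Q" "w \<in> ball 0 1" using Cons.prems x unfolding Q_def by auto
      define N where "N = hnorm H (kfun w)"
      have N: "N \<ge> 0" unfolding N_def using hnorm_ge_0 kfun_carrier w by blast
      have "snd ` set xs \<subseteq> Q" "d / 2 > 0"
        using Cons.prems by auto
      then obtain ys where ys: "set ys \<subseteq> D \<times> Q" "hnorm H (kcomb xs - kcomb ys) < d / 2"
        using Cons.IH[of "d / 2"] by blast
      obtain b where b: "b \<in> D" "cmod (c - b) < d / 2 / (N + 1)"
        using Dd[of "d / 2 / (N + 1)" c] N Cons.prems by auto
      have "snd ` set xs \<subseteq> ball 0 1" "snd ` set ys \<subseteq> ball 0 1"
        using Cons.prems ys(1) unfolding Q_def by auto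
      note carr = kcomb_carrier[OF this(1)] kcomb_carrier[OF this(2)] kfun_carrier[OF w(2)]
      have "kcomb (x # xs) - kcomb ((b, w) # ys) = hscale H (c - b) (kfun w) + (kcomb xs - kcomb ys)"
        unfolding x kcomb_Cons hscale by (rule ext) (simp add: algebra_simps)
      then have "hnorm H (kcomb (x # xs) - kcomb ((b, w) # ys)) \<le> cmod (c - b) * N + hnorm H (kcomb xs - kcomb ys)"
        using hnorm_triangle[OF carrier_scale[OF carr(3), of "c - b"] carrier_diff[OF carr(1,2)]]
        unfolding hnorm_scale[OF carr(3)] N_def by presburger
      also have "cmod (c - b) * N \<le> d / 2"
      proof -
        have "cmod (c - b) * (N + 1) < d / 2"
          using b(2) N by (simp add: field_simps)
        moreover have "cmod (c - b) * N \<le> cmod (c - b) * (N + 1)"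
          by (intro mult_left_mono) auto
        ultimately show ?thesis by linarith
      qed
      finally have "hnorm H (kcomb (x # xs) - kcomb ((b, w) # ys)) < d"
        using ys(2) by linarith
      moreover have "set ((b, w) # ys) \<subseteq> D \<times> Q"
        using b(1) w(1) ys(1) by simp
      ultimately show ?case by blast
    qed
    from this[OF e2] obtain ys where ys: "set ys \<subseteq> D \<times> Q" "hnorm H (kcomb xs - kcomb ys) < e / 2"
      by blast
    have "snd ` set xs \<subseteq> ball 0 1" "snd ` set ys \<subseteq> ball 0 1"
      using xs(1) ys(1) unfolding Q_def by auto
    note carr = kcomb_carrier[OF this(1)] kcomb_carrier[OF this(2)]
    have "f - kcomb ys = (f - kcomb xs) + (kcomb xs - kcomb ys)" by (rule ext) simp
    then have "hnorm H (f - kcomb ys) \<le> hnorm H (f - kcomb xs) + hnorm H (kcomb xs - kcomb ys)"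
      using hnorm_triangle[OF carrier_diff[OF f carr(1)] carrier_diff[OF carr]] by presburger
    then have "hnorm H (f - kcomb ys) < e"
      using xs(2) ys(2) by argo
    then show ?thesis
      using ys(1) unfolding S_def by blast
  qed
  ultimately show "\<exists>S\<subseteq>hcarrier H. countable S \<and> (\<forall>x\<in>hcarrier H. \<forall>e>0. \<exists>s\<in>S. hnorm H (x - s) < e)"
    by blast
qed

end

section \<open>Automorphisms of the disc\<close>

definition moebius_map :: "complex \<Rightarrow> complex \<Rightarrow> complex \<Rightarrow> complex" where
  "moebius_map c a z = c * (z - a) / (1 - cnj a * z)"

lemma norm_cnj_mult_less_1: 
  assumes "cmod a < 1" "cmod z < 1" shows "cmod (cnj a * z) < 1"
  using mult_strict_mono'[of "cmod a" 1 "cmod z" 1] assms by (simp add: norm_mult)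

lemma one_minus_cnj_mult_ne_0:
  assumes "cmod a < 1" "cmod z < 1" shows "1 - cnj a * z \<noteq> 0"
  using norm_cnj_mult_less_1[OF assms] by auto

lemma moebius_map_inverse:
  assumes c: "cmod c = 1" and a: "cmod a < 1" and z: "cmod z < 1"
  shows "moebius_map (cnj c) (- (c * a)) (moebius_map c a z) = z"
proof -
  have cc: "c * cnj c = 1"
    using c by (simp add: complex_norm_square[symmetric])
  have aa: "1 - cnj a * a \<noteq> 0"
    by (rule one_minus_cnj_mult_ne_0) (use a in auto)
  have nz: "1 - cnj a * z \<noteq> 0"
    by (rule one_minus_cnj_mult_ne_0[OF a z])
  have den: "1 + cnj c * cnj a * moebius_map c a z = (1 - cnj a * a) / (1 - cnj a * z)"
  proof -
    have "cnj c * cnj a * moebius_map c a z = (c * cnj c) * cnj a * (z - a) / (1 - cnj a * z)"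
      by (simp add: moebius_map_def)
    also have "1 + \<dots> = (1 - cnj a * a) / (1 - cnj a * z)"
      unfolding cc using nz by (simp add: field_simps)
    finally show ?thesis .
  qed
  have num: "cnj c * (moebius_map c a z + c * a) = z * (1 - cnj a * a) / (1 - cnj a * z)"
  proof -
    have "cnj c * (moebius_map c a z + c * a) = (c * cnj c) * ((z - a) / (1 - cnj a * z) + a)"
      by (simp add: moebius_map_def algebra_simps)
    also have "\<dots> = z * (1 - cnj a * a) / (1 - cnj a * z)"
      unfolding cc using nz by (simp add: field_simps)
    finally show ?thesis .
  qed
  have "moebius_map (cnj c) (- (c * a)) (moebius_map c a z)
      = (cnj c * (moebius_map c a z + c * a)) / (1 + cnj c * cnj a * moebius_map c a z)"
    by (simp add: moebius_map_def[of "cnj c"])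
  also have "\<dots> = z"
    unfolding den num using aa nz by (simp add: divide_simps)
  finally show ?thesis .
qed

lemma one_minus_moebius_map:
  assumes c: "cmod c = 1" and a: "cmod a < 1" and z: "cmod z < 1" and w: "cmod w < 1"
  shows "1 - moebius_map c a z * cnj (moebius_map c a w)
     = (1 - a * cnj a) * (1 - z * cnj w) / ((1 - cnj a * z) * cnj (1 - cnj a * w))"
proof -
  have cc: "c * cnj c = 1"
    using c by (simp add: complex_norm_square[symmetric])
  have nz: "1 - cnj a * z \<noteq> 0" "cnj (1 - cnj a * w) \<noteq> 0"
    using one_minus_cnj_mult_ne_0[OF a] z w by (simp_all only: complex_cnj_zero_iff) auto
  have "moebius_map c a z * cnj (moebius_map c a w)
      = (c * cnj c) * ((z - a) * cnj (w - a)) / ((1 - cnj a * z) * cnj (1 - cnj a * w))"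
    unfolding moebius_map_def by simp
  also have "\<dots> = ((z - a) * cnj (w - a)) / ((1 - cnj a * z) * cnj (1 - cnj a * w))"
    unfolding cc by simp
  finally have "1 - moebius_map c a z * cnj (moebius_map c a w)
      = ((1 - cnj a * z) * cnj (1 - cnj a * w) - (z - a) * cnj (w - a)) / ((1 - cnj a * z) * cnj (1 - cnj a * w))"
    using nz by (simp add: diff_divide_distrib del: complex_cnj_diff)
  then show ?thesis
    by (simp add: algebra_simps)
qed

lemma one_minus_norm_moebius_map:
  assumes c: "cmod c = 1" and a: "cmod a < 1" and z: "cmod z < 1"
  shows "1 - (cmod (moebius_map c a z))\<^sup>2
     = (1 - (cmod a)\<^sup>2) * (1 - (cmod z)\<^sup>2) / (cmod (1 - cnj a * z))\<^sup>2"
proof -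
  have "complex_of_real (1 - (cmod (moebius_map c a z))\<^sup>2) = 
      complex_of_real ((1 - (cmod a)\<^sup>2) * (1 - (cmod z)\<^sup>2) / (cmod (1 - cnj a * z))\<^sup>2)"
    using one_minus_moebius_map[OF c a z z]
    by (simp only: of_real_diff of_real_divide of_real_mult of_real_1 complex_norm_square)
  then show ?thesis by (simp only: of_real_eq_iff)
qed

lemma norm_moebius_map:
  assumes c: "cmod c = 1" and a: "cmod a < 1" and z: "cmod z < 1"
  shows "cmod (moebius_map c a z) < 1"
proof -
  have "(cmod a)\<^sup>2 < 1" "(cmod z)\<^sup>2 < 1"
    using a z by (simp_all add: abs_square_less_1)
  then have "0 < 1 - (cmod (moebius_map c a z))\<^sup>2"
    unfolding one_minus_norm_moebius_map[OF assms] using one_minus_cnj_mult_ne_0[OF a z] by simp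
  then show ?thesis by (simp add: abs_square_less_1)
qed

lemma holomorphic_moebius_map: 
  assumes "cmod a * \<rho> \<le> 1" shows "moebius_map c a holomorphic_on ball 0 \<rho>"
proof -
  have "1 - cnj a * z \<noteq> 0" if "cmod z < \<rho>" for z
  proof (cases "a = 0")
    case False
    then have "cmod (cnj a * z) < cmod a * \<rho>"
      using that by (simp add: norm_mult)
    then show ?thesis using assms by auto
  qed simp
  then show ?thesis
    unfolding moebius_map_def by (intro holomorphic_intros) auto
qed

lemma moebius_map_moeb:
  assumes c: "cmod c = 1" and a: "cmod a < 1"
  shows "moebius_map c a \<in> moeb"
proof -
  have ca: "cmod (cnj c) = 1" "cmod (- (c * a)) < 1"
    using c a by (auto simp: norm_mult)
  have inv: "moebius_map c a (moebius_map (cnj c) (- (c * a)) z) = z" if "cmod z < 1" for z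
  proof -
    have "cnj c * c = 1"
      using c by (simp add: complex_norm_square[symmetric] mult.commute)
    then have "- (cnj c * - (c * a)) = a"
      by (simp add: mult.assoc[symmetric])
    from moebius_map_inverse[OF ca that, unfolded this complex_cnj_cnj] show ?thesis .
  qed
  show ?thesis
    unfolding moeb_def
    using holomorphic_moebius_map[of a 1 c] holomorphic_moebius_map[of "- (c * a)" 1 "cnj c"]
      norm_moebius_map[OF c a] norm_moebius_map[OF ca] moebius_map_inverse[OF c a] inv ca a
    by (auto intro!: exI[of _ "moebius_map (cnj c) (- (c * a))"])
qed

text \<open>
  Composing with the explicit automorphism that sends the zero of \<open>\<phi>\<close> to the origin reduces to an
  automorphism fixing \<open>0\<close>, which is a rotation by the equality case of the Schwarz lemma.
\<close>

lemma moeb_cases: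
  assumes "\<phi> \<in> moeb"
  obtains c a where "cmod c = 1" "cmod a < 1" "\<And>z. cmod z < 1 \<Longrightarrow> \<phi> z = moebius_map c a z"
proof -
  obtain \<psi> where \<phi>: "\<phi> holomorphic_on ball 0 1" "\<phi> ` ball 0 1 \<subseteq> ball 0 1"
    and \<psi>: "\<psi> holomorphic_on ball 0 1" "\<psi> ` ball 0 1 \<subseteq> ball 0 1"
    and inv: "\<And>z. z \<in> ball 0 1 \<Longrightarrow> \<psi> (\<phi> z) = z \<and> \<phi> (\<psi> z) = z"
    using assms unfolding moeb_def by blast
  define a where "a = \<psi> 0"
  have a: "cmod a < 1" "cmod (- a) < 1"
    using \<psi>(2) unfolding a_def by (auto simp: image_subset_iff)
  define m where "m = moebius_map 1 (- a)"
  define m' where "m' = moebius_map 1 a"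
  have m: "m holomorphic_on ball 0 1" "m ` ball 0 1 \<subseteq> ball 0 1"
    and m': "m' holomorphic_on ball 0 1" "m' ` ball 0 1 \<subseteq> ball 0 1"
    unfolding m_def m'_def using a holomorphic_moebius_map[of a 1 1] holomorphic_moebius_map[of "- a" 1 1]
      norm_moebius_map[of 1] by auto
  have mm: "m (m' z) = z" "m' (m z) = z" if "cmod z < 1" for z
    using moebius_map_inverse[of 1 a z] moebius_map_inverse[of 1 "- a" z] a that
    unfolding m_def m'_def by auto
  define h where "h = \<phi> \<circ> m"
  define k where "k = m' \<circ> \<psi>"
  have hol: "h holomorphic_on ball 0 1" "k holomorphic_on ball 0 1"
    unfolding h_def k_def using \<phi> \<psi> m m' by (auto intro: holomorphic_on_compose_gen)
  have h0: "h 0 = 0" and k0: "k 0 = 0"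
    using inv[of 0] unfolding h_def k_def m_def m'_def a_def by (auto simp: moebius_map_def)
  have hb: "cmod (h z) < 1" and kb: "cmod (k z) < 1" if "cmod z < 1" for z
    using that \<phi>(2) \<psi>(2) m(2) m'(2) unfolding h_def k_def by (fastforce simp: image_subset_iff)+
  have kh: "k (h z) = z" if "cmod z < 1" for z
  proof -
    have "m z \<in> ball 0 1" using m(2) that by (auto simp: image_subset_iff)
    then show ?thesis using inv mm(2)[OF that] unfolding h_def k_def by simp
  qed
  have half: "cmod (1/2 :: complex) < 1" by simp
  have "cmod (h (1/2)) = cmod (1/2)"
  proof (rule antisym)
    show "cmod (h (1/2)) \<le> cmod (1/2)"
      by (rule Schwarz_Lemma(1)[OF hol(1) h0 hb half])
    show "cmod (1/2) \<le> cmod (h (1/2))"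
      using Schwarz_Lemma(1)[OF hol(2) k0 kb hb[OF half]] kh[OF half] by simp
  qed
  then obtain c where c: "\<And>z. cmod z < 1 \<Longrightarrow> h z = c * z" "cmod c = 1"
    using Schwarz_Lemma(3)[OF hol(1) h0 hb half] half
    by (metis divide_eq_0_iff one_neq_zero zero_neq_numeral)
  have "\<phi> z = moebius_map c a z" if z: "cmod z < 1" for z
  proof -
    have "m' z \<in> ball 0 1" using m'(2) z by (auto simp: image_subset_iff)
    then have "h (m' z) = c * m' z" using c(1) by simp
    then show ?thesis
      using mm(1)[OF z] unfolding h_def by (simp add: m'_def moebius_map_def)
  qed
  then show thesis using that c(2) a by blast
qed

text \<open>
  Both sides have the same exponential.  Each logarithm has imaginary part of modulus less than
  \<open>pi / 2\<close>, so the two sides differ by less than \<open>2 pi\<close> and the multiple of \<open>2 pi \<i>\<close> is zero.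
\<close>

lemma Ln_one_minus_moebius_map:
  assumes c: "cmod c = 1" and a: "cmod a < 1" and z: "cmod z < 1" and w: "cmod w < 1"
  shows "Ln (1 - moebius_map c a z * cnj (moebius_map c a w))
     = of_real (ln (1 - (cmod a)\<^sup>2)) + Ln (1 - z * cnj w) - Ln (1 - cnj a * z) - cnj (Ln (1 - cnj a * w))"
    (is "?L = ?R")
proof -
  have a1: "0 < 1 - (cmod a)\<^sup>2" using a by (simp add: abs_square_less_1)
  have nw: "cmod (moebius_map c a z * cnj (moebius_map c a w)) < 1"
    using norm_cnj_mult_less_1[OF norm_moebius_map[OF c a w] norm_moebius_map[OF c a z]]
    by (simp add: mult.commute)
  have zw: "cmod (z * cnj w) < 1"
    using norm_cnj_mult_less_1[OF w z] by (simp add: mult.commute)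
  have im: "1 - x \<noteq> 0" "\<bar>Im (Ln (1 - x))\<bar> < pi / 2" if "cmod x < 1" for x
  proof -
    have "Re (1 - x) > 0"
      using complex_Re_le_cmod[of x] that by simp
    moreover show "1 - x \<noteq> 0"
      using that by auto
    ultimately show "\<bar>Im (Ln (1 - x))\<bar> < pi / 2"
      using Re_Ln_pos_lt[of "1 - x"] by blast
  qed
  note ims = im[OF nw] im[OF zw] im[OF norm_cnj_mult_less_1[OF a z]] im[OF norm_cnj_mult_less_1[OF a w]]
  have "exp ?R = exp (of_real (ln (1 - (cmod a)\<^sup>2))) * exp (Ln (1 - z * cnj w))
      / (exp (Ln (1 - cnj a * z)) * cnj (exp (Ln (1 - cnj a * w))))"
    by (simp add: exp_add exp_diff exp_cnj)
  also have "\<dots> = (1 - a * cnj a) * (1 - z * cnj w) / ((1 - cnj a * z) * cnj (1 - cnj a * w))"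
  proof -
    have "exp (complex_of_real (ln (1 - (cmod a)\<^sup>2))) = 1 - a * cnj a"
      using a1 by (simp add: exp_of_real complex_norm_square[symmetric])
    then show ?thesis
      using ims by (simp del: complex_cnj_diff)
  qed
  also have "\<dots> = exp ?L"
    using ims(1) by (simp add: one_minus_moebius_map[OF assms] del: complex_cnj_diff)
  finally have "exp ?L = exp ?R" ..
  then obtain n :: int where n: "?L = ?R + complex_of_real (real_of_int (2 * n) * pi) * \<i>"
    unfolding exp_eq by blast
  then have "Im ?L = Im ?R + real_of_int (2 * n) * pi"
    by simp
  then have "real_of_int (2 * n) * pi = Im ?L - Im (Ln (1 - z * cnj w)) + Im (Ln (1 - cnj a * z)) - Im (Ln (1 - cnj a * w))"
    by simp
  then have "\<bar>real_of_int (2 * n) * pi\<bar> < 2 * pi"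
    using ims(2,4,6,8) unfolding abs_less_iff by argo
  then have "n = 0"
    by (simp add: abs_mult)
  then show ?thesis using n by simp
qed


section \<open>The two factors of the kernel\<close>

lemma one_over_Suc_sums:
  assumes "cmod x < 1"
  shows "(\<lambda>n. complex_of_real (1 / of_nat (n + 1)) * x ^ n) sums (\<Sum>n. 1 / of_nat (n + 1) * x ^ n)"
proof -
  have "summable (\<lambda>n. 1 / of_nat (n + 1) * x ^ n)"
  proof (rule summable_comparison_test')
    show "summable (\<lambda>n. cmod x ^ n)" using assms by (simp add: summable_geometric)
    show "norm (1 / of_nat (n + 1) * x ^ n) \<le> cmod x ^ n" for n
    proof -
      have "norm (1 / of_nat (n + 1) :: complex) \<le> 1"
        by (simp add: norm_divide del: of_nat_Suc)
      then show ?thesis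
        unfolding norm_mult norm_power by (rule mult_left_le_one_le[rotated 2]) auto
    qed
  qed
  then show ?thesis by (simp add: summable_sums)
qed

definition binom_coeff :: "real \<Rightarrow> nat \<Rightarrow> real" where
  "binom_coeff l n = pochhammer l n / fact n"

lemma binom_coeff_nonneg: "l > 0 \<Longrightarrow> binom_coeff l n \<ge> 0"
  unfolding binom_coeff_def by (simp add: pochhammer_nonneg)

lemma binom_coeff_sums:
  assumes "cmod x < 1"
  shows "(\<lambda>n. complex_of_real (binom_coeff l n) * x ^ n) sums ((1 - x) powr (- of_real l))"
proof -
  have "((- complex_of_real l) gchoose n) * (- x) ^ n = complex_of_real (binom_coeff l n) * x ^ n" for n
  proof -
    have "((- complex_of_real l) gchoose n) * (- x) ^ n
        = ((-1) ^ n * (-1) ^ n) * (pochhammer (complex_of_real l) n / fact n * x ^ n)"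
      unfolding gbinomial_pochhammer power_minus[of x n] by simp
    also have "((-1) ^ n * (-1) ^ n :: complex) = 1"
      by (simp flip: power_mult_distrib)
    finally show ?thesis
      unfolding binom_coeff_def by (simp add: pochhammer_of_real)
  qed
  then show ?thesis
    using gen_binomial_complex[of "- x" "- complex_of_real l"] assms by simp
qed

lemma psd_power_kernel_mult:
  assumes "l > 0" "psd K" shows "psd (\<lambda>z w. power_kernel l z w * K z w)"
  unfolding power_kernel_def
  using psd_power_series_mult[OF assms(2) binom_coeff_nonneg[OF assms(1)] binom_coeff_sums] .

lemma psd_dirichlet_mult:
  assumes "psd K" shows "psd (\<lambda>z w. dirichlet_kernel z w * K z w)"
  unfolding dirichlet_kernel_def
  using psd_power_series_mult[OF assms, where c = "\<lambda>n. 1 / of_nat (n + 1)", OF _ one_over_Suc_sums] by simp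

lemma norm_mult_cnj_less_1: "z \<in> ball 0 1 \<Longrightarrow> w \<in> ball 0 1 \<Longrightarrow> cmod (z * cnj w) < 1"
  using norm_cnj_mult_less_1[of w z] by (simp add: mult.commute)

text \<open>
  The weight \<open>\<phi>'\<^sup>l\<^sup>/\<^sup>2\<close> (up to a unimodular constant) under which the power kernel is
  invariant.
\<close>

definition moebius_weight :: "real \<Rightarrow> complex \<Rightarrow> complex \<Rightarrow> complex" where
  "moebius_weight l a z = exp (of_real (l / 2 * ln (1 - (cmod a)\<^sup>2)) - of_real l * Ln (1 - cnj a * z))"

lemma power_kernel_invariant:
  assumes c: "cmod c = 1" and a: "cmod a < 1" and z: "cmod z < 1" and w: "cmod w < 1"
  shows "moebius_weight l a z * power_kernel l (moebius_map c a z) (moebius_map c a w) * cnj (moebius_weight l a w)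
     = power_kernel l z w"
proof -
  have "1 - x \<noteq> 0" if "cmod x < 1" for x
    using that by auto
  then have "1 - moebius_map c a z * cnj (moebius_map c a w) \<noteq> 0" "1 - z * cnj w \<noteq> 0"
    using norm_mult_cnj_less_1 norm_moebius_map[OF c a] z w by simp_all
  then have pk: "power_kernel l (moebius_map c a z) (moebius_map c a w)
      = exp (- of_real l * Ln (1 - moebius_map c a z * cnj (moebius_map c a w)))"
    "power_kernel l z w = exp (- of_real l * Ln (1 - z * cnj w))"
    unfolding power_kernel_def powr_def by simp_all
  show ?thesis
    unfolding pk moebius_weight_def exp_cnj mult_exp_exp Ln_one_minus_moebius_map[OF assms]
    by (rule arg_cong[where f = exp]) (simp add: field_simps)
qed

section \<open>Kernel inequalities\<close>

text \<open>
  The coefficients of \<open>(B - x) (1 - x)\<^sup>-\<^sup>l\<close> are nonnegative; equivalently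
  \<open>M\<^sub>z\<close> has norm at most \<open>sqrt B\<close> on the space with the power kernel.
\<close>

lemma psd_mult_z_power_kernel:
  assumes l: "l > 0" and B: "B = max 1 (1 / l)"
  shows "psd (\<lambda>z w. (of_real B - z * cnj w) * power_kernel l z w)"
proof -
  define d where "d n = (case n of 0 \<Rightarrow> B | Suc m \<Rightarrow> B * binom_coeff l (Suc m) - binom_coeff l m)" for n
  have "d n \<ge> 0" for n
  proof (cases n)
    case 0
    then show ?thesis by (simp add: d_def B)
  next
    case (Suc m)
    have "binom_coeff l (Suc m) = binom_coeff l m * ((l + of_nat m) / of_nat (Suc m))"
      by (simp add: binom_coeff_def pochhammer_rec' field_simps)
    moreover have "1 \<le> B * ((l + of_nat m) / of_nat (Suc m))"
    proof -
      have "1 \<le> B * l" "1 \<le> B"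
        using l unfolding B by (auto simp: field_simps max_def)
      then have "1 + of_nat m \<le> B * l + B * of_nat m"
        using mult_right_mono[of 1 B "of_nat m"] by simp
      then show ?thesis by (simp add: field_simps)
    qed
    ultimately have "binom_coeff l m * 1 \<le> B * binom_coeff l (Suc m)"
      using mult_left_mono[OF _ binom_coeff_nonneg[OF l], of 1 _ m] by (metis mult.left_commute)
    then show ?thesis by (simp add: d_def Suc)
  qed
  moreover have "(\<lambda>n. complex_of_real (d n) * x ^ n) sums ((of_real B - x) * (1 - x) powr (- of_real l))"
    if x: "cmod x < 1" for x
  proof -
    have "(\<lambda>n. case n of 0 \<Rightarrow> 0 | Suc m \<Rightarrow> complex_of_real (binom_coeff l m) * x ^ m * x)
        sums ((1 - x) powr (- of_real l) * x)"
      using sums_Suc[of "\<lambda>n. case n of 0 \<Rightarrow> 0 | Suc m \<Rightarrow> complex_of_real (binom_coeff l m) * x ^ m * x"]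
        sums_mult2[OF binom_coeff_sums[OF x, of l], of x] by simp
    from sums_diff[OF sums_mult[OF binom_coeff_sums[OF x, of l], of "of_real B"] this]
    moreover have "complex_of_real B * (complex_of_real (binom_coeff l n) * x ^ n)
          - (case n of 0 \<Rightarrow> 0 | Suc m \<Rightarrow> complex_of_real (binom_coeff l m) * x ^ m * x)
          = complex_of_real (d n) * x ^ n" for n
      by (cases n) (simp_all add: d_def binom_coeff_def algebra_simps)
    ultimately show ?thesis
      by (simp only: left_diff_distrib mult.commute[of x])
  qed
  ultimately show ?thesis
    using psd_power_series[of d "\<lambda>x. (of_real B - x) * (1 - x) powr (- of_real l)"]
    unfolding power_kernel_def by simp
qed

text \<open>Invariance of the power kernel transports the inequality from \<open>z\<close> to every automorphism.\<close>

lemma psd_multiplier: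
  assumes l: "l > 0" and B: "B = max 1 (1 / l)" and c: "cmod c = 1" and a: "cmod a < 1"
  shows "psd (\<lambda>z w. of_real B * (dirichlet_kernel z w * power_kernel l z w)
     - moebius_map c a z * (dirichlet_kernel z w * power_kernel l z w) * cnj (moebius_map c a w))"
proof -
  have "psd (\<lambda>z w. moebius_weight l a z *
      ((of_real B - moebius_map c a z * cnj (moebius_map c a w))
        * power_kernel l (moebius_map c a z) (moebius_map c a w)) * cnj (moebius_weight l a w))"
    by (rule psd_transform[OF psd_mult_z_power_kernel[OF l B], of "moebius_map c a" "moebius_weight l a"])
      (use norm_moebius_map[OF c a] in simp)
  then have "psd (\<lambda>z w. (of_real B - moebius_map c a z * cnj (moebius_map c a w)) * power_kernel l z w)"
  proof (rule psd_cong)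
    fix z w :: complex assume "z \<in> ball 0 1" "w \<in> ball 0 1"
    then have zw: "cmod z < 1" "cmod w < 1" by auto
    show "moebius_weight l a z *
      ((of_real B - moebius_map c a z * cnj (moebius_map c a w))
        * power_kernel l (moebius_map c a z) (moebius_map c a w)) * cnj (moebius_weight l a w)
      = (of_real B - moebius_map c a z * cnj (moebius_map c a w)) * power_kernel l z w"
      unfolding power_kernel_invariant[OF c a zw, symmetric] by (simp only: mult_ac)
  qed
  from psd_dirichlet_mult[OF this] show ?thesis
    by (rule psd_cong) (simp add: algebra_simps)
qed

text \<open>
  Adjoining the point \<open>a\<close> with coefficient \<open>s\<close> gives a nonnegative quadratic polynomial in \<open>s\<close>; its
  minimum is the claim.
\<close>

lemma psd_cauchy_schwarz:
  assumes K: "psd K" and herm: "\<And>z. z \<in> ball 0 1 \<Longrightarrow> K a z = cnj (K z a)"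
    and a: "a \<in> ball 0 1" and k: "K a a = of_real k" "k > 0"
  shows "psd (\<lambda>z w. of_real k * K z w - K z a * cnj (K w a))"
  unfolding psd_def kernel_form_diff kernel_form_scale kernel_form_rank_one
proof (intro allI impI)
  fix xs :: "(complex \<times> complex) list" assume xs: "snd ` set xs \<subseteq> ball 0 1"
  define v where "v = (\<Sum>(c, z)\<leftarrow>xs. cnj c * K z a)"
  define s where "s = - cnj v / of_real k"
  have cv: "(\<Sum>(c, z)\<leftarrow>xs. c * K a z) = cnj v"
    unfolding v_def using xs by (induction xs) (auto simp: herm)
  have "kernel_form K ((s, a) # xs) = kernel_form K xs + s * v + cnj s * cnj v + of_real k * (cnj s * s)"
    unfolding cv[symmetric] unfolding kernel_form_def v_def
    by (simp add: case_prod_unfold sum_list_addf sum_list_const_mult[symmetric] sum_list_mult_const[symmetric] k mult_ac)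
  moreover have "s * v = - of_real ((cmod v)\<^sup>2 / k)" "cnj s * cnj v = - of_real ((cmod v)\<^sup>2 / k)"
    "of_real k * (cnj s * s) = of_real ((cmod v)\<^sup>2 / k)"
    unfolding s_def using k(2) by (simp_all add: complex_norm_square mult.commute del: of_real_power)
  ultimately have "Re (kernel_form K ((s, a) # xs)) = Re (kernel_form K xs) - (cmod v)\<^sup>2 / k"
    by simp
  moreover have "0 \<le> Re (kernel_form K ((s, a) # xs))"
    using K a xs unfolding psd_def by (metis image_insert insert_subset list.simps(15) snd_conv)
  ultimately have "(cmod v)\<^sup>2 / k \<le> Re (kernel_form K xs)"
    by simp
  then have "(cmod v)\<^sup>2 \<le> k * Re (kernel_form K xs)"
    using k(2) by (simp add: field_simps)
  then show "0 \<le> Re (of_real k * kernel_form K xs - of_real ((cmod (\<Sum>(c, z)\<leftarrow>xs. cnj c * K z a))\<^sup>2))"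
    unfolding v_def by simp
qed

text \<open>
  The kernel of the Dirichlet space of functions vanishing at \<open>0\<close>.  Unlike the Dirichlet kernel
  itself it transforms additively under automorphisms.
\<close>

definition log_kernel :: "complex \<Rightarrow> complex \<Rightarrow> complex" where
  "log_kernel z w = - Ln (1 - z * cnj w)"

lemma log_kernel_sums: "cmod x < 1 \<Longrightarrow> (\<lambda>n. complex_of_real (1 / of_nat n) * x ^ n) sums (- Ln (1 - x))"
  using sums_minus[OF Ln_series'[of "- x"]] by simp

lemma psd_log_kernel: "psd log_kernel"
  using psd_power_series[where c = "\<lambda>n. 1 / of_nat n", OF _ log_kernel_sums]
  unfolding log_kernel_def by simp

lemma one_sums: "(\<lambda>n. complex_of_real (if n = 0 then 1 else 0) * x ^ n) sums 1"
proof -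
  have "(\<lambda>n. if n = 0 then 1 else 0 :: complex) sums 1"
    using sums_single[of 0 "\<lambda>_. 1 :: complex"] by simp
  then show ?thesis
    by (rule back_subst[where P = "\<lambda>f. f sums _"]) auto
qed

text \<open>
  \<open>D \<le> 1 + log_kernel \<le> 2 D\<close>: the coefficients of positive degree are \<open>1 / (n + 1)\<close> and \<open>1 / n\<close>.
\<close>

lemma psd_log_minus_dirichlet: "psd (\<lambda>z w. 1 + log_kernel z w - dirichlet_kernel z w)"
proof -
  define c :: "nat \<Rightarrow> real" where "c n = (if n = 0 then 1 else 0) + 1 / of_nat n - 1 / of_nat (n + 1)" for n
  have "c n \<ge> 0" for n
    by (cases n) (auto simp: c_def field_simps)
  moreover have "(\<lambda>n. complex_of_real (c n) * x ^ n) sums (1 + (- Ln (1 - x)) - (\<Sum>n. 1 / of_nat (n + 1) * x ^ n))"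
    if "cmod x < 1" for x
    using sums_diff[OF sums_add[OF one_sums log_kernel_sums[OF that]] one_over_Suc_sums[OF that]]
    unfolding c_def of_real_add of_real_diff distrib_right left_diff_distrib .
  ultimately show ?thesis
    using psd_power_series[of c "\<lambda>x. 1 + (- Ln (1 - x)) - (\<Sum>n. 1 / of_nat (n + 1) * x ^ n)"] unfolding log_kernel_def dirichlet_kernel_def by simp
qed

lemma psd_dirichlet_minus_log: "psd (\<lambda>z w. 2 * dirichlet_kernel z w - (1 + log_kernel z w))"
proof -
  define c :: "nat \<Rightarrow> real" where "c n = 2 * (1 / of_nat (n + 1)) - ((if n = 0 then 1 else 0) + 1 / of_nat n)" for n
  have "c n \<ge> 0" for n
    by (cases n) (auto simp: c_def field_simps)
  moreover have "(\<lambda>n. complex_of_real (c n) * x ^ n) sums (2 * (\<Sum>n. 1 / of_nat (n + 1) * x ^ n) - (1 + (- Ln (1 - x))))"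
    if "cmod x < 1" for x
    using sums_diff[OF sums_mult[OF one_over_Suc_sums[OF that], of 2] sums_add[OF one_sums log_kernel_sums[OF that]]]
    unfolding c_def of_real_add of_real_diff of_real_mult distrib_right left_diff_distrib mult.assoc by simp
  ultimately show ?thesis
    using psd_power_series[of c "\<lambda>x. 2 * (\<Sum>n. 1 / of_nat (n + 1) * x ^ n) - (1 + (- Ln (1 - x)))"] unfolding log_kernel_def dirichlet_kernel_def by simp
qed

text \<open>
  Composition with an automorphism changes \<open>log_kernel\<close> by a constant \<open>t\<close> and by
  \<open>h z + cnj (h w)\<close>.  The latter is at most \<open>1 + h z * cnj (h w)\<close>, and
  \<open>h z * cnj (h w)\<close> is at most \<open>t\<close> times \<open>log_kernel\<close> because \<open>h\<close> is, up to sign, the kernel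
  function at \<open>a\<close>.
\<close>

lemma psd_log_kernel_moebius:
  assumes c: "cmod c = 1" and a: "cmod a < 1"
  obtains C where "C \<ge> 0" "psd (\<lambda>z w. complex_of_real C * (1 + log_kernel z w)
      - (1 + log_kernel (moebius_map c a z) (moebius_map c a w)))"
proof -
  define t where "t = - ln (1 - (cmod a)\<^sup>2)"
  define h where "h z = Ln (1 - cnj a * z)" for z
  have a1: "0 < 1 - (cmod a)\<^sup>2" using a by (simp add: abs_square_less_1)
  have t0: "t \<ge> 0"
    using a1 unfolding t_def by simp
  have "psd (\<lambda>z w. of_real t * log_kernel z w - h z * cnj (h w))"
  proof (cases "a = 0")
    case True
    then show ?thesis using psd_rank_one[of "\<lambda>_. 0"] by (simp add: t_def h_def)
  next
    case False
    have "1 - a * cnj a = of_real (1 - (cmod a)\<^sup>2)"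
      by (simp only: of_real_diff of_real_1 complex_norm_square)
    then have k1: "log_kernel a a = of_real t"
      unfolding log_kernel_def t_def by (simp only: Ln_of_real[OF a1] of_real_minus)
    have k2: "t > 0"
      using a1 False unfolding t_def by simp
    have k3: "log_kernel a z = cnj (log_kernel z a)" if "z \<in> ball 0 1" for z
    proof -
      have "Re (1 - z * cnj a) > 0"
        using complex_Re_le_cmod[of "z * cnj a"] norm_mult_cnj_less_1[OF that, of a] a by simp
      then have "1 - z * cnj a \<notin> \<real>\<^sub>\<le>\<^sub>0"
        by (auto simp: complex_nonpos_Reals_iff)
      from cnj_Ln[OF this] show ?thesis
        unfolding log_kernel_def by (simp add: mult.commute)
    qed
    have "a \<in> ball 0 1" using a by simp
    then have "psd (\<lambda>z w. of_real t * log_kernel z w - log_kernel z a * cnj (log_kernel w a))"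
      using psd_cauchy_schwarz[where K = log_kernel and a = a and k = t, OF psd_log_kernel k3 _ k1 k2] by blast
    then show ?thesis
      unfolding h_def log_kernel_def by (simp add: mult.commute)
  qed
  from psd_add[OF psd_add[OF psd_add[OF this psd_rank_one[of "\<lambda>z. 1 - h z"]]
        psd_scale[OF psd_log_kernel, of "1 + t"]] psd_scale[OF psd_one t0]] t0
  have "psd (\<lambda>z w. (of_real t * log_kernel z w - h z * cnj (h w)) + (1 - h z) * cnj (1 - h w)
      + of_real (1 + t) * log_kernel z w + of_real t * 1)" by simp
  then have "psd (\<lambda>z w. complex_of_real (2 + 2 * t) * (1 + log_kernel z w)
      - (1 + log_kernel (moebius_map c a z) (moebius_map c a w)))"
  proof (rule psd_cong)
    fix z w :: complex assume "z \<in> ball 0 1" "w \<in> ball 0 1"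
    then have "log_kernel (moebius_map c a z) (moebius_map c a w) = of_real t + log_kernel z w + h z + cnj (h w)"
      using Ln_one_minus_moebius_map[OF c a, of z w] unfolding log_kernel_def t_def h_def by simp
    then show "(of_real t * log_kernel z w - h z * cnj (h w)) + (1 - h z) * cnj (1 - h w)
      + of_real (1 + t) * log_kernel z w + of_real t * 1
      = complex_of_real (2 + 2 * t) * (1 + log_kernel z w)
      - (1 + log_kernel (moebius_map c a z) (moebius_map c a w))"
      by (simp add: algebra_simps)
  qed
  then show thesis using that[of "2 + 2 * t"] t0 by simp
qed

lemma psd_dirichlet_moebius:
  assumes c: "cmod c = 1" and a: "cmod a < 1"
  obtains C where "C \<ge> 0" "psd (\<lambda>z w. complex_of_real C * dirichlet_kernel z w
      - dirichlet_kernel (moebius_map c a z) (moebius_map c a w))"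
proof -
  obtain C where C: "C \<ge> 0" and pC: "psd (\<lambda>z w. complex_of_real C * (1 + log_kernel z w)
      - (1 + log_kernel (moebius_map c a z) (moebius_map c a w)))"
    by (rule psd_log_kernel_moebius[OF assms])
  have p1: "psd (\<lambda>z w. 1 * (1 + log_kernel (moebius_map c a z) (moebius_map c a w)
      - dirichlet_kernel (moebius_map c a z) (moebius_map c a w)) * cnj 1)"
    by (rule psd_transform[OF psd_log_minus_dirichlet, of "moebius_map c a" "\<lambda>_. 1"])
      (use norm_moebius_map[OF c a] in simp)
  have "psd (\<lambda>z w. complex_of_real (2 * C) * dirichlet_kernel z w
      - dirichlet_kernel (moebius_map c a z) (moebius_map c a w))"
    using psd_add[OF psd_add[OF p1 pC] psd_scale[OF psd_dirichlet_minus_log C]]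
    by (rule psd_cong) (simp add: algebra_simps)
  then show thesis using that[of "2 * C"] C by simp
qed

text \<open>
  The weight absorbs the power kernel exactly, so the claim is \<open>psd_dirichlet_moebius\<close> multiplied by
  that kernel.  The weight is arbitrary subject to invariance, so as to cover the weight
  \<open>1 / (\<psi> \<circ> \<phi>\<^sup>-\<^sup>1)\<close> of the inverse operator.
\<close>

lemma psd_weighted_composition:
  assumes l: "l > 0" and c: "cmod c = 1" and a: "cmod a < 1"
    and w: "\<And>z w. z \<in> ball 0 1 \<Longrightarrow> w \<in> ball 0 1 \<Longrightarrow>
      \<psi> z * power_kernel l (moebius_map c a z) (moebius_map c a w) * cnj (\<psi> w) = power_kernel l z w"
  obtains C where "C \<ge> 0" "psd (\<lambda>z w. complex_of_real (C\<^sup>2) * (dirichlet_kernel z w * power_kernel l z w)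
    - \<psi> z * (dirichlet_kernel (moebius_map c a z) (moebius_map c a w)
        * power_kernel l (moebius_map c a z) (moebius_map c a w)) * cnj (\<psi> w))"
proof -
  obtain C where C: "C \<ge> 0" and pC: "psd (\<lambda>z w. complex_of_real C * dirichlet_kernel z w
      - dirichlet_kernel (moebius_map c a z) (moebius_map c a w))"
    by (rule psd_dirichlet_moebius[OF c a])
  have "psd (\<lambda>z w. complex_of_real ((sqrt C)\<^sup>2) * (dirichlet_kernel z w * power_kernel l z w)
    - \<psi> z * (dirichlet_kernel (moebius_map c a z) (moebius_map c a w)
        * power_kernel l (moebius_map c a z) (moebius_map c a w)) * cnj (\<psi> w))"
    using psd_power_kernel_mult[OF l pC]
  proof (rule psd_cong)
    fix z v :: complex assume zv: "z \<in> ball 0 1" "v \<in> ball 0 1"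
    have "\<psi> z * (dirichlet_kernel (moebius_map c a z) (moebius_map c a v)
        * power_kernel l (moebius_map c a z) (moebius_map c a v)) * cnj (\<psi> v)
        = dirichlet_kernel (moebius_map c a z) (moebius_map c a v) * power_kernel l z v"
      unfolding w[OF zv, symmetric] by (simp only: mult_ac)
    then show "power_kernel l z v * (complex_of_real C * dirichlet_kernel z v
        - dirichlet_kernel (moebius_map c a z) (moebius_map c a v))
      = complex_of_real ((sqrt C)\<^sup>2) * (dirichlet_kernel z v * power_kernel l z v)
        - \<psi> z * (dirichlet_kernel (moebius_map c a z) (moebius_map c a v)
        * power_kernel l (moebius_map c a z) (moebius_map c a v)) * cnj (\<psi> v)"
      using C by (simp add: algebra_simps)
  qed
  then show thesis using that[of "sqrt C"] C by simp
qed

lemma psd_kernel_minus_one: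
  assumes l: "l > 0" shows "psd (\<lambda>z w. dirichlet_kernel z w * power_kernel l z w - 1)"
proof -
  have "psd (\<lambda>z w. power_kernel l z w * (dirichlet_kernel z w - 1))"
  proof (rule psd_power_kernel_mult[OF l])
    define c :: "nat \<Rightarrow> real" where "c n = 1 / of_nat (n + 1) - (if n = 0 then 1 else 0)" for n
    have "c n \<ge> 0" for n by (simp add: c_def)
    moreover have "(\<lambda>n. complex_of_real (c n) * x ^ n) sums ((\<Sum>n. 1 / of_nat (n + 1) * x ^ n) - 1)"
      if "cmod x < 1" for x
      using sums_diff[OF one_over_Suc_sums[OF that] one_sums]
      unfolding c_def of_real_diff left_diff_distrib .
    ultimately show "psd (\<lambda>z w. dirichlet_kernel z w - 1)"
      using psd_power_series[of c "\<lambda>x. (\<Sum>n. 1 / of_nat (n + 1) * x ^ n) - 1"] unfolding dirichlet_kernel_def by simp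
  qed
  moreover have "psd (\<lambda>z w. power_kernel l z w - 1)"
  proof -
    define c :: "nat \<Rightarrow> real" where "c n = binom_coeff l n - (if n = 0 then 1 else 0)" for n
    have "c n \<ge> 0" for n
      using binom_coeff_nonneg[OF l, of n] by (simp add: c_def) (simp add: binom_coeff_def)
    moreover have "(\<lambda>n. complex_of_real (c n) * x ^ n) sums ((1 - x) powr (- of_real l) - 1)"
      if "cmod x < 1" for x
      using sums_diff[OF binom_coeff_sums[OF that] one_sums]
      unfolding c_def of_real_diff left_diff_distrib .
    ultimately show ?thesis
      using psd_power_series[of c "\<lambda>x. (1 - x) powr (- of_real l) - 1"] unfolding power_kernel_def by simp
  qed
  ultimately have "psd (\<lambda>z w. power_kernel l z w * (dirichlet_kernel z w - 1) + (power_kernel l z w - 1))"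
    by (rule psd_add)
  then show ?thesis by (rule psd_cong) (simp add: algebra_simps)
qed

section \<open>Multipliers and the functional calculus\<close>

locale dirichlet_power_space =
  fixes l :: real and H :: "(complex \<Rightarrow> complex) hilbert"
  assumes l_pos: "l > 0"
    and kernel: "is_rkhs H (\<lambda>z w. dirichlet_kernel z w * power_kernel l z w)"

sublocale dirichlet_power_space \<subseteq> rkhs H "\<lambda>z w. dirichlet_kernel z w * power_kernel l z w"
  by unfold_locales (rule kernel)

context dirichlet_power_space
begin

abbreviation mult :: "(complex \<Rightarrow> complex) \<Rightarrow> (complex \<Rightarrow> complex) \<Rightarrow> complex \<Rightarrow> complex" where
  "mult \<theta> \<equiv> wcomp \<theta> (\<lambda>z. z)"

abbreviation cauchy_mult :: "complex \<Rightarrow> (complex \<Rightarrow> complex) \<Rightarrow> complex \<Rightarrow> complex" where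
  "cauchy_mult \<zeta> \<equiv> mult (\<lambda>z. 1 / (\<zeta> - z))"

definition mult_bound :: real where
  "mult_bound = sqrt (max 1 (1 / l))"

lemma mult_bound_ge_0: "0 \<le> mult_bound"
  unfolding mult_bound_def by simp

lemma psd_moebius_multiplier:
  assumes "cmod c = 1" "cmod a < 1"
  shows "psd (\<lambda>z w. complex_of_real (mult_bound\<^sup>2) * (dirichlet_kernel z w * power_kernel l z w)
     - moebius_map c a z * (dirichlet_kernel z w * power_kernel l z w) * cnj (moebius_map c a w))"
proof -
  have "mult_bound\<^sup>2 = max 1 (1 / l)"
    unfolding mult_bound_def by (rule real_sqrt_pow2) simp
  then show ?thesis
    using psd_multiplier[OF l_pos _ assms] by simp
qed

lemmas mult_moebius_map =
  weighted_composition[OF _ mult_bound_ge_0 psd_moebius_multiplier]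

lemmas bounded_op_mult_moebius_map =
  bounded_op_wcomp[OF _ mult_bound_ge_0 psd_moebius_multiplier]

lemma mult_z_eq: "f \<in> hcarrier H \<Longrightarrow> mult_z f = mult (moebius_map 1 0) f"
  using carrier_outside by (auto simp: mult_z_def wcomp_def moebius_map_def fun_eq_iff)

lemma bounded_op_mult_z: "bounded_op H H mult_z"
proof -
  have "bounded_op H H (mult (moebius_map 1 0))"
    by (rule bounded_op_mult_moebius_map) auto
  then show ?thesis
    unfolding bounded_op_def using mult_z_eq by (simp add: carrier_add carrier_scale)
qed

text \<open>
  For \<open>a = 1 / cnj \<zeta>\<close> the function \<open>1 / (\<zeta> - z)\<close> is an affine function of the automorphism
  \<open>(z - a) / (1 - cnj a * z)\<close>.  So the resolvent is controlled by multipliers already bounded.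
\<close>

lemma cauchy_mult_bound:
  assumes r: "r > 1"
  obtains C where "\<And>\<zeta> f. cmod \<zeta> = r \<Longrightarrow> f \<in> hcarrier H \<Longrightarrow> cauchy_mult \<zeta> f \<in> hcarrier H"
    "\<And>\<zeta> f. cmod \<zeta> = r \<Longrightarrow> f \<in> hcarrier H \<Longrightarrow> hnorm H (cauchy_mult \<zeta> f) \<le> C * hnorm H f"
proof -
  define C where "C = (1 / r) / (1 - (1 / r)\<^sup>2) + (1 / r)\<^sup>2 / (1 - (1 / r)\<^sup>2) * mult_bound"
  have r1: "(1 / r)\<^sup>2 < 1" using r by (simp add: abs_square_less_1)
  have main: "cauchy_mult \<zeta> f \<in> hcarrier H \<and> hnorm H (cauchy_mult \<zeta> f) \<le> C * hnorm H f"
    if \<zeta>: "cmod \<zeta> = r" and f: "f \<in> hcarrier H" for \<zeta> f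
  proof -
    define a where "a = 1 / cnj \<zeta>"
    have a: "cmod a = 1 / r" "cmod a < 1" "cnj a = 1 / \<zeta>" "\<zeta> \<noteq> 0"
      using \<zeta> r unfolding a_def by (auto simp: norm_divide)
    define \<alpha> where "\<alpha> = cnj a / of_real (1 - (cmod a)\<^sup>2)"
    define \<beta> where "\<beta> = (cnj a)\<^sup>2 / of_real (1 - (cmod a)\<^sup>2)"
    define g where "g = mult (moebius_map 1 a) f"
    have g: "g \<in> hcarrier H" "hnorm H g \<le> mult_bound * hnorm H f"
      unfolding g_def by (rule mult_moebius_map; use a f in simp)+
    have "cauchy_mult \<zeta> f = hscale H \<alpha> f + hscale H \<beta> g"
    proof
      fix z
      show "cauchy_mult \<zeta> f z = (hscale H \<alpha> f + hscale H \<beta> g) z"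
      proof (cases "z \<in> ball 0 1")
        case True
        then have z: "cmod z < 1" by simp
        have nz: "1 - cnj a * z \<noteq> 0"
          by (rule one_minus_cnj_mult_ne_0[OF a(2) z])
        have D: "complex_of_real (1 - (cmod a)\<^sup>2) = 1 - a * cnj a"
          by (simp only: of_real_diff of_real_1 complex_norm_square)
        have D0: "1 - a * cnj a \<noteq> 0"
          using one_minus_cnj_mult_ne_0[OF a(2) a(2)] by (simp add: mult.commute)
        have "1 / (\<zeta> - z) = cnj a / (1 - cnj a * z)"
          unfolding a(3) using a(4) by (simp add: field_simps)
        moreover have "1 + cnj a * moebius_map 1 a z = (1 - a * cnj a) / (1 - cnj a * z)"
          unfolding moebius_map_def using nz by (simp add: field_simps)
        moreover have "\<alpha> + \<beta> * moebius_map 1 a z = cnj a * (1 + cnj a * moebius_map 1 a z) / (1 - a * cnj a)"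
          unfolding \<alpha>_def \<beta>_def D by (simp add: add_divide_distrib power2_eq_square algebra_simps)
        ultimately have "1 / (\<zeta> - z) = \<alpha> + \<beta> * moebius_map 1 a z"
          using D0 by simp
        then show ?thesis
          using True by (simp add: hscale g_def wcomp_def distrib_right)
      next
        case False
        then show ?thesis
          using carrier_outside[OF f] by (simp add: hscale g_def wcomp_def)
      qed
    qed
    moreover have "hnorm H (hscale H \<alpha> f + hscale H \<beta> g) \<le> C * hnorm H f"
    proof -
      have "hnorm H (hscale H \<alpha> f + hscale H \<beta> g) \<le> cmod \<alpha> * hnorm H f + cmod \<beta> * hnorm H g"
        using hnorm_triangle[OF carrier_scale[OF f] carrier_scale[OF g(1)]]
        by (simp only: hnorm_scale[OF f] hnorm_scale[OF g(1)])
      also have "\<dots> \<le> cmod \<alpha> * hnorm H f + cmod \<beta> * (mult_bound * hnorm H f)"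
        using g(2) by (intro add_left_mono mult_left_mono) auto
      also have "cmod \<alpha> = (1 / r) / (1 - (1 / r)\<^sup>2)"
        unfolding \<alpha>_def norm_divide norm_of_real using r1 by (simp add: a(1))
      also have "cmod \<beta> = (1 / r)\<^sup>2 / (1 - (1 / r)\<^sup>2)"
        unfolding \<beta>_def norm_divide norm_of_real norm_power using r1 by (simp add: a(1))
      finally show ?thesis unfolding C_def by (simp only: distrib_right mult.assoc)
    qed
    ultimately show ?thesis
      using carrier_add[OF carrier_scale[OF f] carrier_scale[OF g(1)]] by simp
  qed
  then show thesis using that by blast
qed

lemma cauchy_mult_carrier:
  assumes "1 < cmod \<zeta>" "f \<in> hcarrier H" shows "cauchy_mult \<zeta> f \<in> hcarrier H"
  using cauchy_mult_bound[OF assms(1)] assms(2) by metis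

lemma bounded_op_cauchy_mult:
  assumes "1 < cmod \<zeta>" shows "bounded_op H H (cauchy_mult \<zeta>)"
proof -
  obtain C where "\<And>f. f \<in> hcarrier H \<Longrightarrow> hnorm H (cauchy_mult \<zeta> f) \<le> C * hnorm H f"
    using cauchy_mult_bound[OF assms] by metis
  then show ?thesis
    unfolding bounded_op_def using cauchy_mult_carrier[OF assms]
    by (auto simp: wcomp_def hscale fun_eq_iff distrib_left)
qed

lemma cauchy_mult_inverse:
  assumes \<zeta>: "1 < cmod \<zeta>" and f: "f \<in> hcarrier H"
  shows "hscale H \<zeta> (cauchy_mult \<zeta> f) - mult_z (cauchy_mult \<zeta> f) = f"
    "cauchy_mult \<zeta> (hscale H \<zeta> f - mult_z f) = f"
proof -
  have nz: "\<zeta> - z \<noteq> 0" if "cmod z < 1" for z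
    using \<zeta> that by auto
  show "hscale H \<zeta> (cauchy_mult \<zeta> f) - mult_z (cauchy_mult \<zeta> f) = f"
  proof
    fix z show "(hscale H \<zeta> (cauchy_mult \<zeta> f) - mult_z (cauchy_mult \<zeta> f)) z = f z"
      using nz[of z] carrier_outside[OF f, of z]
      by (simp add: hscale mult_z_def wcomp_def left_diff_distrib[symmetric] flip: diff_divide_distrib)
  qed
  show "cauchy_mult \<zeta> (hscale H \<zeta> f - mult_z f) = f"
  proof
    fix z show "cauchy_mult \<zeta> (hscale H \<zeta> f - mult_z f) z = f z"
      using nz[of z] carrier_outside[OF f, of z]
      by (simp add: hscale mult_z_def wcomp_def left_diff_distrib[symmetric])
  qed
qed

lemma disc_operator_mult_z: "disc_operator H mult_z"
proof -
  have "spectrum H mult_z \<subseteq> cball 0 1"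
  proof
    fix \<mu> assume \<mu>: "\<mu> \<in> spectrum H mult_z"
    show "\<mu> \<in> cball 0 1"
    proof (rule ccontr)
      assume "\<mu> \<notin> cball 0 1"
      then have "1 < cmod \<mu>" by simp
      then show False
        using \<mu> bounded_op_cauchy_mult cauchy_mult_inverse unfolding spectrum_def by blast
    qed
  qed
  then show ?thesis
    unfolding disc_operator_def using separable bounded_op_mult_z by blast
qed

lemma resolvent_mult_z:
  assumes "1 < cmod \<zeta>" "f \<in> hcarrier H"
  shows "resolvent H mult_z \<zeta> f = cauchy_mult \<zeta> f"
  unfolding resolvent_def
proof (rule inv_into_f_eq)
  show "inj_on (\<lambda>x. hscale H \<zeta> x - mult_z x) (hcarrier H)"
    by (rule inj_on_inverseI[where g = "cauchy_mult \<zeta>"]) (rule cauchy_mult_inverse(2)[OF assms(1)])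
qed (rule cauchy_mult_carrier[OF assms], rule cauchy_mult_inverse(1)[OF assms])

text \<open>
  Against a kernel function the integral is the Cauchy formula for point values; the uniform bound
  on the resolvent over the circle passes the identity to limits of combinations of kernel functions.
\<close>

lemma cauchy_integral:
  assumes r: "1 < r" "r < \<rho>" and F: "F holomorphic_on ball 0 \<rho>"
    and f: "f \<in> hcarrier H" and g: "g \<in> hcarrier H" and y: "y \<in> hcarrier H"
    and gF: "\<And>z. z \<in> ball 0 1 \<Longrightarrow> g z = F z * f z"
  shows "((\<lambda>\<zeta>. F \<zeta> * hinner H (cauchy_mult \<zeta> f) y) has_contour_integral
      2 * of_real pi * \<i> * hinner H g y) (circlepath 0 r)"
proof -
  obtain C where C: "\<And>\<zeta> f. cmod \<zeta> = r \<Longrightarrow> f \<in> hcarrier H \<Longrightarrow> cauchy_mult \<zeta> f \<in> hcarrier H"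
    "\<And>\<zeta> f. cmod \<zeta> = r \<Longrightarrow> f \<in> hcarrier H \<Longrightarrow> hnorm H (cauchy_mult \<zeta> f) \<le> C * hnorm H f"
    using cauchy_mult_bound[OF r(1)] by blast
  have Fc: "F holomorphic_on cball 0 r"
    using F r by (auto intro: holomorphic_on_subset)
  have comb: "((\<lambda>\<zeta>. F \<zeta> * hinner H (cauchy_mult \<zeta> f) (kcomb xs)) has_contour_integral
      2 * of_real pi * \<i> * hinner H g (kcomb xs)) (circlepath 0 r)"
    if xs: "snd ` set xs \<subseteq> ball 0 1" for xs
  proof -
    have "((\<lambda>\<zeta>. \<Sum>(c, w)\<leftarrow>xs. cnj c * f w * (F \<zeta> / (\<zeta> - w))) has_contour_integral
        (\<Sum>(c, w)\<leftarrow>xs. cnj c * f w * (2 * of_real pi * \<i> * F w))) (circlepath 0 r)"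
      using xs
    proof (induction xs)
      case Nil
      then show ?case by (simp add: has_contour_integral_0)
    next
      case (Cons x xs)
      obtain c w where x: "x = (c, w)" by force
      have w: "cmod (w - 0) < r" using Cons.prems x r by auto
      have "snd ` set xs \<subseteq> ball 0 1" using Cons.prems by simp
      from has_contour_integral_add[OF
          has_contour_integral_lmul[OF Cauchy_integral_circlepath_simple[OF Fc w], of "cnj c * f w"] Cons.IH[OF this]]
      show ?case
        unfolding x by (simp only: list.map sum_list.Cons prod.case)
    qed
    moreover have "(\<Sum>(c, w)\<leftarrow>xs. cnj c * f w * (2 * of_real pi * \<i> * F w)) = 2 * of_real pi * \<i> * hinner H g (kcomb xs)"
    proof -
      have "hinner H g (kcomb xs) = (\<Sum>(c, w)\<leftarrow>xs. cnj c * (F w * f w))"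
        unfolding inner_kcomb[OF xs g]
        by (intro arg_cong[where f = sum_list] map_cong refl) (use xs gF in force)
      then show ?thesis
        by (simp add: case_prod_unfold sum_list_const_mult[symmetric] mult_ac)
    qed
    moreover have "(\<Sum>(c, w)\<leftarrow>xs. cnj c * f w * (F \<zeta> / (\<zeta> - w))) = F \<zeta> * hinner H (cauchy_mult \<zeta> f) (kcomb xs)"
      if \<zeta>: "\<zeta> \<in> path_image (circlepath 0 r)" for \<zeta>
    proof -
      have "cmod \<zeta> = r" using \<zeta> r by simp
      have "hinner H (cauchy_mult \<zeta> f) (kcomb xs) = (\<Sum>(c, w)\<leftarrow>xs. cnj c * (f w / (\<zeta> - w)))"
        unfolding inner_kcomb[OF xs C(1)[OF \<open>cmod \<zeta> = r\<close> f]]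
        by (intro arg_cong[where f = sum_list] map_cong refl) (use xs in \<open>auto simp: wcomp_def image_subset_iff\<close>)
      then show ?thesis
        by (simp add: case_prod_unfold sum_list_const_mult[symmetric] mult_ac)
    qed
    ultimately show ?thesis
      using has_contour_integral_eq by (metis (no_types, lifting))
  qed
  have "\<exists>xs. snd ` set xs \<subseteq> ball 0 1 \<and> hnorm H (y - kcomb xs) < 1 / of_nat (Suc n)" for n
  proof -
    have det: "h = 0" if "h \<in> hcarrier H" "\<And>w. w \<in> ball 0 1 \<Longrightarrow> h w = 0" for h
      by (rule carrier_eqI) (use that in auto)
    have pos: "0 < 1 / real (Suc n)" by simp
    show ?thesis
      by (rule kcomb_dense[OF y order.refl det pos]) blast+
  qed
  then obtain X where X: "\<And>n. snd ` set (X n) \<subseteq> ball 0 1"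
    and Xy: "\<And>n. hnorm H (y - kcomb (X n)) < 1 / of_nat (Suc n)"
    by metis
  have kX: "kcomb (X n) \<in> hcarrier H" for n
    using X kcomb_carrier by blast
  have lim: "(\<lambda>n. hnorm H (kcomb (X n) - y)) \<longlonglongrightarrow> 0"
  proof (rule Lim_null_comparison[OF _ LIMSEQ_Suc[OF lim_1_over_n]])
    show "\<forall>\<^sub>F n in sequentially. norm (hnorm H (kcomb (X n) - y)) \<le> 1 / of_nat (Suc n)"
      using Xy hnorm_ge_0[OF carrier_diff[OF kX y]] hnorm_minus_commute[OF y kX]
      by (intro always_eventually allI) (simp add: less_imp_le)
  qed
  have "compact (F ` sphere 0 r)"
    using Fc by (intro compact_continuous_image holomorphic_on_imp_continuous_on)
      (auto intro: holomorphic_on_subset)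
  then obtain M where M: "M > 0" "\<And>\<zeta>. cmod \<zeta> = r \<Longrightarrow> cmod (F \<zeta>) \<le> M"
    using bounded_pos compact_imp_bounded by (metis imageI mem_sphere_0)
  have ulim: "uniform_limit (sphere 0 r :: complex set) (\<lambda>n \<zeta>. F \<zeta> * hinner H (cauchy_mult \<zeta> f) (kcomb (X n)))
      (\<lambda>\<zeta>. F \<zeta> * hinner H (cauchy_mult \<zeta> f) y) sequentially"
  proof (rule uniform_limitI)
    fix e :: real assume "e > 0"
    have "(\<lambda>n. M * (C * hnorm H f) * hnorm H (kcomb (X n) - y)) \<longlonglongrightarrow> 0"
      using tendsto_mult_right_zero[OF lim] .
    then have "\<forall>\<^sub>F n in sequentially. M * (C * hnorm H f) * hnorm H (kcomb (X n) - y) < e"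
      using \<open>e > 0\<close> by (rule order_tendstoD(2))
    then show "\<forall>\<^sub>F n in sequentially. \<forall>\<zeta>\<in>sphere 0 r.
        dist (F \<zeta> * hinner H (cauchy_mult \<zeta> f) (kcomb (X n))) (F \<zeta> * hinner H (cauchy_mult \<zeta> f) y) < e"
    proof (rule eventually_mono, intro ballI)
      fix n and \<zeta> :: complex assume n: "M * (C * hnorm H f) * hnorm H (kcomb (X n) - y) < e" and "\<zeta> \<in> sphere (0 :: complex) r"
      then have \<zeta>: "cmod \<zeta> = r" by simp
      note cm = C(1)[OF \<zeta> f]
      have "dist (F \<zeta> * hinner H (cauchy_mult \<zeta> f) (kcomb (X n))) (F \<zeta> * hinner H (cauchy_mult \<zeta> f) y)
          = cmod (F \<zeta>) * cmod (hinner H (cauchy_mult \<zeta> f) (kcomb (X n) - y))"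
        unfolding dist_norm inner_diff_right[OF cm kX y] right_diff_distrib[symmetric] norm_mult ..
      also have "\<dots> \<le> M * ((C * hnorm H f) * hnorm H (kcomb (X n) - y))"
      proof (rule mult_mono)
        have "cmod (hinner H (cauchy_mult \<zeta> f) (kcomb (X n) - y))
            \<le> hnorm H (cauchy_mult \<zeta> f) * hnorm H (kcomb (X n) - y)"
          by (rule cauchy_schwarz[OF cm carrier_diff[OF kX y]])
        also have "\<dots> \<le> (C * hnorm H f) * hnorm H (kcomb (X n) - y)"
          by (rule mult_right_mono[OF C(2)[OF \<zeta> f] hnorm_ge_0[OF carrier_diff[OF kX y]]])
        finally show "cmod (hinner H (cauchy_mult \<zeta> f) (kcomb (X n) - y))
            \<le> (C * hnorm H f) * hnorm H (kcomb (X n) - y)" .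
      qed (use M \<zeta> in auto)
      finally show "dist (F \<zeta> * hinner H (cauchy_mult \<zeta> f) (kcomb (X n))) (F \<zeta> * hinner H (cauchy_mult \<zeta> f) y) < e"
        using n by (simp only: mult.assoc)
    qed
  qed
  have ev: "\<forall>\<^sub>F n in sequentially. (\<lambda>\<zeta>. F \<zeta> * hinner H (cauchy_mult \<zeta> f) (kcomb (X n)))
      contour_integrable_on (circlepath 0 r)" and r0: "0 < r"
    using has_contour_integral_integrable[OF comb[OF X]] r by auto
  have *: "(\<lambda>\<zeta>. F \<zeta> * hinner H (cauchy_mult \<zeta> f) y) contour_integrable_on (circlepath 0 r)"
    "(\<lambda>n. contour_integral (circlepath 0 r) (\<lambda>\<zeta>. F \<zeta> * hinner H (cauchy_mult \<zeta> f) (kcomb (X n))))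
      \<longlonglongrightarrow> contour_integral (circlepath 0 r) (\<lambda>\<zeta>. F \<zeta> * hinner H (cauchy_mult \<zeta> f) y)"
    using contour_integral_uniform_limit_circlepath[OF ev ulim sequentially_bot r0] by blast+
  have "(\<lambda>n. 2 * of_real pi * \<i> * hinner H g (kcomb (X n))) \<longlonglongrightarrow> 2 * of_real pi * \<i> * hinner H g y"
    by (intro tendsto_mult_left inner_tendsto_right kX y g lim)
  then have "contour_integral (circlepath 0 r) (\<lambda>\<zeta>. F \<zeta> * hinner H (cauchy_mult \<zeta> f) y)
      = 2 * of_real pi * \<i> * hinner H g y"
    using *(2) unfolding contour_integral_unique[OF comb[OF X]] by (rule LIMSEQ_unique[rotated])
  then show ?thesis
    using has_contour_integral_integral[OF *(1)] by simp
qed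

end

section \<open>Moebius boundedness and weak homogeneity\<close>

context dirichlet_power_space
begin

lemma hol_calculus_mult_z:
  assumes c: "cmod c = 1" and a: "cmod a < 1" and \<phi>: "\<And>z. cmod z < 1 \<Longrightarrow> \<phi> z = moebius_map c a z"
  shows "hol_calculus H mult_z \<phi> (mult (moebius_map c a))"
proof -
  \<comment> \<open>A radius in \<open>(1, 1 / \<bar>a\<bar>)\<close> that is also defined for \<open>a = 0\<close>.\<close>
  define \<rho> where "\<rho> = 2 / (1 + cmod a)"
  define r where "r = (1 + \<rho>) / 2"
  have \<rho>: "1 < \<rho>" using a unfolding \<rho>_def by (simp add: field_simps add_pos_nonneg)
  have r: "1 < r" "r < \<rho>" using \<rho> unfolding r_def by auto
  have "cmod a * \<rho> \<le> 1" using a unfolding \<rho>_def by (simp add: field_simps add_pos_nonneg)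
  then have hol: "moebius_map c a holomorphic_on ball 0 \<rho>"
    by (rule holomorphic_moebius_map)
  have "((\<lambda>\<zeta>. moebius_map c a \<zeta> * hinner H (resolvent H mult_z \<zeta> x) y) has_contour_integral
      2 * of_real pi * \<i> * hinner H (mult (moebius_map c a) x) y) (circlepath 0 r)"
    if x: "x \<in> hcarrier H" and y: "y \<in> hcarrier H" for x y
  proof -
    have "mult (moebius_map c a) x \<in> hcarrier H"
      by (rule mult_moebius_map) (use c a x in auto)
    then have "((\<lambda>\<zeta>. moebius_map c a \<zeta> * hinner H (cauchy_mult \<zeta> x) y) has_contour_integral
      2 * of_real pi * \<i> * hinner H (mult (moebius_map c a) x) y) (circlepath 0 r)"
      by (rule cauchy_integral[OF r hol x _ y]) (simp add: wcomp_def)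
    then show ?thesis
    proof (rule has_contour_integral_eq)
      fix \<zeta> assume "\<zeta> \<in> path_image (circlepath 0 r)"
      then have "1 < cmod \<zeta>" using r by simp
      then show "moebius_map c a \<zeta> * hinner H (cauchy_mult \<zeta> x) y = moebius_map c a \<zeta> * hinner H (resolvent H mult_z \<zeta> x) y"
        by (simp only: resolvent_mult_z[OF _ x])
    qed
  qed
  moreover have "bounded_op H H (mult (moebius_map c a))"
    by (rule bounded_op_mult_moebius_map) (use c a in auto)
  moreover have "\<forall>z\<in>ball 0 1. moebius_map c a z = \<phi> z"
    using \<phi> by simp
  ultimately show ?thesis
    unfolding hol_calculus_def using r hol by blast
qed

lemma moebius_bounded_mult_z: "moebius_bounded H mult_z"
  unfolding moebius_bounded_def
proof (intro conjI exI[of _ mult_bound] ballI)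
  fix \<phi> assume "\<phi> \<in> moeb"
  then obtain c a where ca: "cmod c = 1" "cmod a < 1" and \<phi>: "\<And>z. cmod z < 1 \<Longrightarrow> \<phi> z = moebius_map c a z"
    by (rule moeb_cases) blast
  have "op_norm H (mult (moebius_map c a)) \<le> mult_bound"
    unfolding op_norm_def
  proof (rule cSup_least)
    have "hnorm H (mult (moebius_map c a) 0) \<in> {hnorm H (mult (moebius_map c a) x) |x. x \<in> hcarrier H \<and> hnorm H x \<le> 1}"
      using carrier_zero hnorm_zero by auto
    then show "{hnorm H (mult (moebius_map c a) x) |x. x \<in> hcarrier H \<and> hnorm H x \<le> 1} \<noteq> {}"
      by blast
    fix t assume "t \<in> {hnorm H (mult (moebius_map c a) x) |x. x \<in> hcarrier H \<and> hnorm H x \<le> 1}"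
    then obtain x where x: "x \<in> hcarrier H" "hnorm H x \<le> 1" and t: "t = hnorm H (mult (moebius_map c a) x)"
      by blast
    have "t \<le> mult_bound * hnorm H x"
      unfolding t by (rule mult_moebius_map) (use ca x in auto)
    also have "\<dots> \<le> mult_bound * 1"
      by (rule mult_left_mono[OF x(2) mult_bound_ge_0])
    finally show "t \<le> mult_bound" by simp
  qed
  then show "\<exists>A. hol_calculus H mult_z \<phi> A \<and> op_norm H A \<le> mult_bound"
    using hol_calculus_mult_z[OF ca \<phi>] by blast
qed (rule disc_operator_mult_z)

text \<open>
  \<open>L f = \<psi> * (f \<circ> \<phi>)\<close> with the weight \<open>\<psi>\<close> for which the power kernel is invariant.  It satisfies
  \<open>L M\<^sub>z = M\<^sub>\<phi> L\<close>, and its inverse has the same form for \<open>\<phi>\<^sup>-\<^sup>1\<close>.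
\<close>

lemma weakly_homogeneous_mult_z: "weakly_homogeneous H mult_z"
  unfolding weakly_homogeneous_def
proof (intro conjI ballI)
  fix \<phi> assume "\<phi> \<in> moeb"
  then obtain c a where c: "cmod c = 1" and a: "cmod a < 1" and \<phi>: "\<And>z. cmod z < 1 \<Longrightarrow> \<phi> z = moebius_map c a z"
    by (rule moeb_cases) blast
  define f where "f = moebius_map c a"
  define g where "g = moebius_map (cnj c) (- (c * a))"
  have ca: "cmod (cnj c) = 1" "cmod (- (c * a)) < 1"
    using c a by (auto simp: norm_mult)
  have fb: "f z \<in> ball 0 1" and gb: "g z \<in> ball 0 1" if "z \<in> ball 0 1" for z
    using norm_moebius_map[OF c a] norm_moebius_map[OF ca] that unfolding f_def g_def by simp_all
  have "cnj c * c = 1"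
    using c by (simp add: complex_norm_square[symmetric] mult.commute)
  then have "- (cnj c * - (c * a)) = a"
    by (simp add: mult.assoc[symmetric])
  then have fg: "f (g z) = z" if "z \<in> ball 0 1" for z
    using moebius_map_inverse[OF ca, of z, unfolded \<open>- (cnj c * - (c * a)) = a\<close> complex_cnj_cnj] that
    unfolding f_def g_def by simp
  have gf: "g (f z) = z" if "z \<in> ball 0 1" for z
    using moebius_map_inverse[OF c a] that unfolding f_def g_def by simp
  define \<psi> where "\<psi> = moebius_weight l a"
  define \<psi>' where "\<psi>' z = 1 / \<psi> (g z)" for z
  have \<psi>0: "\<psi> z \<noteq> 0" for z
    unfolding \<psi>_def moebius_weight_def by simp
  have inv: "\<psi> z * power_kernel l (f z) (f w) * cnj (\<psi> w) = power_kernel l z w"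
    if "z \<in> ball 0 1" "w \<in> ball 0 1" for z w
    unfolding \<psi>_def f_def by (rule power_kernel_invariant[OF c a]) (use that in auto)
  have inv': "\<psi>' z * power_kernel l (g z) (g w) * cnj (\<psi>' w) = power_kernel l z w"
    if "z \<in> ball 0 1" "w \<in> ball 0 1" for z w
    unfolding inv[OF gb[OF that(1)] gb[OF that(2)], symmetric] \<psi>'_def fg[OF that(1)] fg[OF that(2)]
    using \<psi>0 by simp
  have L: "bounded_op H H (wcomp \<psi> f)"
  proof -
    obtain C where "C \<ge> 0" "psd (\<lambda>z w. complex_of_real (C\<^sup>2) * (dirichlet_kernel z w * power_kernel l z w)
      - \<psi> z * (dirichlet_kernel (f z) (f w) * power_kernel l (f z) (f w)) * cnj (\<psi> w))"
      using psd_weighted_composition[OF l_pos c a inv[unfolded f_def], folded f_def] by blast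
    then show ?thesis using bounded_op_wcomp[where \<phi> = f and \<psi> = \<psi>, OF fb] by blast
  qed
  have M: "bounded_op H H (wcomp \<psi>' g)"
  proof -
    obtain C where "C \<ge> 0" "psd (\<lambda>z w. complex_of_real (C\<^sup>2) * (dirichlet_kernel z w * power_kernel l z w)
      - \<psi>' z * (dirichlet_kernel (g z) (g w) * power_kernel l (g z) (g w)) * cnj (\<psi>' w))"
      using psd_weighted_composition[OF l_pos ca inv'[unfolded g_def], folded g_def] by blast
    then show ?thesis using bounded_op_wcomp[where \<phi> = g and \<psi> = \<psi>', OF gb] by blast
  qed
  have MoL: "wcomp \<psi>' g (wcomp \<psi> f x) = x" and LoM: "wcomp \<psi> f (wcomp \<psi>' g x) = x"
    and inter: "mult (moebius_map c a) x = wcomp \<psi> f (mult_z (wcomp \<psi>' g x))" if x: "x \<in> hcarrier H" for x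
  proof -
    show "wcomp \<psi>' g (wcomp \<psi> f x) = x"
    proof
      fix z show "wcomp \<psi>' g (wcomp \<psi> f x) z = x z"
        using gb[of z] fg[of z] \<psi>0[of "g z"] carrier_outside[OF x, of z]
        unfolding wcomp_def \<psi>'_def by (cases "z \<in> ball 0 1") simp_all
    qed
    show "wcomp \<psi> f (wcomp \<psi>' g x) = x"
    proof
      fix z show "wcomp \<psi> f (wcomp \<psi>' g x) z = x z"
        using fb[of z] gf[of z] \<psi>0[of z] carrier_outside[OF x, of z]
        unfolding wcomp_def \<psi>'_def by (cases "z \<in> ball 0 1") simp_all
    qed
    show "mult (moebius_map c a) x = wcomp \<psi> f (mult_z (wcomp \<psi>' g x))"
    proof
      fix z show "mult (moebius_map c a) x z = wcomp \<psi> f (mult_z (wcomp \<psi>' g x)) z"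
        using fb[of z] gf[of z] \<psi>0[of z]
        unfolding wcomp_def \<psi>'_def mult_z_def f_def[symmetric] by (cases "z \<in> ball 0 1") simp_all
    qed
  qed
  have "similar_op H mult_z H (mult (moebius_map c a))"
    unfolding similar_op_def using L M MoL LoM inter by blast
  then show "\<exists>A. hol_calculus H mult_z \<phi> A \<and> similar_op H mult_z H A"
    using hol_calculus_mult_z[OF c a \<phi>] by blast
qed (rule disc_operator_mult_z)

end

section \<open>Growth of quasi-invariant kernels\<close>

lemma norm_at_centre_le:
  assumes k: "k holomorphic_on ball 0 1" and r: "0 < r" "r < 1"
    and M: "\<And>z. cmod z = r \<Longrightarrow> cmod (k z) \<le> M"
  shows "cmod (k 0) \<le> M"
proof (rule maximum_modulus_frontier[where S = "cball 0 r" and f = k and \<xi> = 0 and B = M])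
  show "k holomorphic_on interior (cball 0 r)"
    using k r by (auto intro: holomorphic_on_subset)
  have "k holomorphic_on cball 0 r"
    using k r by (auto intro: holomorphic_on_subset)
  then show "continuous_on (closure (cball 0 r)) k"
    by (simp add: holomorphic_on_imp_continuous_on)
qed (use r M in \<open>auto simp: frontier_cball\<close>)

lemma norm_at_centre_ge:
  assumes k: "k holomorphic_on ball 0 1" and nz: "\<And>z. z \<in> ball 0 1 \<Longrightarrow> k z \<noteq> 0" and r: "0 < r" "r < 1"
    and m: "0 < m" "\<And>z. cmod z = r \<Longrightarrow> m \<le> cmod (k z)"
  shows "m \<le> cmod (k 0)"
proof -
  have "cmod (1 / k 0) \<le> 1 / m"
  proof (rule norm_at_centre_le[where r = r])
    show "(\<lambda>z. 1 / k z) holomorphic_on ball 0 1"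
      using k nz by (intro holomorphic_intros) auto
    show "cmod (1 / k z) \<le> 1 / m" if "cmod z = r" for z
      using m(1) m(2)[OF that] by (simp add: norm_divide frac_le)
  qed (use r in auto)
  moreover have "cmod (k 0) > 0" using nz[of 0] by simp
  ultimately show ?thesis
    using m(1) by (simp add: norm_divide field_simps)
qed

text \<open>
  \<open>(1 - ln x) * x\<^sup>-\<^sup>l\<close>, the order of growth of the diagonal \<open>K w w\<close> in terms of \<open>x = 1 - \<bar>w\<bar>\<^sup>2\<close>.
\<close>

definition growth :: "real \<Rightarrow> real \<Rightarrow> real" where
  "growth l x = (1 - ln x) * exp (- l * ln x)"

lemma growth_pos: "0 < x \<Longrightarrow> x \<le> 1 \<Longrightarrow> 0 < growth l x"
proof -
  assume "0 < x" "x \<le> 1"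
  then have "ln x \<le> 0" by simp
  then show ?thesis unfolding growth_def by simp
qed

text \<open>
  Quasi-invariance makes \<open>p z w = \<bar>k z w\<bar>\<^sup>2 / (k z z * k w w)\<close> invariant under automorphisms.
  The function \<open>p z 0\<close> is radial, and applying the maximum principle to \<open>k z 0\<close> shows that it is
  comparable with \<open>1 / growth l (1 - \<bar>z\<bar>\<^sup>2)\<close>.  For \<open>w = r\<close> the zero free function
  \<open>k z w * (1 - z * cnj w) powr l / k z 0\<close> is then known up to constants on the circle of radius
  \<open>r\<close> and at its centre.  The minimum principle yields \<open>u\<^sup>2 \<le> const * u\<close> for \<open>u = 1 - ln (1 - r\<^sup>2)\<close>:
  the power part of the growth cancels and the logarithm does not.
\<close>

lemma no_quasi_invariant_kernel:
  fixes k :: "complex \<Rightarrow> complex \<Rightarrow> complex"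
  assumes hol: "\<And>w. w \<in> ball 0 1 \<Longrightarrow> (\<lambda>z. k z w) holomorphic_on ball 0 1"
    and herm: "\<And>z w. z \<in> ball 0 1 \<Longrightarrow> w \<in> ball 0 1 \<Longrightarrow> k z w = cnj (k w z)"
    and inv: "\<And>c a. cmod c = 1 \<Longrightarrow> cmod a < 1 \<Longrightarrow> \<exists>g. \<forall>z\<in>ball 0 1. \<forall>w\<in>ball 0 1.
      k z w = g z * k (moebius_map c a z) (moebius_map c a w) * cnj (g w)"
    and c1: "0 < c1" and lower: "\<And>w. w \<in> ball 0 1 \<Longrightarrow> c1 * growth l (1 - (cmod w)\<^sup>2) \<le> Re (k w w)"
    and upper: "\<And>w. w \<in> ball 0 1 \<Longrightarrow> Re (k w w) \<le> c2 * growth l (1 - (cmod w)\<^sup>2)"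
  shows False
proof -
  define d where "d z = Re (k z z)" for z
  define n where "n z = growth l (1 - (cmod z)\<^sup>2)" for z
  have n: "n z > 0" if "z \<in> ball 0 1" for z
    unfolding n_def using that by (intro growth_pos) (auto simp: abs_square_less_1)
  have low: "c1 * n z \<le> d z" and up: "d z \<le> c2 * n z" if "z \<in> ball 0 1" for z
    using lower upper that unfolding d_def n_def by auto
  have d: "d z > 0" if "z \<in> ball 0 1" for z
    using low[OF that] n[OF that] c1 by (meson less_le_trans mult_pos_pos)
  have kd: "k z z = of_real (d z)" if "z \<in> ball 0 1" for z
    using herm[OF that that] unfolding d_def by (simp add: complex_eq_iff)
  have n0: "n 0 = 1" unfolding n_def growth_def by simp
  have zb: "0 \<in> ball (0 :: complex) 1" by simp
  define d0 where "d0 = d 0"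
  have d0: "d0 > 0" unfolding d0_def using d[OF zb] .
  have c2: "c2 > 0" using up[OF zb] d0 n0 unfolding d0_def by simp
  define p where "p z w = (cmod (k z w))\<^sup>2 / (d z * d w)" for z w
  have p_inv: "p (moebius_map c a z) (moebius_map c a w) = p z w"
    if c: "cmod c = 1" and a: "cmod a < 1" and z: "z \<in> ball 0 1" and w: "w \<in> ball 0 1" for c a z w
  proof -
    let ?m = "moebius_map c a"
    have mz: "?m z \<in> ball 0 1" "?m w \<in> ball 0 1"
      using norm_moebius_map[OF c a] z w by auto
    obtain g where g: "\<And>z w. z \<in> ball 0 1 \<Longrightarrow> w \<in> ball 0 1 \<Longrightarrow> k z w = g z * k (?m z) (?m w) * cnj (g w)"
      using inv[OF c a] by blast
    have dg: "d z = (cmod (g z))\<^sup>2 * d (?m z)" if z: "z \<in> ball 0 1" for z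
    proof -
      have m: "?m z \<in> ball 0 1" using norm_moebius_map[OF c a] z by simp
      have "of_real (d z) = complex_of_real ((cmod (g z))\<^sup>2 * d (?m z))"
        using g[OF z z] unfolding kd[OF z] kd[OF m] of_real_mult complex_norm_square by (simp only: mult_ac)
      then show ?thesis by (simp only: of_real_eq_iff)
    qed
    have gz: "cmod (g z) \<noteq> 0" "cmod (g w) \<noteq> 0"
      using dg[OF z] dg[OF w] d[OF z] d[OF w] by auto
    have "p z w = ((cmod (g z))\<^sup>2 * (cmod (g w))\<^sup>2 * (cmod (k (?m z) (?m w)))\<^sup>2)
        / ((cmod (g z))\<^sup>2 * (cmod (g w))\<^sup>2 * (d (?m z) * d (?m w)))"
      unfolding p_def g[OF z w] dg[OF z] dg[OF w] norm_mult complex_mod_cnj power_mult_distrib by (simp only: mult_ac)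
    also have "\<dots> = p (?m z) (?m w)"
      unfolding p_def using gz by simp
    finally show ?thesis ..
  qed
  define P where "P r = p (of_real r) 0" for r
  have radial: "p z 0 = P (cmod z)" if z: "z \<in> ball 0 1" for z
  proof (cases "z = 0")
    case False
    have "p (moebius_map (z / of_real (cmod z)) 0 (of_real (cmod z))) (moebius_map (z / of_real (cmod z)) 0 0)
        = p (of_real (cmod z)) 0"
      by (rule p_inv) (use z False in \<open>auto simp: norm_divide\<close>)
    then show ?thesis
      unfolding P_def moebius_map_def using False by simp
  qed (simp add: P_def)
  have k0: "(cmod (k z 0))\<^sup>2 = P (cmod z) * (d z * d0)" if z: "z \<in> ball 0 1" for z
    using d[OF z] d0 unfolding radial[OF z, symmetric] p_def d0_def by simp
  have k00: "cmod (k 0 0) = d0"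
    unfolding kd[OF zb] d0_def using d[OF zb] by simp
  have P_nonneg: "P r \<ge> 0" if "0 \<le> r" "r < 1" for r
    unfolding P_def p_def using d[of "of_real r"] d[OF zb] that by simp
  \<comment> \<open>On the circle through \<open>z\<close> both \<open>p v 0\<close> and \<open>n v\<close> are constant, which bounds \<open>\<bar>k v 0\<bar>\<close>
    there; at the centre its value is \<open>d0\<close>.\<close>
  have P_ge: "d0 \<le> P (cmod z) * c2 * n z" if z: "z \<in> ball 0 1" for z
  proof (cases "z = 0")
    case True
    have "P 0 = 1"
      using k0[OF zb] k00 d0 unfolding d0_def by (simp add: power2_eq_square)
    then show ?thesis
      using True up[OF zb] n0 unfolding d0_def by simp
  next
    case False
    have r: "0 < cmod z" "cmod z < 1" using False z by auto
    have "cmod (k 0 0) \<le> sqrt (P (cmod z) * c2 * n z * d0)"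
    proof (rule norm_at_centre_le[OF hol[OF zb] r])
      fix v assume v: "cmod v = cmod z"
      then have vb: "v \<in> ball 0 1" and nv: "n v = n z" using z unfolding n_def by auto
      have "(cmod (k v 0))\<^sup>2 \<le> P (cmod z) * (c2 * n z * d0)"
        unfolding k0[OF vb] v
        using up[OF vb] P_nonneg[of "cmod z"] d0 r unfolding nv by (intro mult_left_mono mult_right_mono) auto
      then show "cmod (k v 0) \<le> sqrt (P (cmod z) * c2 * n z * d0)"
        by (intro real_le_rsqrt) (simp only: mult.assoc)
    qed
    then have "d0\<^sup>2 \<le> P (cmod z) * c2 * n z * d0"
      unfolding k00 using d0 by (simp add: real_le_rsqrt sqrt_ge_absD)
    then show ?thesis using d0 by (simp add: power2_eq_square)
  qed
  have P_pos: "P (cmod z) > 0" if z: "z \<in> ball 0 1" for z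
  proof -
    have "0 < P (cmod z) * (c2 * n z)" using P_ge[OF z] d0 by (simp add: mult.assoc)
    then show ?thesis using mult_pos_pos[OF c2 n[OF z]] by (simp only: zero_less_mult_pos2)
  qed
  have k_nz: "k z 0 \<noteq> 0" if z: "z \<in> ball 0 1" for z
    using k0[OF z] P_pos[OF z] d[OF z] d0 by auto
  have P_le: "P r * c1 * n (of_real r) \<le> d0" if r: "0 < r" "r < 1" for r
  proof -
    have rb: "of_real r \<in> ball (0 :: complex) 1" using r by simp
    have Pr: "P r > 0" using P_pos[OF rb] r by simp
    have "sqrt (P r * c1 * n (of_real r) * d0) \<le> cmod (k 0 0)"
    proof (rule norm_at_centre_ge[OF hol[OF zb] k_nz r])
      show "0 < sqrt (P r * c1 * n (of_real r) * d0)"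
        using Pr c1 n[OF rb] d0 by simp
      fix v assume v: "cmod v = r"
      then have vb: "v \<in> ball 0 1" and nv: "n v = n (of_real r)" using r unfolding n_def by auto
      have "P r * (c1 * n (of_real r) * d0) \<le> (cmod (k v 0))\<^sup>2"
        unfolding k0[OF vb] v
        using low[OF vb] Pr d0 unfolding nv by (intro mult_left_mono mult_right_mono) auto
      then show "sqrt (P r * c1 * n (of_real r) * d0) \<le> cmod (k v 0)"
        by (intro real_le_lsqrt) (simp_all only: mult.assoc norm_ge_zero)
    qed
    then have "P r * c1 * n (of_real r) * d0 \<le> d0\<^sup>2"
      unfolding k00 using d0 by (simp add: sqrt_le_D)
    then show ?thesis using d0 by (simp add: power2_eq_square)
  qed
  have key: "c1\<^sup>2 * (1 - ln s) \<le> 4 * c2 * d0" if s: "0 < s" "s < 1" for s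
  proof -
    define r where "r = sqrt (1 - s)"
    define w where "w = complex_of_real r"
    define u where "u = 1 - ln s"
    define e where "e = exp (- l * ln s)"
    have r: "0 < r" "r < 1" "r\<^sup>2 = 1 - s" using s unfolding r_def by auto
    have wb: "w \<in> ball 0 1" and w1: "cmod w < 1" and cw: "cmod w = r" "cnj w = w"
      using r unfolding w_def by auto
    have u: "u \<ge> 1" unfolding u_def using s by simp
    have e: "e > 0" unfolding e_def by simp
    have nw: "n w = u * e"
      unfolding n_def growth_def cw r(3) u_def e_def by simp
    define \<phi> where "\<phi> = moebius_map 1 w"
    \<comment> \<open>The numerator removes the factor \<open>\<bar>1 - w z\<bar>\<close> that the growth at \<open>\<phi> z\<close> contributes, see \<open>n\<phi>\<close>.\<close>
    define Q where "Q z = k z w * exp (of_real l * Ln (1 - w * z)) / k z 0" for z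
    have pb: "p z w = P (cmod (\<phi> z))" and pz: "\<phi> z \<in> ball 0 1" if z: "z \<in> ball 0 1" for z
    proof -
      show "\<phi> z \<in> ball 0 1" unfolding \<phi>_def using norm_moebius_map[of 1 w z] w1 z by simp
      then show "p z w = P (cmod (\<phi> z))"
        using p_inv[of 1 w z w] radial[of "\<phi> z"] w1 z wb unfolding \<phi>_def by (simp add: moebius_map_def[of 1 w w])
    qed
    have re: "Re (1 - w * z) > 0" if z: "z \<in> ball 0 1" for z
      using norm_cnj_mult_less_1[OF w1, of z] complex_Re_le_cmod[of "w * z"] z cw(2) by simp
    have branch: "1 - w * z \<notin> \<real>\<^sub>\<le>\<^sub>0" if z: "z \<in> ball 0 1" for z
      using re[OF z] unfolding complex_nonpos_Reals_iff by linarith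
    have Q_hol: "Q holomorphic_on ball 0 1"
      unfolding Q_def using hol[OF wb] hol[OF zb] k_nz branch
      by (intro holomorphic_intros) blast+
    have kw_sq: "(cmod (k z w))\<^sup>2 = P (cmod (\<phi> z)) * (d z * d w)" if z: "z \<in> ball 0 1" for z
      using d[OF z] d[OF wb] unfolding pb[OF z, symmetric] p_def by simp
    have kw_nz: "k z w \<noteq> 0" if z: "z \<in> ball 0 1" for z
      using kw_sq[OF z] P_pos[OF pz[OF z]] d[OF z] d[OF wb] by auto
    have Q_nz: "Q z \<noteq> 0" if z: "z \<in> ball 0 1" for z
      unfolding Q_def using k_nz[OF z] kw_nz[OF z] by simp
    have Pr: "P r > 0" using P_pos[OF wb] unfolding cw .
    \<comment> \<open>A lower bound for \<open>\<bar>Q\<bar>\<^sup>2\<close> on the circle of radius \<open>r\<close>.\<close>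
    define m where "m = d w / (P r * e\<^sup>2 * (c2 * (4 * u)))"
    have dw: "d w > 0" using d[OF wb] .
    have m: "m > 0" unfolding m_def using dw Pr e c2 u by simp
    have "sqrt m \<le> cmod (Q 0)"
    proof (rule norm_at_centre_ge[OF Q_hol Q_nz r(1,2)])
      show "0 < sqrt m" using m by simp
      fix z assume z: "cmod z = r"
      then have zb': "z \<in> ball 0 1" and z1: "cmod z < 1" using r by auto
      define E where "E = cmod (1 - w * z)"
      have E: "0 < E" "E \<le> 2"
      proof -
        show "0 < E" unfolding E_def using one_minus_cnj_mult_ne_0[OF w1 z1] cw(2) by simp
        have "E \<le> cmod 1 + cmod (w * z)" unfolding E_def by (rule norm_triangle_ineq4)
        also have "cmod (w * z) \<le> 1" using norm_cnj_mult_less_1[OF w1 z1] cw(2) by simp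
        finally show "E \<le> 2" by simp
      qed
      have "1 - (cmod (\<phi> z))\<^sup>2 = (s / E)\<^sup>2"
        unfolding \<phi>_def E_def using one_minus_norm_moebius_map[of 1 w z] w1 z1 r(3)
        by (simp add: z cw power2_eq_square)
      then have lnX: "ln (1 - (cmod (\<phi> z))\<^sup>2) = 2 * ln s - 2 * ln E"
        using s E by (simp add: ln_realpow ln_div)
      have "ln E \<le> 1"
        using ln_le_minus_one[OF E(1)] E(2) by simp
      then have X: "1 - (2 * ln s - 2 * ln E) \<le> 4 * u"
        using u unfolding u_def by simp
      have "n (\<phi> z) = (1 - (2 * ln s - 2 * ln E)) * (e\<^sup>2 * exp (2 * l * ln E))"
      proof -
        have "exp (- l * (2 * ln s - 2 * ln E)) = e\<^sup>2 * exp (2 * l * ln E)"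
          unfolding e_def power2_eq_square mult_exp_exp by (rule arg_cong[where f = exp]) (simp add: algebra_simps)
        then show ?thesis unfolding n_def growth_def lnX by simp
      qed
      also have "\<dots> \<le> 4 * u * (e\<^sup>2 * exp (2 * l * ln E))"
        using X by (intro mult_right_mono) simp_all
      finally have n\<phi>: "n (\<phi> z) \<le> 4 * u * (e\<^sup>2 * exp (2 * l * ln E))" .
      have "d0 \<le> P (cmod (\<phi> z)) * c2 * n (\<phi> z)" by (rule P_ge[OF pz[OF zb']])
      also have "\<dots> \<le> P (cmod (\<phi> z)) * c2 * (4 * u * (e\<^sup>2 * exp (2 * l * ln E)))"
        using n\<phi> P_pos[OF pz[OF zb']] c2 by (intro mult_left_mono) auto
      finally have d0_le: "d0 \<le> P (cmod (\<phi> z)) * exp (2 * l * ln E) * (e\<^sup>2 * (c2 * (4 * u)))"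
        by (simp only: mult_ac)
      have "(cmod (exp (of_real l * Ln (1 - w * z))))\<^sup>2 = exp (2 * l * ln E)"
      proof -
        have "Re (Ln (1 - w * z)) = ln E"
          unfolding E_def using E E_def by (intro Re_Ln) auto
        then show ?thesis
          by (simp add: norm_exp_eq_Re power2_eq_square mult_exp_exp)
      qed
      then have "(cmod (Q z))\<^sup>2 = P (cmod (\<phi> z)) * (d z * d w) * exp (2 * l * ln E) / (P r * (d z * d0))"
        unfolding Q_def norm_divide norm_mult power_divide power_mult_distrib kw_sq[OF zb'] k0[OF zb'] z by simp
      also have "\<dots> = P (cmod (\<phi> z)) * exp (2 * l * ln E) * (d w / (P r * d0))"
        using d[OF zb'] by (simp add: field_simps)
      finally have Qz: "(cmod (Q z))\<^sup>2 = P (cmod (\<phi> z)) * exp (2 * l * ln E) * (d w / (P r * d0))" .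
      have "m = d0 / (e\<^sup>2 * (c2 * (4 * u))) * (d w / (P r * d0))"
        unfolding m_def using d0 by (simp add: field_simps)
      also have "\<dots> \<le> (cmod (Q z))\<^sup>2"
        unfolding Qz using d0_le e c2 u dw Pr d0
        by (intro mult_right_mono) (auto simp: pos_divide_le_eq)
      finally show "sqrt m \<le> cmod (Q z)"
        by (intro real_le_lsqrt) auto
    qed
    moreover have "(cmod (Q 0))\<^sup>2 = P r * d w / d0"
    proof -
      have "cmod (k 0 w) = cmod (k w 0)"
        using herm[OF zb wb] by simp
      then have "(cmod (k 0 w))\<^sup>2 = P r * (d w * d0)"
        using k0[OF wb] cw by simp
      then show ?thesis
        unfolding Q_def norm_divide norm_mult power_divide power_mult_distrib k00
        using d0 by (simp add: power2_eq_square)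
    qed
    ultimately have "m \<le> P r * d w / d0"
      using sqrt_le_D by metis
    then have "d0 \<le> (P r)\<^sup>2 * e\<^sup>2 * (c2 * (4 * u))"
      unfolding m_def using dw Pr e c2 u d0 by (simp add: field_simps power2_eq_square)
    moreover have "(P r * c1 * (u * e))\<^sup>2 \<le> d0\<^sup>2"
      using P_le[OF r(1,2)] nw Pr c1 u e unfolding w_def[symmetric] by (intro power_mono) auto
    ultimately have "c1\<^sup>2 * u\<^sup>2 * d0 \<le> d0\<^sup>2 * (c2 * (4 * u))"
    proof -
      assume A: "d0 \<le> (P r)\<^sup>2 * e\<^sup>2 * (c2 * (4 * u))" and B: "(P r * c1 * (u * e))\<^sup>2 \<le> d0\<^sup>2"
      have "c1\<^sup>2 * u\<^sup>2 * d0 \<le> c1\<^sup>2 * u\<^sup>2 * ((P r)\<^sup>2 * e\<^sup>2 * (c2 * (4 * u)))"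
        using A by (intro mult_left_mono) auto
      also have "\<dots> = (P r * c1 * (u * e))\<^sup>2 * (c2 * (4 * u))"
        by (simp only: power_mult_distrib mult_ac)
      also have "\<dots> \<le> d0\<^sup>2 * (c2 * (4 * u))"
        using B c2 u by (intro mult_right_mono) auto
      finally show ?thesis .
    qed
    then have "(c1\<^sup>2 * u) * (u * d0) \<le> (4 * c2 * d0) * (u * d0)"
      by (simp add: power2_eq_square mult_ac)
    then show ?thesis
      using u d0 unfolding u_def by (simp only: mult_le_cancel_right) (auto simp: mult_less_0_iff)
  qed
  \<comment> \<open>\<open>key\<close> bounds \<open>1 - ln s\<close> for all \<open>s\<close> in \<open>(0, 1)\<close>, which fails for \<open>s = exp (- v)\<close>.\<close>
  define v where "v = 4 * c2 * d0 / c1\<^sup>2"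
  have "v > 0" unfolding v_def using c1 c2 d0 by simp
  then have "c1\<^sup>2 * (1 + v) \<le> 4 * c2 * d0"
    using key[of "exp (- v)"] by simp
  moreover have "c1\<^sup>2 * v = 4 * c2 * d0"
    unfolding v_def using c1 by simp
  ultimately have "c1\<^sup>2 \<le> 0"
    by (simp add: distrib_left)
  then show False using c1 by simp
qed

section \<open>No similarity to a homogeneous operator\<close>

context dirichlet_power_space
begin

text \<open>
  On the diagonal \<open>log_kernel w w = - ln (1 - \<bar>w\<bar>\<^sup>2)\<close>, and the Dirichlet kernel lies between
  half of \<open>1 + log_kernel\<close> and all of it.
\<close>

lemma kernel_growth:
  assumes w: "w \<in> ball 0 1"
  shows "growth l (1 - (cmod w)\<^sup>2) / 2 \<le> (hnorm H (kfun w))\<^sup>2"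
    "(hnorm H (kfun w))\<^sup>2 \<le> growth l (1 - (cmod w)\<^sup>2)"
proof -
  define x where "x = 1 - (cmod w)\<^sup>2"
  have x: "0 < x" using w unfolding x_def by (simp add: abs_square_less_1)
  have ww: "1 - w * cnj w = of_real x"
    unfolding x_def by (simp only: of_real_diff of_real_1 complex_norm_square)
  have P: "power_kernel l w w = of_real (exp (- l * ln x))"
    unfolding power_kernel_def ww powr_def using x by (simp add: Ln_of_real flip: exp_of_real)
  have L: "Re (log_kernel w w) = - ln x"
    unfolding log_kernel_def ww using x by (simp add: Ln_of_real)
  have diag: "0 \<le> Re (F w w)" if "psd F" for F
    using that[unfolded psd_def, rule_format, of "[(1, w)]"] w by (simp add: kernel_form_def)
  have D: "Re (dirichlet_kernel w w) \<le> 1 - ln x" "1 - ln x \<le> 2 * Re (dirichlet_kernel w w)"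
    using diag[OF psd_log_minus_dirichlet] diag[OF psd_dirichlet_minus_log] L by simp_all
  have "(hnorm H (kfun w))\<^sup>2 = Re (dirichlet_kernel w w) * exp (- l * ln x)"
    unfolding hnorm_kfun[OF w] P by simp
  then show "growth l (1 - (cmod w)\<^sup>2) / 2 \<le> (hnorm H (kfun w))\<^sup>2"
    "(hnorm H (kfun w))\<^sup>2 \<le> growth l (1 - (cmod w)\<^sup>2)"
    unfolding growth_def x_def[symmetric] using D by simp_all
qed

definition one :: "complex \<Rightarrow> complex" where
  "one = (\<lambda>z. if z \<in> ball 0 1 then 1 else 0)"

lemma one_carrier: "one \<in> hcarrier H"
proof (rule membership_psd)
  show "psd (\<lambda>z w. dirichlet_kernel z w * power_kernel l z w - one z * cnj (one w))"
    by (rule psd_cong[OF psd_kernel_minus_one[OF l_pos]]) (simp add: one_def)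
qed (simp add: one_def)

lemma kernel_holomorphic:
  assumes w: "cmod w * \<rho> \<le> 1"
  shows "(\<lambda>z. dirichlet_kernel z w * power_kernel l z w) holomorphic_on ball 0 \<rho>"
proof -
  have "(\<lambda>x. \<Sum>n. 1 / of_nat (n + 1) * x ^ n) holomorphic_on ball 0 1"
    by (rule power_series_holomorphic[where a = "\<lambda>n. complex_of_real (1 / of_nat (n + 1))"])
      (use one_over_Suc_sums in simp)
  moreover have "(\<lambda>x. (1 - x) powr (- complex_of_real l)) holomorphic_on ball 0 1"
    by (rule power_series_holomorphic[where a = "\<lambda>n. complex_of_real (binom_coeff l n)"])
      (use binom_coeff_sums in simp)
  ultimately have "(\<lambda>x. (\<Sum>n. 1 / of_nat (n + 1) * x ^ n) * (1 - x) powr (- complex_of_real l)) holomorphic_on ball 0 1"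
    by (rule holomorphic_on_mult)
  moreover have "(\<lambda>z. z * cnj w) holomorphic_on ball 0 \<rho>"
    by (intro holomorphic_intros)
  moreover have "(\<lambda>z. z * cnj w) ` ball 0 \<rho> \<subseteq> ball 0 1"
  proof (cases "w = 0")
    case False
    have "cmod z * cmod w < 1" if "cmod z < \<rho>" for z
    proof -
      have "cmod z * cmod w < \<rho> * cmod w" using that False by simp
      then show ?thesis using w by (simp add: mult.commute)
    qed
    then show ?thesis by (auto simp: norm_mult)
  qed auto
  ultimately show ?thesis
    using holomorphic_on_compose_gen[of "\<lambda>z. z * cnj w" "ball 0 \<rho>"
        "\<lambda>x. (\<Sum>n. 1 / of_nat (n + 1) * x ^ n) * (1 - x) powr (- complex_of_real l)" "ball 0 1"]
    unfolding dirichlet_kernel_def power_kernel_def comp_def by simp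
qed

text \<open>
  The eigenspaces of the adjoint of \<open>M\<^sub>z\<close> are spanned by kernel functions.  The resolvent identity
  gives \<open>\<langle>(\<zeta> - z)\<^sup>-\<^sup>1, v\<rangle> = \<langle>1, v\<rangle> / (\<zeta> - b)\<close>, and \<open>K\<^sub>w = K\<^sub>w(M\<^sub>z) 1\<close> because \<open>K\<^sub>w\<close> extends past the
  closed disc, so the calculus determines \<open>\<langle>K\<^sub>w, v\<rangle>\<close>.
\<close>

lemma adjoint_eigenvector:
  assumes v: "v \<in> hcarrier H" and b: "b \<in> ball 0 1"
    and eig: "\<And>f. f \<in> hcarrier H \<Longrightarrow> hinner H (mult_z f) v = b * hinner H f v"
    and f: "f \<in> hcarrier H"
  shows "hinner H f v = hinner H one v * f b"
proof -
  define t where "t = hinner H one v"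
  have cm: "hinner H (cauchy_mult \<zeta> one) v = t / (\<zeta> - b)" if \<zeta>: "1 < cmod \<zeta>" for \<zeta>
  proof -
    note c = cauchy_mult_carrier[OF \<zeta> one_carrier]
    have Tc: "mult_z (cauchy_mult \<zeta> one) \<in> hcarrier H"
      using bounded_op_mult_z c unfolding bounded_op_def by blast
    have "t = hinner H (hscale H \<zeta> (cauchy_mult \<zeta> one) - mult_z (cauchy_mult \<zeta> one)) v"
      unfolding cauchy_mult_inverse(1)[OF \<zeta> one_carrier] t_def ..
    also have "\<dots> = (\<zeta> - b) * hinner H (cauchy_mult \<zeta> one) v"
      unfolding inner_diff_left[OF carrier_scale[OF c] Tc v] inner_scale_left[OF c v] eig[OF c]
      by (simp only: left_diff_distrib)
    finally show ?thesis using \<zeta> b by auto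
  qed
  have "v w = cnj t * kfun b w" if w: "w \<in> ball 0 1" for w
  proof -
    define F where "F z = dirichlet_kernel z w * power_kernel l z w" for z
    define \<rho> where "\<rho> = 2 / (1 + cmod w)"
    define r where "r = (1 + \<rho>) / 2"
    have \<rho>: "1 < \<rho>" using w unfolding \<rho>_def by (simp add: field_simps add_pos_nonneg)
    have r: "1 < r" "r < \<rho>" using \<rho> unfolding r_def by auto
    have "cmod w * \<rho> \<le> 1" using w unfolding \<rho>_def by (simp add: field_simps add_pos_nonneg)
    then have hol: "F holomorphic_on ball 0 \<rho>"
      unfolding F_def by (rule kernel_holomorphic)
    have "((\<lambda>\<zeta>. F \<zeta> * hinner H (cauchy_mult \<zeta> one) v) has_contour_integral
      2 * of_real pi * \<i> * hinner H (kfun w) v) (circlepath 0 r)"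
      by (rule cauchy_integral[OF r hol one_carrier kfun_carrier[OF w] v]) (simp add: kfun_def one_def F_def)
    moreover have "((\<lambda>\<zeta>. F \<zeta> * hinner H (cauchy_mult \<zeta> one) v) has_contour_integral
      t * (2 * of_real pi * \<i> * F b)) (circlepath 0 r)"
    proof (rule has_contour_integral_eq)
      show "((\<lambda>\<zeta>. t * (F \<zeta> / (\<zeta> - b))) has_contour_integral t * (2 * of_real pi * \<i> * F b)) (circlepath 0 r)"
        by (intro has_contour_integral_lmul Cauchy_integral_circlepath_simple)
          (use hol r b in \<open>auto intro: holomorphic_on_subset\<close>)
      fix \<zeta> assume "\<zeta> \<in> path_image (circlepath 0 r)"
      then have "1 < cmod \<zeta>" using r by simp
      then show "t * (F \<zeta> / (\<zeta> - b)) = F \<zeta> * hinner H (cauchy_mult \<zeta> one) v"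
        by (simp only: cm) simp
    qed
    ultimately have "2 * of_real pi * \<i> * hinner H (kfun w) v = t * (2 * of_real pi * \<i> * F b)"
      by (rule has_contour_integral_unique)
    then have "hinner H (kfun w) v = t * kfun w b"
      using b by (simp add: F_def kfun_def)
    moreover have "hinner H v (kfun w) = cnj (hinner H (kfun w) v)"
      by (rule inner_commute[OF v kfun_carrier[OF w]])
    moreover have "kfun b w = cnj (kfun w b)"
      using inner_commute[OF kfun_carrier[OF b] kfun_carrier[OF w]]
      unfolding reproducing[OF w kfun_carrier[OF b]] reproducing[OF b kfun_carrier[OF w]] .
    ultimately show ?thesis
      unfolding reproducing[OF w v] by simp
  qed
  then have "v = hscale H (cnj t) (kfun b)"
    by (intro carrier_eqI[OF v]) (auto simp: hscale kfun_def)
  then have "hinner H f v = t * hinner H f (kfun b)"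
    using inner_scale_right[OF f kfun_carrier[OF b], of "cnj t"] by simp
  then show ?thesis
    unfolding reproducing[OF b f] t_def .
qed

text \<open>
  Transporting the inner product of \<open>G\<close> to \<open>H\<close> turns \<open>S\<close> into \<open>M\<^sub>z\<close> on a space whose kernel
  \<open>\<langle>k w, k z\<rangle>\<close> is comparable with \<open>K\<close> on the diagonal.  A unitary \<open>U\<close> intertwining \<open>S\<close> with
  \<open>\<phi>(S)\<close> pulls \<open>k w\<close> back to an eigenvector for \<open>\<phi> w\<close>, hence to a multiple of \<open>k (\<phi> w)\<close>, and so the
  kernel is quasi-invariant.
\<close>

lemma not_similar_to_homogeneous:
  fixes G :: "'b::ab_group_add hilbert"
  assumes hom: "homogeneous G S" and sim: "similar_op H mult_z G S"
  shows False
proof -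
  have hG: "hilbert_space G"
    using hom unfolding homogeneous_def disc_operator_def separable_hilbert_space_def by blast
  have hH: "hilbert_space H" by (rule hilbert_space_axioms)
  interpret G: hilbert_space G by (rule hG)
  obtain L M where L: "bounded_op H G L" and M: "bounded_op G H M"
    and MoL: "\<And>x. x \<in> hcarrier H \<Longrightarrow> M (L x) = x" and LoM: "\<And>y. y \<in> hcarrier G \<Longrightarrow> L (M y) = y"
    and S: "\<And>y. y \<in> hcarrier G \<Longrightarrow> S y = L (mult_z (M y))"
    using sim unfolding similar_op_def by blast
  have LG: "L x \<in> hcarrier G" if "x \<in> hcarrier H" for x
    using L that unfolding bounded_op_def by blast
  have MH: "M y \<in> hcarrier H" if "y \<in> hcarrier G" for y
    using M that unfolding bounded_op_def by blast
  have TH: "mult_z x \<in> hcarrier H" if "x \<in> hcarrier H" for x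
    using bounded_op_mult_z that unfolding bounded_op_def by blast
  have L_scale: "L (hscale H c x) = hscale G c (L x)" if "x \<in> hcarrier H" for c x
    using L that unfolding bounded_op_def by blast
  have M_scale: "M (hscale G c y) = hscale H c (M y)" if "y \<in> hcarrier G" for c y
    using M that unfolding bounded_op_def by blast
  obtain CL where CL: "CL > 0" "\<And>x. x \<in> hcarrier H \<Longrightarrow> hnorm G (L x) \<le> CL * hnorm H x"
    using bounded_op_bound[OF hH L] by blast
  obtain CM where CM: "CM > 0" "\<And>y. y \<in> hcarrier G \<Longrightarrow> hnorm H (M y) \<le> CM * hnorm G y"
    using bounded_op_bound[OF hG M] by blast
  \<comment> \<open>The image of \<open>K\<^sub>w\<close> under the adjoint of \<open>M\<close>.\<close>
  have "\<exists>k. k \<in> hcarrier G \<and> (\<forall>x\<in>hcarrier G. hinner G x k = M x w)" if w: "w \<in> ball 0 1" for w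
  proof -
    obtain k where "k \<in> hcarrier G" "\<And>x. x \<in> hcarrier G \<Longrightarrow> hinner G x k = M x w"
    proof (rule G.riesz_functional[where ell = "\<lambda>x. M x w" and B = "CM * hnorm H (kfun w)"])
      show "M (x + y) w = M x w + M y w" if "x \<in> hcarrier G" "y \<in> hcarrier G" for x y
        using M that unfolding bounded_op_def by simp
      show "M (hscale G c x) w = c * M x w" if "x \<in> hcarrier G" for c x
        using M_scale[OF that] by (simp add: hscale)
      show "cmod (M x w) \<le> CM * hnorm H (kfun w) * hnorm G x" if x: "x \<in> hcarrier G" for x
      proof -
        have "cmod (M x w) \<le> hnorm H (M x) * hnorm H (kfun w)"
          using cauchy_schwarz[OF MH[OF x] kfun_carrier[OF w]] unfolding reproducing[OF w MH[OF x]] .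
        also have "\<dots> \<le> (CM * hnorm G x) * hnorm H (kfun w)"
          by (rule mult_right_mono[OF CM(2)[OF x] hnorm_ge_0[OF kfun_carrier[OF w]]])
        finally show ?thesis by (simp only: mult_ac)
      qed
      show "0 \<le> CM * hnorm H (kfun w)"
        using CM(1) hnorm_ge_0[OF kfun_carrier[OF w]] by simp
    qed blast
    then show ?thesis by blast
  qed
  then obtain k where kG: "\<And>w. w \<in> ball 0 1 \<Longrightarrow> k w \<in> hcarrier G"
    and k: "\<And>w x. w \<in> ball 0 1 \<Longrightarrow> x \<in> hcarrier G \<Longrightarrow> hinner G x (k w) = M x w"
    by metis
  define \<kappa> where "\<kappa> z w = hinner G (k w) (k z)" for z w
  show False
  proof (rule no_quasi_invariant_kernel[of \<kappa> "1 / CL\<^sup>2 / 2" l "CM\<^sup>2"])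
    fix w :: complex assume w: "w \<in> ball 0 1"
    have "M (k w) holomorphic_on ball 0 1"
      by (rule carrier_holomorphic[OF MH[OF kG[OF w]]])
    then show "(\<lambda>z. \<kappa> z w) holomorphic_on ball 0 1"
      by (rule holomorphic_transform) (simp only: \<kappa>_def k[OF _ kG[OF w]])
    show "\<kappa> z w = cnj (\<kappa> w z)" if "z \<in> ball 0 1" for z
      unfolding \<kappa>_def by (rule G.inner_commute[OF kG[OF w] kG[OF that]])
    have \<kappa>w: "Re (\<kappa> w w) = (hnorm G (k w))\<^sup>2"
      unfolding \<kappa>_def G.hnorm_power2[OF kG[OF w]] ..
    have nn: "0 \<le> hnorm H (kfun w)" "0 \<le> hnorm G (k w)"
      using hnorm_ge_0[OF kfun_carrier[OF w]] G.hnorm_ge_0[OF kG[OF w]] by auto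
    have cancel: "a \<le> b" if "a * a \<le> b * a" "0 \<le> a" "0 \<le> b" for a b :: real
      using that by (cases "a = 0") (auto simp: mult_le_cancel_right)
    have "hnorm H (kfun w) \<le> CL * hnorm G (k w)"
    proof (rule cancel)
      have "of_real ((hnorm H (kfun w))\<^sup>2) = hinner G (L (kfun w)) (k w)"
        unfolding k[OF w LG[OF kfun_carrier[OF w]]] MoL[OF kfun_carrier[OF w]]
          inner_self[OF kfun_carrier[OF w], symmetric] reproducing[OF w kfun_carrier[OF w]] ..
      from arg_cong[OF this, of cmod] have "(hnorm H (kfun w))\<^sup>2 = cmod (hinner G (L (kfun w)) (k w))"
        unfolding norm_of_real abs_power2 .
      also have "\<dots> \<le> hnorm G (L (kfun w)) * hnorm G (k w)"
        by (rule G.cauchy_schwarz[OF LG[OF kfun_carrier[OF w]] kG[OF w]])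
      also have "\<dots> \<le> (CL * hnorm H (kfun w)) * hnorm G (k w)"
        by (rule mult_right_mono[OF CL(2)[OF kfun_carrier[OF w]] nn(2)])
      finally show "hnorm H (kfun w) * hnorm H (kfun w) \<le> CL * hnorm G (k w) * hnorm H (kfun w)"
        by (simp add: power2_eq_square mult_ac)
    qed (use nn CL in auto)
    then have "(hnorm H (kfun w))\<^sup>2 \<le> CL\<^sup>2 * (hnorm G (k w))\<^sup>2"
      using nn power_mono by (metis power_mult_distrib)
    then have "growth l (1 - (cmod w)\<^sup>2) / 2 \<le> CL\<^sup>2 * (hnorm G (k w))\<^sup>2"
      using kernel_growth(1)[OF w] by linarith
    then show "1 / CL\<^sup>2 / 2 * growth l (1 - (cmod w)\<^sup>2) \<le> Re (\<kappa> w w)"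
      unfolding \<kappa>w using CL(1) by (simp add: field_simps)
    have "hnorm G (k w) \<le> CM * hnorm H (kfun w)"
    proof (rule cancel)
      have "of_real ((hnorm G (k w))\<^sup>2) = hinner H (M (k w)) (kfun w)"
        unfolding reproducing[OF w MH[OF kG[OF w]]] k[OF w kG[OF w], symmetric]
          G.inner_self[OF kG[OF w], symmetric] ..
      from arg_cong[OF this, of cmod] have "(hnorm G (k w))\<^sup>2 = cmod (hinner H (M (k w)) (kfun w))"
        unfolding norm_of_real abs_power2 .
      also have "\<dots> \<le> hnorm H (M (k w)) * hnorm H (kfun w)"
        by (rule cauchy_schwarz[OF MH[OF kG[OF w]] kfun_carrier[OF w]])
      also have "\<dots> \<le> (CM * hnorm G (k w)) * hnorm H (kfun w)"
        by (rule mult_right_mono[OF CM(2)[OF kG[OF w]] nn(1)])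
      finally show "hnorm G (k w) * hnorm G (k w) \<le> CM * hnorm H (kfun w) * hnorm G (k w)"
        by (simp add: power2_eq_square mult_ac)
    qed (use nn CM in auto)
    then have "(hnorm G (k w))\<^sup>2 \<le> CM\<^sup>2 * (hnorm H (kfun w))\<^sup>2"
      using nn power_mono by (metis power_mult_distrib)
    also have "\<dots> \<le> CM\<^sup>2 * growth l (1 - (cmod w)\<^sup>2)"
      by (rule mult_left_mono[OF kernel_growth(2)[OF w]]) simp
    finally show "Re (\<kappa> w w) \<le> CM\<^sup>2 * growth l (1 - (cmod w)\<^sup>2)"
      unfolding \<kappa>w .
  next
    show "0 < 1 / CL\<^sup>2 / 2" using CL(1) by simp
  next
    fix c a :: complex assume c: "cmod c = 1" and a: "cmod a < 1"
    define \<phi> where "\<phi> = moebius_map c a"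
    have \<phi>b: "\<phi> z \<in> ball 0 1" if "z \<in> ball 0 1" for z
      using norm_moebius_map[OF c a] that unfolding \<phi>_def by simp
    have "\<phi> \<in> moeb" unfolding \<phi>_def by (rule moebius_map_moeb[OF c a])
    then obtain A U where calc: "hol_calculus G S \<phi> A" and U: "bij_betw U (hcarrier G) (hcarrier G)"
      and Ui: "\<And>x y. x \<in> hcarrier G \<Longrightarrow> y \<in> hcarrier G \<Longrightarrow> hinner G (U x) (U y) = hinner G x y"
      and AU: "\<And>x. x \<in> hcarrier G \<Longrightarrow> A (U x) = U (S x)"
      using hom unfolding homogeneous_def unitarily_equivalent_def by metis
    have SG: "S x \<in> hcarrier G" if "x \<in> hcarrier G" for x
      using S[OF that] LG[OF TH[OF MH[OF that]]] by simp
    have res: "resolvent G S \<zeta> x = L (cauchy_mult \<zeta> (M x))" if \<zeta>: "1 < cmod \<zeta>" and x: "x \<in> hcarrier G" for \<zeta> x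
      unfolding resolvent_def
    proof (rule inv_into_f_eq)
      show "inj_on (\<lambda>y. hscale G \<zeta> y - S y) (hcarrier G)"
      proof (rule inj_on_inverseI[where g = "\<lambda>y. L (cauchy_mult \<zeta> (M y))"])
        fix y assume y: "y \<in> hcarrier G"
        have "M (hscale G \<zeta> y - S y) = hscale H \<zeta> (M y) - mult_z (M y)"
          unfolding bounded_op_diff[OF hG hH M G.carrier_scale[OF y] SG[OF y]] M_scale[OF y]
          unfolding S[OF y] MoL[OF TH[OF MH[OF y]]] ..
        then show "L (cauchy_mult \<zeta> (M (hscale G \<zeta> y - S y))) = y"
          by (simp only: cauchy_mult_inverse(2)[OF \<zeta> MH[OF y]] LoM[OF y])
      qed
      note cm = cauchy_mult_carrier[OF \<zeta> MH[OF x]]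
      show "L (cauchy_mult \<zeta> (M x)) \<in> hcarrier G" by (rule LG[OF cm])
      show "hscale G \<zeta> (L (cauchy_mult \<zeta> (M x))) - S (L (cauchy_mult \<zeta> (M x))) = x"
        unfolding S[OF LG[OF cm]] MoL[OF cm]
        unfolding L_scale[OF cm, symmetric]
          bounded_op_diff[OF hH hG L carrier_scale[OF cm] TH[OF cm], symmetric]
          cauchy_mult_inverse(1)[OF \<zeta> MH[OF x]] LoM[OF x] ..
    qed
    \<comment> \<open>The calculus is similarity invariant: \<open>\<phi>(S)\<close> corresponds to multiplication by \<open>\<phi>\<close>.\<close>
    have A: "hinner G (A x) (k w) = \<phi> w * hinner G x (k w)"
      if x: "x \<in> hcarrier G" and w: "w \<in> ball 0 1" for x w
    proof -
      obtain \<rho> F r where r: "1 < r" "r < \<rho>" and F: "F holomorphic_on ball 0 \<rho>" "\<forall>z\<in>ball 0 1. F z = \<phi> z"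
        and int: "((\<lambda>\<zeta>. F \<zeta> * hinner G (resolvent G S \<zeta> x) (k w)) has_contour_integral
             2 * of_real pi * \<i> * hinner G (A x) (k w)) (circlepath 0 r)"
        using calc x kG[OF w] unfolding hol_calculus_def by blast
      have "((\<lambda>\<zeta>. F \<zeta> * hinner G (resolvent G S \<zeta> x) (k w)) has_contour_integral
          M x w * (2 * of_real pi * \<i> * F w)) (circlepath 0 r)"
      proof (rule has_contour_integral_eq)
        show "((\<lambda>\<zeta>. M x w * (F \<zeta> / (\<zeta> - w))) has_contour_integral M x w * (2 * of_real pi * \<i> * F w)) (circlepath 0 r)"
          by (intro has_contour_integral_lmul Cauchy_integral_circlepath_simple)
            (use F r w in \<open>auto intro: holomorphic_on_subset\<close>)
        fix \<zeta> assume "\<zeta> \<in> path_image (circlepath 0 r)"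
        then have \<zeta>: "1 < cmod \<zeta>" using r by simp
        note cm = cauchy_mult_carrier[OF \<zeta> MH[OF x]]
        have "hinner G (resolvent G S \<zeta> x) (k w) = cauchy_mult \<zeta> (M x) w"
          unfolding res[OF \<zeta> x] k[OF w LG[OF cm]] MoL[OF cm] ..
        also have "\<dots> = M x w / (\<zeta> - w)"
          using w by (simp add: wcomp_def)
        finally show "M x w * (F \<zeta> / (\<zeta> - w)) = F \<zeta> * hinner G (resolvent G S \<zeta> x) (k w)"
          by simp
      qed
      from has_contour_integral_unique[OF int this]
      show ?thesis using F(2) w k[OF w x] by simp
    qed
    \<comment> \<open>\<open>u = U\<^sup>-\<^sup>1 (k w)\<close> is an eigenvector of the adjoint of \<open>S\<close>; seen in \<open>H\<close> through \<open>L\<close> it is \<open>v\<close>,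
      a multiple of the kernel function at \<open>\<phi> w\<close>.\<close>
    have "\<exists>\<gamma>. U (hscale G \<gamma> (k (\<phi> w))) = k w" if w: "w \<in> ball 0 1" for w
    proof -
      obtain u where u: "u \<in> hcarrier G" "U u = k w"
        using U kG[OF w] unfolding bij_betw_def by (metis imageE)
      have UG: "U x \<in> hcarrier G" if "x \<in> hcarrier G" for x
        using U that unfolding bij_betw_def by blast
      have Su: "hinner G (S x) u = \<phi> w * hinner G x u" if x: "x \<in> hcarrier G" for x
        using A[OF UG[OF x] w] unfolding AU[OF x] u(2)[symmetric] Ui[OF SG[OF x] u(1)] Ui[OF x u(1)] .
      obtain v where v: "v \<in> hcarrier H" "\<And>f. f \<in> hcarrier H \<Longrightarrow> hinner H f v = hinner G (L f) u"
      proof (rule riesz_functional[where ell = "\<lambda>f. hinner G (L f) u" and B = "CL * hnorm G u"])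
        show "hinner G (L (x + y)) u = hinner G (L x) u + hinner G (L y) u"
          if "x \<in> hcarrier H" "y \<in> hcarrier H" for x y
        proof -
          have "L (x + y) = L x + L y" using L that unfolding bounded_op_def by blast
          then show ?thesis using G.inner_add_left[OF LG[OF that(1)] LG[OF that(2)] u(1)] by simp
        qed
        show "hinner G (L (hscale H c x)) u = c * hinner G (L x) u" if "x \<in> hcarrier H" for c x
          unfolding L_scale[OF that] by (rule G.inner_scale_left[OF LG[OF that] u(1)])
        show "cmod (hinner G (L x) u) \<le> CL * hnorm G u * hnorm H x" if x: "x \<in> hcarrier H" for x
        proof -
          have "cmod (hinner G (L x) u) \<le> hnorm G (L x) * hnorm G u"
            by (rule G.cauchy_schwarz[OF LG[OF x] u(1)])
          also have "\<dots> \<le> (CL * hnorm H x) * hnorm G u"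
            by (rule mult_right_mono[OF CL(2)[OF x] G.hnorm_ge_0[OF u(1)]])
          finally show ?thesis by (simp only: mult_ac)
        qed
        show "0 \<le> CL * hnorm G u" using CL(1) G.hnorm_ge_0[OF u(1)] by simp
      qed blast
      have eigv: "hinner H (mult_z f) v = \<phi> w * hinner H f v" if f: "f \<in> hcarrier H" for f
        using Su[OF LG[OF f]] unfolding S[OF LG[OF f]] MoL[OF f] v(2)[OF f] v(2)[OF TH[OF f]] .
      have eig: "hinner H f v = hinner H one v * f (\<phi> w)" if f: "f \<in> hcarrier H" for f
        by (rule adjoint_eigenvector[OF v(1) \<phi>b[OF w] eigv f])
      define \<beta> where "\<beta> = hinner H one v"
      have xu: "hinner G x u = hinner G x (hscale G (cnj \<beta>) (k (\<phi> w)))" if x: "x \<in> hcarrier G" for x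
        using eig[OF MH[OF x]]
        unfolding v(2)[OF MH[OF x]] LoM[OF x] \<beta>_def[symmetric] k[OF \<phi>b[OF w] x, symmetric]
          G.inner_scale_right[OF x kG[OF \<phi>b[OF w]]] by simp
      define y where "y = u - hscale G (cnj \<beta>) (k (\<phi> w))"
      have sG: "hscale G (cnj \<beta>) (k (\<phi> w)) \<in> hcarrier G"
        by (rule G.carrier_scale[OF kG[OF \<phi>b[OF w]]])
      have yG: "y \<in> hcarrier G"
        unfolding y_def by (rule G.carrier_diff[OF u(1) sG])
      have "hinner G y y = 0"
        using xu[OF yG] G.inner_diff_right[OF yG u(1) sG] unfolding y_def[symmetric] by simp
      then have "hnorm G y = 0" unfolding hnorm_def by simp
      then have "y = 0" by (rule G.hnorm_eq_0[OF yG])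
      then have "u = hscale G (cnj \<beta>) (k (\<phi> w))" unfolding y_def by simp
      then show ?thesis using u(2) by blast
    qed
    then obtain \<gamma> where \<gamma>: "\<And>w. w \<in> ball 0 1 \<Longrightarrow> U (hscale G (\<gamma> w) (k (\<phi> w))) = k w"
      by metis
    have "\<kappa> z w = cnj (\<gamma> z) * \<kappa> (\<phi> z) (\<phi> w) * cnj (cnj (\<gamma> w))"
      if z: "z \<in> ball 0 1" and w: "w \<in> ball 0 1" for z w
    proof -
      note kz = kG[OF \<phi>b[OF z]] and kw = kG[OF \<phi>b[OF w]]
      have "\<kappa> z w = hinner G (U (hscale G (\<gamma> w) (k (\<phi> w)))) (U (hscale G (\<gamma> z) (k (\<phi> z))))"
        unfolding \<kappa>_def \<gamma>[OF z] \<gamma>[OF w] ..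
      also have "\<dots> = \<gamma> w * (cnj (\<gamma> z) * hinner G (k (\<phi> w)) (k (\<phi> z)))"
        unfolding Ui[OF G.carrier_scale[OF kw] G.carrier_scale[OF kz]]
          G.inner_scale_left[OF kw G.carrier_scale[OF kz]] G.inner_scale_right[OF kw kz] ..
      finally show ?thesis
        unfolding \<kappa>_def by simp
    qed
    then show "\<exists>g. \<forall>z\<in>ball 0 1. \<forall>w\<in>ball 0 1.
        \<kappa> z w = g z * \<kappa> (moebius_map c a z) (moebius_map c a w) * cnj (g w)"
      unfolding \<phi>_def by (intro exI[of _ "\<lambda>z. cnj (\<gamma> z)"]) blast
  qed
qed

end

theorem corollary5p4:
  fixes l :: real and H :: "(complex \<Rightarrow> complex) hilbert"
  assumes "l > 0"
    and "is_rkhs H (\<lambda>z w. dirichlet_kernel z w * power_kernel l z w)"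
  shows "moebius_bounded H mult_z \<and> weakly_homogeneous H mult_z \<and>
    \<not> (\<exists>(G :: 'b::ab_group_add hilbert) S. homogeneous G S \<and> similar_op H mult_z G S)"
proof -
  interpret dirichlet_power_space l H
    using assms by unfold_locales
  show ?thesis
    using moebius_bounded_mult_z weakly_homogeneous_mult_z not_similar_to_homogeneous by blast
qed

end
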